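(* Let $(\mathfrak g,\mathfrak a)$ be an almost abelian Lie algebra of real dimension $2n\ge 8$ with an integrable complex structure $J$ and a presentation $(\lambda,v,A)$. Let $z_2,\dots,z_n\in\mathbb C$ be the eigenvalues (with multiplicity) of $A$ seen as an endomorphism of $(\mathfrak a_J\otimes\mathbb C)^{1,0}$, and $u_j:=z_j+\bar z_j$ for $2\le j\le n$. Let $p$ be an integer with $2\le p\le n-2$. Then there exists a $p$-pluriclosed structure on $(\mathfrak g,J)$ if and only if $A$ is diagonalizable over $\mathbb C$ and, up to reordering the $u_j$'s: (i) either $p=n-2$, and there exists $k\in\{0,\dots,n-1\}$ such that $$u_2=\dots=u_{k+1}=t,\quad u_{k+2}=\dots=u_n=t+\lambda,\quad\text{for } t:=\frac{k+1-n}{n-2}\lambda;$$ (ii) or $2\le p\le n-3$, and one of the following four cases holds: (a) $u_2=\dots=u_n=0$; (b) $u_2=\dots=u_n=-\frac{\lambda}{p}$; (c) $u_2=\dots=u_{n-1}=0$, $u_n=-\lambda$, in which case $(\mathfrak g,J)$ admits a pluriclosed metric; (d) $u_2=\dots=u_{n-1}=-\frac{\lambda}{p}$, $u_n=\frac{p-1}{p}\lambda$.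
   Context: A real Lie algebra $\mathfrak g$ is almost abelian if it has an abelian ideal $\mathfrak a$ of codimension $1$. For an integrable complex structure $J$ put $\mathfrak a_J:=\mathfrak a\cap J\mathfrak a$; it is an ideal, and $\mathrm{ad}_x|_{\mathfrak a_J}$ commutes with $J|_{\mathfrak a_J}$ for all $x\in\mathfrak g$. Each $y\in\mathfrak a\setminus\mathfrak a_J$ determines $x:=-Jy$, $A:=\mathrm{ad}_x|_{\mathfrak a_J}\in\mathrm{End}(\mathfrak a_J)$, and $\lambda\in\mathbb R$, $v\in\mathfrak a_J$ by $[x,y]=\lambda y+v$; the triple $(\lambda,v,A)$ is the presentation of $(\mathfrak g,\mathfrak a,J)$ determined by $y$. Since $A$ commutes with $J$, its complex-linear extension preserves $(\mathfrak a_J\otimes\mathbb C)^{1,0}$. Forms are elements of $\Lambda\mathfrak g^*$ or its complexification, $d$ is the Chevalley–Eilenberg differential, $J$ acts on $1$-forms by $(J\phi)(Z)=-\phi(JZ)$ and multiplicatively on forms, and $d^c:=JdJ^{-1}$. A real $(p,p)$-form $\Omega$ on $(\mathfrak g,J)$ is transverse if for every $J$-invariant subspace $W\subset\mathfrak g$ of real dimension $2p$, $\Omega|_W$ is a positive multiple of $(i\gamma_1\wedge\bar\gamma_1)\wedge\dots\wedge(i\gamma_p\wedge\bar\gamma_p)$ for a basis $\gamma_1,\dots,\gamma_p$ of $\Lambda^{1,0}W^*$. A $p$-pluriclosed structure is a transverse real $(p,p)$-form $\Omega$ with $dd^c\Omega=0$. A pluriclosed metric is a Hermitian metric $g$ (a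 $J$-invariant positive definite scalar product) on $(\mathfrak g,J)$ whose fundamental form $\omega=g(J\cdot,\cdot)$ satisfies $dd^c\omega=0$. *)

theory Defs
  imports "HOL-Analysis.Analysis" "Jordan_Normal_Form.Char_Poly"
begin

section \<open>Lie algebras with a complex structure\<close>

text \<open>The underlying real vector space is a type of class \<open>euclidean_space\<close>, used only as a
  finite-dimensional real vector space: its inner product plays no role. A Lie algebra is given by
  its bracket.\<close>

definition lie_algebra :: "('a::real_vector \<Rightarrow> 'a \<Rightarrow> 'a) \<Rightarrow> bool" where
  "lie_algebra br \<longleftrightarrow> bilinear br \<and> (\<forall>x. br x x = 0) \<and>
     (\<forall>x y z. br x (br y z) + br y (br z x) + br z (br x y) = 0)"

definition almost_abelian :: "('a::euclidean_space \<Rightarrow> 'a \<Rightarrow> 'a) \<Rightarrow> 'a set \<Rightarrow> bool" where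
  "almost_abelian br \<aa> \<longleftrightarrow> lie_algebra br \<and>
     subspace \<aa> \<and> dim \<aa> + 1 = DIM('a) \<and>
     (\<forall>x. \<forall>y\<in>\<aa>. br x y \<in> \<aa>) \<and> (\<forall>x\<in>\<aa>. \<forall>y\<in>\<aa>. br x y = 0)"

definition complex_structure :: "('a::real_vector \<Rightarrow> 'a) \<Rightarrow> bool" where
  "complex_structure J \<longleftrightarrow> linear J \<and> (\<forall>x. J (J x) = - x)"

text \<open>Vanishing of the Nijenhuis tensor.\<close>

definition integrable_cs :: "('a::real_vector \<Rightarrow> 'a \<Rightarrow> 'a) \<Rightarrow> ('a \<Rightarrow> 'a) \<Rightarrow> bool" where
  "integrable_cs br J \<longleftrightarrow> complex_structure J \<and>
     (\<forall>x y. br (J x) (J y) - J (br (J x) y) - J (br x (J y)) - br x y = 0)"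

definition J_part :: "('a \<Rightarrow> 'a) \<Rightarrow> 'a set \<Rightarrow> 'a set" where
  "J_part J \<aa> = \<aa> \<inter> J ` \<aa>"

text \<open>Endomorphisms of a subspace are functions on the whole type of which only the values on the
  subspace matter.\<close>

definition presentation ::
  "('a::real_vector \<Rightarrow> 'a \<Rightarrow> 'a) \<Rightarrow> 'a set \<Rightarrow> ('a \<Rightarrow> 'a) \<Rightarrow> real \<Rightarrow> 'a \<Rightarrow> ('a \<Rightarrow> 'a) \<Rightarrow> bool" where
  "presentation br \<aa> J lam v A \<longleftrightarrow>
     (\<exists>y \<in> \<aa> - J_part J \<aa>.
        (\<forall>w \<in> J_part J \<aa>. A w = br (- J y) w) \<and>
        v \<in> J_part J \<aa> \<and> br (- J y) y = lam *\<^sub>R y + v)"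


section \<open>Complexification and eigenvalues\<close>

text \<open>The pair \<open>(u, w)\<close> stands for \<open>u + \<i> w\<close>. So \<open>S \<times> S\<close> is the complexification of a subspace
  \<open>S\<close>, and \<open>map_prod f f\<close> is the complex-linear extension of \<open>f\<close>.\<close>

definition cscale :: "complex \<Rightarrow> 'a::real_vector \<times> 'a \<Rightarrow> 'a \<times> 'a" where
  "cscale c x = (Re c *\<^sub>R fst x - Im c *\<^sub>R snd x, Im c *\<^sub>R fst x + Re c *\<^sub>R snd x)"

global_interpretation cx: vector_space "cscale :: complex \<Rightarrow> 'a::real_vector \<times> 'a \<Rightarrow> 'a \<times> 'a"
  by unfold_locales (auto simp: cscale_def algebra_simps)

definition cx_part10 :: "('a::real_vector \<Rightarrow> 'a) \<Rightarrow> 'a set \<Rightarrow> ('a \<times> 'a) set" where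
  "cx_part10 J S = {x \<in> S \<times> S. map_prod J J x = cscale \<i> x}"

definition diagonalizable_over_C :: "'a::real_vector set \<Rightarrow> ('a \<Rightarrow> 'a) \<Rightarrow> bool" where
  "diagonalizable_over_C S f \<longleftrightarrow>
     (\<exists>B. cx.independent B \<and> cx.span B = S \<times> S \<and> (\<forall>b\<in>B. \<exists>c. map_prod f f b = cscale c b))"

text \<open>\<open>(z j)\<close>, \<open>j \<in> I\<close>, lists the eigenvalues, with algebraic multiplicity, of the complex
  endomorphism \<open>F\<close> of \<open>V\<close>: the characteristic polynomial of the matrix of \<open>F\<close> in a basis of \<open>V\<close>
  is the product of the \<open>X - z j\<close>.\<close>

definition eigenvalues_with_mult ::
  "('a::real_vector \<times> 'a) set \<Rightarrow> ('a \<times> 'a \<Rightarrow> 'a \<times> 'a) \<Rightarrow> 'i set \<Rightarrow> ('i \<Rightarrow> complex) \<Rightarrow> bool" where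
  "eigenvalues_with_mult V F I z \<longleftrightarrow>
     (\<exists>m e M. inj_on e {..<m} \<and> cx.independent (e ` {..<m}) \<and> cx.span (e ` {..<m}) = V \<and>
        M \<in> carrier_mat m m \<and>
        (\<forall>j<m. F (e j) = (\<Sum>i<m. cscale (M $$ (i, j)) (e i))) \<and>
        char_poly M = (\<Prod>j\<in>I. [:- z j, 1:]))"


section \<open>Forms\<close>

text \<open>A \<open>k\<close>-form is a function of a sequence of vectors that depends only on the entries with index
  \<open>< k\<close>, in which it is multilinear and alternating. Real forms have values in \<open>real\<close>, elements of
  the complexified exterior algebra have values in \<open>complex\<close>.\<close>

definition kform :: "nat \<Rightarrow> ((nat \<Rightarrow> 'a::real_vector) \<Rightarrow> 'b::real_vector) \<Rightarrow> bool" where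
  "kform k \<omega> \<longleftrightarrow>
     (\<forall>v w. (\<forall>i<k. v i = w i) \<longrightarrow> \<omega> v = \<omega> w) \<and>
     (\<forall>v. \<forall>i<k. linear (\<lambda>x. \<omega> (v(i := x)))) \<and>
     (\<forall>v. \<forall>i<k. \<forall>j<k. i \<noteq> j \<and> v i = v j \<longrightarrow> \<omega> v = 0)"

definition omit :: "nat \<Rightarrow> (nat \<Rightarrow> 'a) \<Rightarrow> nat \<Rightarrow> 'a" where
  "omit l v = (\<lambda>m. if m < l then v m else v (Suc m))"

text \<open>Chevalley--Eilenberg differential of a \<open>k\<close>-form:
  \<open>d\<omega> (v\<^sub>0, \<dots>, v\<^sub>k)\<close> is the sum over \<open>i < j\<close> of
  \<open>(-1)\<^bsup>i+j\<^esup> \<omega> ([v\<^sub>i, v\<^sub>j], v\<^sub>0, \<dots>)\<close> with \<open>v\<^sub>i\<close>, \<open>v\<^sub>j\<close> omitted from the remaining arguments.\<close>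

definition ce_d :: "('a \<Rightarrow> 'a \<Rightarrow> 'a) \<Rightarrow> nat \<Rightarrow> ((nat \<Rightarrow> 'a) \<Rightarrow> 'b::real_vector) \<Rightarrow> (nat \<Rightarrow> 'a) \<Rightarrow> 'b" where
  "ce_d br k \<omega> v =
     (\<Sum>j\<le>k. \<Sum>i<j. (-1) ^ (i + j) *\<^sub>R \<omega> (case_nat (br (v i) (v j)) (omit i (omit j v))))"

text \<open>The multiplicative action of \<open>J\<close> determined by \<open>(J \<phi>) Z = - \<phi> (J Z)\<close> on 1-forms, and its
  inverse.\<close>

definition J_act :: "('a::real_vector \<Rightarrow> 'a) \<Rightarrow> ((nat \<Rightarrow> 'a) \<Rightarrow> 'b) \<Rightarrow> (nat \<Rightarrow> 'a) \<Rightarrow> 'b" where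
  "J_act J \<omega> v = \<omega> (\<lambda>i. - J (v i))"

definition J_act_inv :: "('a::real_vector \<Rightarrow> 'a) \<Rightarrow> ((nat \<Rightarrow> 'a) \<Rightarrow> 'b) \<Rightarrow> (nat \<Rightarrow> 'a) \<Rightarrow> 'b" where
  "J_act_inv J \<omega> v = \<omega> (\<lambda>i. J (v i))"

lemma J_act_inverse:
  assumes "complex_structure J"
  shows "J_act J (J_act_inv J \<omega>) = \<omega>" and "J_act_inv J (J_act J \<omega>) = \<omega>"
  using assms
  by (auto simp: J_act_def J_act_inv_def complex_structure_def fun_eq_iff linear_neg)

definition dc :: "('a::real_vector \<Rightarrow> 'a \<Rightarrow> 'a) \<Rightarrow> ('a \<Rightarrow> 'a) \<Rightarrow> nat \<Rightarrow>
    ((nat \<Rightarrow> 'a) \<Rightarrow> 'b::real_vector) \<Rightarrow> (nat \<Rightarrow> 'a) \<Rightarrow> 'b" where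
  "dc br J k \<omega> = J_act J (ce_d br k (J_act_inv J \<omega>))"

definition ddc_closed :: "('a::real_vector \<Rightarrow> 'a \<Rightarrow> 'a) \<Rightarrow> ('a \<Rightarrow> 'a) \<Rightarrow> nat \<Rightarrow>
    ((nat \<Rightarrow> 'a) \<Rightarrow> 'b::real_vector) \<Rightarrow> bool" where
  "ddc_closed br J k \<omega> \<longleftrightarrow> (\<forall>v. ce_d br (Suc k) (dc br J k \<omega>) v = 0)"

text \<open>The wedge product of the 1-forms \<open>\<phi> 0, \<dots>, \<phi> (k - 1)\<close>, that is
  \<open>(v\<^sub>0, \<dots>) \<mapsto> det (\<phi> i (v j))\<close>.\<close>

definition wedge1 :: "nat \<Rightarrow> (nat \<Rightarrow> 'a \<Rightarrow> complex) \<Rightarrow> (nat \<Rightarrow> 'a) \<Rightarrow> complex" where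
  "wedge1 k \<phi> v = (\<Sum>\<sigma> | \<sigma> permutes {..<k}. of_int (sign \<sigma>) * (\<Prod>i<k. \<phi> i (v (\<sigma> i))))"

text \<open>The (1,0)-forms on a \<open>J\<close>-invariant subspace \<open>W\<close>; values outside \<open>W\<close> are irrelevant.\<close>

definition forms10 :: "('a::real_vector \<Rightarrow> 'a) \<Rightarrow> 'a set \<Rightarrow> ('a \<Rightarrow> complex) set" where
  "forms10 J W = {\<gamma>. (\<forall>x\<in>W. \<forall>y\<in>W. \<gamma> (x + y) = \<gamma> x + \<gamma> y) \<and>
     (\<forall>r. \<forall>x\<in>W. \<gamma> (r *\<^sub>R x) = of_real r * \<gamma> x) \<and> (\<forall>x\<in>W. \<gamma> (J x) = \<i> * \<gamma> x)}"

definition basis10 :: "('a::real_vector \<Rightarrow> 'a) \<Rightarrow> 'a set \<Rightarrow> nat \<Rightarrow> (nat \<Rightarrow> 'a \<Rightarrow> complex) \<Rightarrow> bool" where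
  "basis10 J W p \<gamma> \<longleftrightarrow> (\<forall>j<p. \<gamma> j \<in> forms10 J W) \<and>
     (\<forall>c. (\<forall>x\<in>W. (\<Sum>j<p. c j * \<gamma> j x) = 0) \<longrightarrow> (\<forall>j<p. c j = 0)) \<and>
     (\<forall>\<phi>\<in>forms10 J W. \<exists>c. \<forall>x\<in>W. \<phi> x = (\<Sum>j<p. c j * \<gamma> j x))"

text \<open>The forms of type \<open>(p, q)\<close> are the complex linear combinations of wedge products of \<open>p\<close> forms
  of type (1,0) and \<open>q\<close> forms of type (0,1), the latter being the conjugates of the former.\<close>

definition pq_form :: "('a::real_vector \<Rightarrow> 'a) \<Rightarrow> nat \<Rightarrow> nat \<Rightarrow> ((nat \<Rightarrow> 'a) \<Rightarrow> complex) \<Rightarrow> bool" where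
  "pq_form J p q \<Omega> \<longleftrightarrow>
     (\<exists>(m::nat) c \<alpha> \<beta>. (\<forall>s<m. (\<forall>i<p. \<alpha> s i \<in> forms10 J UNIV) \<and> (\<forall>i<q. \<beta> s i \<in> forms10 J UNIV)) \<and>
        \<Omega> = (\<lambda>v. \<Sum>s<m. c s *
          wedge1 (p + q) (\<lambda>i. if i < p then \<alpha> s i else (\<lambda>x. cnj (\<beta> s (i - p) x))) v))"

definition real_pp_form :: "('a::real_vector \<Rightarrow> 'a) \<Rightarrow> nat \<Rightarrow> ((nat \<Rightarrow> 'a) \<Rightarrow> real) \<Rightarrow> bool" where
  "real_pp_form J p \<Omega> \<longleftrightarrow> kform (2 * p) \<Omega> \<and> pq_form J p p (\<lambda>v. of_real (\<Omega> v))"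

text \<open>\<open>(\<i> \<gamma>\<^sub>0 \<and> cnj \<gamma>\<^sub>0) \<and> \<dots> \<and> (\<i> \<gamma>\<^sub>p\<^sub>-\<^sub>1 \<and> cnj \<gamma>\<^sub>p\<^sub>-\<^sub>1)\<close>\<close>

definition positive_volume :: "nat \<Rightarrow> (nat \<Rightarrow> 'a \<Rightarrow> complex) \<Rightarrow> (nat \<Rightarrow> 'a) \<Rightarrow> complex" where
  "positive_volume p \<gamma> v = \<i> ^ p *
     wedge1 (2 * p) (\<lambda>i. if even i then \<gamma> (i div 2) else (\<lambda>x. cnj (\<gamma> (i div 2) x))) v"

definition transverse :: "('a::real_vector \<Rightarrow> 'a) \<Rightarrow> nat \<Rightarrow> ((nat \<Rightarrow> 'a) \<Rightarrow> real) \<Rightarrow> bool" where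
  "transverse J p \<Omega> \<longleftrightarrow> real_pp_form J p \<Omega> \<and>
     (\<forall>W. subspace W \<and> J ` W \<subseteq> W \<and> dim W = 2 * p \<longrightarrow>
        (\<exists>\<gamma> r. basis10 J W p \<gamma> \<and> r > 0 \<and>
           (\<forall>v. (\<forall>i<2 * p. v i \<in> W) \<longrightarrow> of_real (\<Omega> v) = of_real r * positive_volume p \<gamma> v)))"

definition p_pluriclosed_structure ::
  "('a::real_vector \<Rightarrow> 'a \<Rightarrow> 'a) \<Rightarrow> ('a \<Rightarrow> 'a) \<Rightarrow> nat \<Rightarrow> ((nat \<Rightarrow> 'a) \<Rightarrow> real) \<Rightarrow> bool" where
  "p_pluriclosed_structure br J p \<Omega> \<longleftrightarrow> transverse J p \<Omega> \<and> ddc_closed br J (2 * p) \<Omega>"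

definition hermitian_metric :: "('a::real_vector \<Rightarrow> 'a) \<Rightarrow> ('a \<Rightarrow> 'a \<Rightarrow> real) \<Rightarrow> bool" where
  "hermitian_metric J g \<longleftrightarrow> bilinear g \<and> (\<forall>x y. g x y = g y x) \<and> (\<forall>x. x \<noteq> 0 \<longrightarrow> g x x > 0) \<and>
     (\<forall>x y. g (J x) (J y) = g x y)"

definition pluriclosed_metric ::
  "('a::real_vector \<Rightarrow> 'a \<Rightarrow> 'a) \<Rightarrow> ('a \<Rightarrow> 'a) \<Rightarrow> ('a \<Rightarrow> 'a \<Rightarrow> real) \<Rightarrow> bool" where
  "pluriclosed_metric br J g \<longleftrightarrow>
     hermitian_metric J g \<and> ddc_closed br J 2 (\<lambda>v. g (J (v 0)) (v 1))"

end

theory Submission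
  imports Defs "Jordan_Normal_Form.Jordan_Normal_Form_Existence"
begin

text \<open>
  Fix \<open>y\<close> as in the presentation, put \<open>x = - J y\<close>, and let \<open>\<hh>\<close> be the complex hyperplane
  \<open>\<aa> \<inter> J \<aa>\<close>, so that the algebra is \<open>\<real> x + \<real> y + \<hh>\<close>. Let \<open>\<xi>\<close> and \<open>\<eta> = J \<xi>\<close> be the forms dual to
  \<open>x\<close> and \<open>y\<close>, and \<open>D = ad x\<close>. As \<open>\<aa>\<close> is abelian, \<open>[a, b] = \<xi> a * D b - \<xi> b * D a\<close>, and therefore
  \<open>d \<omega> = - \<xi> \<and> D.\<omega>\<close>, where \<open>D.\<omega>\<close> is the derivation that inserts \<open>D\<close> into each argument in turn
  (\<open>ce_d_almost_abelian\<close>). Applying this twice to a \<open>J\<close>-invariant form, and using \<open>D.\<eta> = lam * \<eta>\<close>,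
  gives \<open>d d\<^sup>c \<Omega> = \<xi> \<and> \<eta> \<and> \<tau>\<close> with a form \<open>\<tau>\<close> that equals \<open>(D + lam).(D.\<Omega>)\<close> on \<open>\<hh>\<close>. Hence the
  pluriclosed equation only concerns the restriction \<open>\<rho>\<close> of \<open>\<Omega>\<close> to \<open>\<hh>\<close>, where \<open>D\<close> is \<open>A\<close>: it says
  \<open>A.(A.\<rho>) + lam * A.\<rho> = 0\<close> (\<open>ddc_closed_iff\<close>).

  Necessity. Choose a complex Jordan basis of \<open>\<hh>\<close> for \<open>A\<close>, and recall that a transverse form does
  not vanish on \<open>(w\<^sub>1, J w\<^sub>1, w\<^sub>2, J w\<^sub>2, \<dots>)\<close> for \<open>p\<close> linearly independent vectors \<open>w\<^sub>i\<close>
  (\<open>transverse_frame_nonzero\<close>). If \<open>A\<close> has a nontrivial Jordan block, there is an invariant subspace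
  \<open>F\<close> of dimension \<open>p - 1\<close> with a Jordan pair \<open>e\<^sub>1, e\<^sub>2\<close> on top of it. Inserting a basis of \<open>F\<close> into \<open>\<rho>\<close>
  leaves a Hermitian form on the span of \<open>e\<^sub>1, e\<^sub>2\<close>, on which \<open>A\<close> acts as \<open>s + N\<close> with a real number \<open>s\<close>
  and \<open>N\<close> nilpotent; evaluating \<open>(s + N) (s + N + lam) = 0\<close> on the pair forces the value at \<open>e\<^sub>1\<close> to
  vanish, contrary to transversality (\<open>pluriclosed_imp_diagonal\<close>). So \<open>A\<close> is diagonalizable, and
  evaluating on \<open>p\<close> eigenvectors with indices in \<open>I\<close> gives \<open>s * (s + lam) = 0\<close> for
  \<open>s = (\<Sum>j\<in>I. u j)\<close> (\<open>pluriclosed_imp_trace\<close>).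

  Sufficiency. If \<open>A\<close> is diagonal and every sum of \<open>p\<close> of the \<open>u j\<close> is \<open>0\<close> or \<open>- lam\<close>, let \<open>\<gamma> j\<close> be
  the (1,0)-forms dual to \<open>x\<close> and the eigenvectors, and \<open>\<omega>\<close> the sum of the \<open>\<i> \<gamma> j \<and> cnj (\<gamma> j)\<close>.
  The power \<open>\<omega>\<^sup>p\<close> is transverse, because on a \<open>p\<close>-dimensional complex subspace its summands are the
  squared moduli of the maximal minors of a matrix of rank \<open>p\<close>; and on \<open>\<hh>\<close> each summand is an eigenform of
  the derivation \<open>A\<close> with eigenvalue \<open>0\<close> or \<open>- lam\<close> (\<open>diagonal_imp_pluriclosed\<close>). For \<open>p = 1\<close>
  the same argument yields the pluriclosed metric.

  It remains to see which families of \<open>n - 1\<close> numbers have all their sums of \<open>p\<close> members in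
  \<open>{0, - lam}\<close>. Exchanging one summand shows that there are at most two values \<open>t\<close> and \<open>t + lam\<close>; counting
  how often the second one can occur in a sum gives the list (\<open>subset_sums_classification\<close> and
  \<open>subset_sums_of_classification\<close>).
\<close>

(* The plain name refers to real subspaces from here on. *)
hide_const (open) VectorSpace.subspace

section \<open>Alternating forms\<close>

lemma kform_cong: "kform k \<omega> \<Longrightarrow> (\<And>i. i < k \<Longrightarrow> v i = w i) \<Longrightarrow> \<omega> v = \<omega> w"
  by (simp add: kform_def)

lemma kform_linear: "kform k \<omega> \<Longrightarrow> i < k \<Longrightarrow> linear (\<lambda>x. \<omega> (v(i := x)))"
  unfolding kform_def by blast

lemma kform_alternating:
  "kform k \<omega> \<Longrightarrow> i < k \<Longrightarrow> j < k \<Longrightarrow> i \<noteq> j \<Longrightarrow> v i = v j \<Longrightarrow> \<omega> v = 0"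
  unfolding kform_def by blast

lemma kform_add:
  "kform k \<omega> \<Longrightarrow> i < k \<Longrightarrow> \<omega> (v(i := x + y)) = \<omega> (v(i := x)) + \<omega> (v(i := y))"
  using linear_add[OF kform_linear] by blast

lemma kform_diff:
  "kform k \<omega> \<Longrightarrow> i < k \<Longrightarrow> \<omega> (v(i := x - y)) = \<omega> (v(i := x)) - \<omega> (v(i := y))"
  using linear_diff[OF kform_linear] by blast

lemma kform_scale:
  "kform k \<omega> \<Longrightarrow> i < k \<Longrightarrow> \<omega> (v(i := c *\<^sub>R x)) = c *\<^sub>R \<omega> (v(i := x))"
  using linear_scale[OF kform_linear] by blast

lemma kform_swap:
  fixes \<omega> :: "(nat \<Rightarrow> 'a::real_vector) \<Rightarrow> 'b::real_vector"
  assumes k: "kform k \<omega>" and ij: "i < k" "j < k" "i \<noteq> j"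
  shows "\<omega> (v(i := x, j := y)) = - \<omega> (v(i := y, j := x))"
proof -
  let ?f = "\<lambda>a b. \<omega> (v(i := a, j := b))"
  have z: "?f a a = 0" for a
    by (rule kform_alternating[OF k ij]) (use ij in auto)
  have r: "?f (a + b) c = ?f a c + ?f b c" for a b c
    using kform_add[OF k ij(1), of "v(j := c)" a b] ij(3) by (simp add: fun_upd_twist)
  have l: "?f c (a + b) = ?f c a + ?f c b" for a b c
    by (rule kform_add[OF k ij(2)])
  have "?f (x + y) (x + y) = (?f x x + ?f x y) + (?f y x + ?f y y)"
    unfolding r l by (simp only: ac_simps)
  then have "?f x y + ?f y x = 0"
    by (metis z add_0_left add_0_right)
  then show ?thesis by (simp add: eq_neg_iff_add_eq_0)
qed

text \<open>Only the component of the new entry along the old one is seen by an alternating form: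
  the other entries span vectors that it kills.\<close>

lemma kform_replace_slot:
  fixes \<omega> :: "(nat \<Rightarrow> 'a::real_vector) \<Rightarrow> 'b::real_vector"
  assumes k: "kform k \<omega>" and i: "i < k"
    and u: "u - c *\<^sub>R v i \<in> span (v ` ({..<k} - {i}))"
  shows "\<omega> (v(i := u)) = c *\<^sub>R \<omega> v"
proof -
  have "\<omega> (v(i := s)) = 0" if "s \<in> span (v ` ({..<k} - {i}))" for s
    using that
  proof (induction rule: span_induct_alt)
    case base
    show ?case using linear_0[OF kform_linear[OF k i]] by blast
  next
    case (step c x y)
    then obtain j where j: "j < k" "j \<noteq> i" "x = v j" by auto
    have "\<omega> (v(i := x)) = 0"
      by (rule kform_alternating[OF k i j(1)]) (use j in auto)
    then have "\<omega> (v(i := c *\<^sub>R x + y)) = \<omega> (v(i := y))"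
      by (simp only: kform_add[OF k i] kform_scale[OF k i] scaleR_zero_right add_0_left)
    with step show ?case by (simp only:)
  qed
  from this[OF u] have "\<omega> (v(i := u - c *\<^sub>R v i)) = 0" .
  then show ?thesis by (simp add: kform_diff[OF k i] kform_scale[OF k i])
qed

text \<open>The differential puts a bracket in front of the other arguments. This moves it to the place
  of the argument from which it comes, past the \<open>l\<close> arguments before that place.\<close>

lemma kform_to_front:
  fixes \<omega> :: "(nat \<Rightarrow> 'a::real_vector) \<Rightarrow> 'b::real_vector"
  assumes k: "kform k \<omega>"
  shows "l < k \<Longrightarrow> \<omega> (case_nat u (omit l w)) = (-1) ^ l *\<^sub>R \<omega> (w(l := u))"
proof (induction l arbitrary: w)
  case 0
  have "case_nat u (omit 0 w) = w(0 := u)"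
    by (auto simp: fun_eq_iff omit_def split: nat.split)
  then show ?case by simp
next
  case (Suc l)
  let ?w = "w(Suc l := w l)"
  have "case_nat u (omit (Suc l) w) = case_nat u (omit l ?w)"
    by (rule ext) (auto simp: fun_eq_iff omit_def less_Suc_eq split: nat.split)
  then have "\<omega> (case_nat u (omit (Suc l) w)) = \<omega> (case_nat u (omit l ?w))"
    by (rule arg_cong)
  also have "\<dots> = (-1) ^ l *\<^sub>R \<omega> (?w(l := u))"
    using Suc.prems by (intro Suc.IH) auto
  also have "?w(l := u) = w(l := u, Suc l := w l)"
    by (auto simp: fun_eq_iff)
  also have "\<omega> \<dots> = - \<omega> (w(l := w l, Suc l := u))"
    using Suc.prems by (intro kform_swap[OF k]) auto
  finally show ?case
    by (simp only: fun_upd_triv power_Suc scaleR_minus_right mult_minus1 scaleR_minus_left)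
qed

subsection \<open>The derivation of an endomorphism\<close>

text \<open>The derivation of the exterior algebra that extends the transpose of \<open>D\<close> on 1-forms. It is the
  Lie derivative only up to sign.\<close>

definition deriv_act ::
  "('a \<Rightarrow> 'a) \<Rightarrow> nat \<Rightarrow> ((nat \<Rightarrow> 'a) \<Rightarrow> 'b::real_vector) \<Rightarrow> (nat \<Rightarrow> 'a) \<Rightarrow> 'b" where
  "deriv_act D k \<omega> v = (\<Sum>l<k. \<omega> (v(l := D (v l))))"

lemma kform_deriv_act:
  fixes \<omega> :: "(nat \<Rightarrow> 'a::real_vector) \<Rightarrow> 'b::real_vector"
  assumes k: "kform k \<omega>" and D: "linear D"
  shows "kform k (deriv_act D k \<omega>)"
  unfolding kform_def
proof (intro conjI allI impI)
  fix v w :: "nat \<Rightarrow> 'a"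
  assume "\<forall>i<k. v i = w i"
  then show "deriv_act D k \<omega> v = deriv_act D k \<omega> w"
    unfolding deriv_act_def by (intro sum.cong refl kform_cong[OF k]) auto
next
  fix v :: "nat \<Rightarrow> 'a" and i
  assume i: "i < k"
  have "linear (\<lambda>x. \<omega> ((v(i := x))(l := D ((v(i := x)) l))))" if l: "l < k" for l
  proof (cases "l = i")
    case True
    have "linear ((\<lambda>x. \<omega> (v(i := x))) \<circ> D)"
      by (intro linear_compose D kform_linear[OF k i])
    then show ?thesis using True by (simp add: o_def)
  next
    case False
    have "linear (\<lambda>x. \<omega> ((v(l := D (v l)))(i := x)))" by (rule kform_linear[OF k i])
    moreover have "(\<lambda>x. \<omega> ((v(l := D (v l)))(i := x))) = (\<lambda>x. \<omega> ((v(i := x))(l := D ((v(i := x)) l))))"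
      using False by (simp add: fun_upd_twist)
    ultimately show ?thesis by simp
  qed
  then show "linear (\<lambda>x. deriv_act D k \<omega> (v(i := x)))"
    unfolding deriv_act_def by (intro linear_compose_sum) auto
next
  fix v :: "nat \<Rightarrow> 'a" and i j
  assume ij: "i < k" "j < k" "i \<noteq> j \<and> v i = v j"
  have "\<omega> (v(l := D (v l))) = 0" if "l < k" "l \<noteq> i" "l \<noteq> j" for l
    by (rule kform_alternating[OF k ij(1,2)]) (use ij that in auto)
  then have "deriv_act D k \<omega> v = (\<Sum>l\<in>{i, j}. \<omega> (v(l := D (v l))))"
    unfolding deriv_act_def using ij by (intro sum.mono_neutral_right) auto
  also have "\<dots> = \<omega> (v(i := D (v i), j := v i)) + \<omega> (v(i := v i, j := D (v i)))"
    using ij by (simp add: fun_upd_idem)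
  also have "\<dots> = 0"
    using ij by (subst kform_swap[OF k ij(1,2)]) auto
  finally show "deriv_act D k \<omega> v = 0" .
qed

subsection \<open>The product of a 1-form and a form\<close>

definition wedge_left ::
  "('a \<Rightarrow> real) \<Rightarrow> nat \<Rightarrow> ((nat \<Rightarrow> 'a) \<Rightarrow> 'b::real_vector) \<Rightarrow> (nat \<Rightarrow> 'a) \<Rightarrow> 'b" where
  "wedge_left \<phi> k \<omega> v = (\<Sum>i\<le>k. ((-1) ^ i * \<phi> (v i)) *\<^sub>R \<omega> (omit i v))"

lemma omit_upd_same [simp]: "omit i (v(i := x)) = omit i v"
  by (auto simp: omit_def fun_eq_iff)

lemma omit_upd_less: "l < i \<Longrightarrow> omit i (v(l := x)) = (omit i v)(l := x)"
  by (auto simp: omit_def fun_eq_iff)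

lemma omit_upd_Suc: "i \<le> l \<Longrightarrow> omit i (v(Suc l := x)) = (omit i v)(l := x)"
  by (auto simp: omit_def fun_eq_iff)

text \<open>Moving a repeated entry from one of its places to the other is a cyclic permutation of the
  entries in between, which gives the sign by which the two corresponding terms cancel.\<close>

lemma kform_omit_repeated:
  fixes \<omega> :: "(nat \<Rightarrow> 'a::real_vector) \<Rightarrow> 'b::real_vector"
  assumes k: "kform k \<omega>" and ij: "i < j" "j \<le> k" and v: "v i = v j"
  shows "(-1) ^ i *\<^sub>R \<omega> (omit i v) + (-1) ^ j *\<^sub>R \<omega> (omit j v) = 0"
proof -
  define w where "w = omit i v"
  have 1: "omit i v = w(j - 1 := v i)"
    using ij v by (auto simp: w_def omit_def fun_eq_iff)
  have 2: "omit j v = (omit j v)(i := v i)"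
    using ij by (auto simp: omit_def fun_eq_iff)
  have 3: "omit (j - 1) w = omit i (omit j v)"
    using ij by (auto simp: w_def omit_def fun_eq_iff)
  have "(-1) ^ (j - 1) *\<^sub>R \<omega> (w(j - 1 := v i)) = \<omega> (case_nat (v i) (omit (j - 1) w))"
    using ij by (intro kform_to_front[OF k, symmetric]) auto
  also have "\<dots> = (-1) ^ i *\<^sub>R \<omega> ((omit j v)(i := v i))"
    unfolding 3 using ij by (intro kform_to_front[OF k]) auto
  finally have *: "(-1) ^ (j - 1) *\<^sub>R \<omega> (omit i v) = (-1) ^ i *\<^sub>R \<omega> (omit j v)"
    using 1 2 by simp
  have s: "(-1::real) ^ j = - ((-1) ^ (j - 1))"
    using ij by (cases j) auto
  have "(-1) ^ i *\<^sub>R (-1) ^ i *\<^sub>R \<omega> (omit j v) = \<omega> (omit j v)"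
    by (cases "even i") auto
  then have "\<omega> (omit j v) = (-1) ^ i *\<^sub>R (-1) ^ (j - 1) *\<^sub>R \<omega> (omit i v)"
    unfolding * by simp
  then show ?thesis unfolding s
    by (cases "even i"; cases "even (j - 1)") simp_all
qed

lemma kform_wedge_left:
  fixes \<omega> :: "(nat \<Rightarrow> 'a::real_vector) \<Rightarrow> 'b::real_vector"
  assumes k: "kform k \<omega>" and \<phi>: "linear \<phi>"
  shows "kform (Suc k) (wedge_left \<phi> k \<omega>)"
  unfolding kform_def
proof (intro conjI allI impI)
  fix v w :: "nat \<Rightarrow> 'a"
  assume "\<forall>i<Suc k. v i = w i"
  then show "wedge_left \<phi> k \<omega> v = wedge_left \<phi> k \<omega> w"
    unfolding wedge_left_def
    by (intro sum.cong refl arg_cong2[where f = "(*\<^sub>R)"] kform_cong[OF k]) (auto simp: omit_def)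
next
  fix v :: "nat \<Rightarrow> 'a" and l
  assume l: "l < Suc k"
  have "linear (\<lambda>x. ((-1) ^ i * \<phi> ((v(l := x)) i)) *\<^sub>R \<omega> (omit i (v(l := x))))" if i: "i \<le> k" for i
  proof -
    consider "l = i" | "l < i" | l' where "l = Suc l'" "i \<le> l'"
      by (metis less_imp_Suc_add linorder_neqE_nat le_add1)
    then show ?thesis
    proof cases
      case 1
      then show ?thesis
        by (intro linearI) (simp_all add: linear_add[OF \<phi>] linear_scale[OF \<phi>] algebra_simps)
    next
      case 2
      then show ?thesis using i
        by (intro linearI) (simp_all add: omit_upd_less kform_add[OF k] kform_scale[OF k] algebra_simps)
    next
      case 3
      then show ?thesis using i l
        by (intro linearI) (simp_all add: omit_upd_Suc kform_add[OF k] kform_scale[OF k] algebra_simps)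
    qed
  qed
  then show "linear (\<lambda>x. wedge_left \<phi> k \<omega> (v(l := x)))"
    unfolding wedge_left_def by (intro linear_compose_sum) auto
next
  have *: "wedge_left \<phi> k \<omega> v = 0" if ij: "i < j" "j \<le> k" "v i = v j" for v :: "nat \<Rightarrow> 'a" and i j
  proof -
    have "\<omega> (omit l v) = 0" if l: "l \<le> k" "l \<noteq> i" "l \<noteq> j" for l
    proof (rule kform_alternating[OF k])
      let ?i = "if i < l then i else i - 1" and ?j = "if j < l then j else j - 1"
      show "?i < k" "?j < k" "?i \<noteq> ?j" "omit l v ?i = omit l v ?j"
        using ij l by (auto simp: omit_def)
    qed
    then have "wedge_left \<phi> k \<omega> v = (\<Sum>l\<in>{i, j}. ((-1) ^ l * \<phi> (v l)) *\<^sub>R \<omega> (omit l v))"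
      unfolding wedge_left_def using ij by (intro sum.mono_neutral_right) auto
    also have "\<dots> = \<phi> (v j) *\<^sub>R ((-1) ^ i *\<^sub>R \<omega> (omit i v) + (-1) ^ j *\<^sub>R \<omega> (omit j v))"
      using ij by (simp add: algebra_simps)
    also have "\<dots> = 0"
      by (simp only: kform_omit_repeated[OF k ij] scaleR_zero_right)
    finally show ?thesis .
  qed
  fix v :: "nat \<Rightarrow> 'a" and i j
  assume ij: "i < Suc k" "j < Suc k" "i \<noteq> j \<and> v i = v j"
  then consider "i < j" | "j < i" by linarith
  then show "wedge_left \<phi> k \<omega> v = 0"
  proof cases
    case 1
    with ij show ?thesis by (intro *[of i j]) auto
  next
    case 2
    with ij show ?thesis by (intro *[of j i]) auto
  qed
qed

lemma deriv_act_wedge_left: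
  "deriv_act D (Suc k) (wedge_left \<phi> k \<omega>) v =
     wedge_left (\<lambda>x. \<phi> (D x)) k \<omega> v + wedge_left \<phi> k (deriv_act D k \<omega>) v"
proof -
  let ?t = "\<lambda>i l. ((-1) ^ i * \<phi> ((v(l := D (v l))) i)) *\<^sub>R \<omega> (omit i (v(l := D (v l))))"
  have "deriv_act D (Suc k) (wedge_left \<phi> k \<omega>) v = (\<Sum>i\<le>k. \<Sum>l\<le>k. ?t i l)"
    unfolding deriv_act_def wedge_left_def lessThan_Suc_atMost by (rule sum.swap)
  also have "\<dots> = (\<Sum>i\<le>k. ((-1) ^ i * \<phi> (D (v i))) *\<^sub>R \<omega> (omit i v) +
      ((-1) ^ i * \<phi> (v i)) *\<^sub>R deriv_act D k \<omega> (omit i v))"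
  proof (intro sum.cong refl)
    fix i assume i: "i \<in> {..k}"
    have "(\<Sum>l\<in>{..k} - {i}. ?t i l) =
        (\<Sum>l<k. ((-1) ^ i * \<phi> (v i)) *\<^sub>R \<omega> ((omit i v)(l := D (omit i v l))))"
    proof (rule sum.reindex_bij_witness[where j = "\<lambda>l. if l < i then l else l - 1"
          and i = "\<lambda>l. if l < i then l else Suc l"], goal_cases)
      case (5 l)
      show ?case
      proof (cases "l < i")
        case True
        then have "omit i v l = v l" by (simp add: omit_def)
        with True show ?thesis by (simp add: omit_upd_less)
      next
        case False
        with 5 obtain l' where l: "l = Suc l'" "i \<le> l'" by (cases l) auto
        then have "omit i v l' = v l" by (simp add: omit_def)
        with l show ?thesis by (simp add: omit_upd_Suc)
      qed
    qed (use i in auto)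
    then have "(\<Sum>l\<in>{..k} - {i}. ?t i l) = ((-1) ^ i * \<phi> (v i)) *\<^sub>R deriv_act D k \<omega> (omit i v)"
      by (simp add: deriv_act_def scaleR_sum_right)
    moreover have "(\<Sum>l\<le>k. ?t i l) = ?t i i + (\<Sum>l\<in>{..k} - {i}. ?t i l)"
      using i by (intro sum.remove) auto
    ultimately show "(\<Sum>l\<le>k. ?t i l) = ((-1) ^ i * \<phi> (D (v i))) *\<^sub>R \<omega> (omit i v) +
        ((-1) ^ i * \<phi> (v i)) *\<^sub>R deriv_act D k \<omega> (omit i v)"
      by simp
  qed
  finally show ?thesis by (simp add: wedge_left_def sum.distrib)
qed

lemma wedge_left_front:
  assumes "\<And>i. i < k \<Longrightarrow> \<phi> (w i) = 0"
  shows "wedge_left \<phi> k \<omega> (case_nat a w) = \<phi> a *\<^sub>R \<omega> w"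
proof -
  have e: "omit 0 (case_nat a w) = w"
    by (auto simp: omit_def fun_eq_iff)
  have "wedge_left \<phi> k \<omega> (case_nat a w) =
      (\<Sum>i\<in>{0}. ((-1) ^ i * \<phi> (case_nat a w i)) *\<^sub>R \<omega> (omit i (case_nat a w)))"
    unfolding wedge_left_def
    by (rule sum.mono_neutral_right) (use assms in \<open>auto split: nat.split\<close>)
  then show ?thesis by (simp add: e)
qed

text \<open>An entry on which \<open>\<phi>\<close> does not vanish must equal \<open>a\<close>. If it occurs twice the product
  vanishes, being alternating; if it occurs once, the only term left omits it.\<close>

lemma wedge_left_zero:
  fixes \<omega> :: "(nat \<Rightarrow> 'b::real_vector) \<Rightarrow> 'c::real_vector"
  assumes k: "kform k \<omega>" and \<phi>: "linear \<phi>"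
    and a: "\<And>i. i \<le> k \<Longrightarrow> \<phi> (w i) = 0 \<or> w i = a"
    and \<omega>: "\<And>u. (\<And>i. i < k \<Longrightarrow> u i \<in> w ` {..k} \<and> \<phi> (u i) = 0) \<Longrightarrow> \<omega> u = 0"
  shows "wedge_left \<phi> k \<omega> w = 0"
proof (cases "\<exists>i j. i \<le> k \<and> j \<le> k \<and> i \<noteq> j \<and> \<phi> (w i) \<noteq> 0 \<and> \<phi> (w j) \<noteq> 0")
  case True
  then obtain i j where "i \<le> k" "j \<le> k" "i \<noteq> j" "w i = w j"
    using a by metis
  then show ?thesis
    by (intro kform_alternating[OF kform_wedge_left[OF k \<phi>], of i j]) auto
next
  case False
  have "((-1) ^ i * \<phi> (w i)) *\<^sub>R \<omega> (omit i w) = 0" if i: "i \<le> k" for i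
  proof (cases "\<phi> (w i) = 0")
    case ne: False
    have "\<omega> (omit i w) = 0"
    proof (rule \<omega>)
      fix j assume j: "j < k"
      let ?j = "if j < i then j else Suc j"
      have e: "omit i w j = w ?j" and l: "?j \<le> k" "?j \<noteq> i"
        using j by (auto simp: omit_def)
      have "\<phi> (w ?j) = 0" using False i ne l by blast
      then show "omit i w j \<in> w ` {..k} \<and> \<phi> (omit i w j) = 0"
        unfolding e using l by blast
    qed
    then show ?thesis by simp
  qed simp
  then show ?thesis
    unfolding wedge_left_def by (intro sum.neutral ballI) blast
qed

section \<open>The Chevalley--Eilenberg differential of an almost abelian algebra\<close>

lemma omit_omit: "i < j \<Longrightarrow> omit i (omit j v) = omit (j - 1) (omit i v)"
  by (auto simp: omit_def fun_eq_iff)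

text \<open>A pair \<open>i \<noteq> j\<close> of indices is recorded as \<open>i\<close> together with the place of \<open>j\<close> in the sequence
  that omits \<open>i\<close>, which is \<open>j - 1\<close> or \<open>j\<close>.\<close>

lemma sum_pairs_reindex:
  fixes g :: "nat \<Rightarrow> nat \<Rightarrow> 'b::comm_monoid_add"
  shows "(\<Sum>j\<le>k. \<Sum>i<j. g i (j - 1)) + (\<Sum>j\<le>k. \<Sum>i<j. g j i) = (\<Sum>i\<le>k. \<Sum>l<k. g i l)"
proof (induction k)
  case (Suc k)
  have "(\<Sum>j\<le>Suc k. \<Sum>i<j. g i (j - 1)) + (\<Sum>j\<le>Suc k. \<Sum>i<j. g j i) =
      (\<Sum>i\<le>k. \<Sum>l<k. g i l) + (\<Sum>i\<le>k. g i k) + (\<Sum>l\<le>k. g (Suc k) l)"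
    using Suc.IH[symmetric] by (simp add: lessThan_Suc_atMost ac_simps)
  then show ?case
    by (simp add: sum.distrib lessThan_Suc_atMost[symmetric] ac_simps)
qed simp

text \<open>Each bracket \<open>[v\<^sub>i, v\<^sub>j]\<close> splits into a term with \<open>D v\<^sub>j\<close> in the place of \<open>v\<^sub>j\<close> and the
  coefficient \<open>\<xi> v\<^sub>i\<close>, and one with the roles exchanged; collected by the omitted index \<open>i\<close>, the
  terms form a derivation.\<close>

lemma ce_d_almost_abelian:
  fixes \<omega> :: "(nat \<Rightarrow> 'a::real_vector) \<Rightarrow> 'b::real_vector"
  assumes k: "kform k \<omega>" and br: "\<And>a b. br a b = \<xi> a *\<^sub>R D b - \<xi> b *\<^sub>R D a"
  shows "ce_d br k \<omega> v = - wedge_left \<xi> k (deriv_act D k \<omega>) v"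
proof -
  define g where "g i l = ((-1) ^ i * \<xi> (v i)) *\<^sub>R \<omega> ((omit i v)(l := D (omit i v l)))" for i l
  have t: "(-1) ^ (i + j) *\<^sub>R \<omega> (case_nat (br (v i) (v j)) (omit i (omit j v))) =
      - (g i (j - 1) + g j i)" if ij: "i < j" "j \<le> k" for i j
  proof -
    let ?r = "omit i (omit j v)"
    define e where "e = case_nat 0 ?r"
    have u: "case_nat x ?r = e(0 := x)" for x
      by (auto simp: e_def fun_eq_iff split: nat.split)
    have 0: "0 < k" using ij by simp
    have "\<omega> (case_nat (br (v i) (v j)) ?r) =
        \<xi> (v i) *\<^sub>R \<omega> (case_nat (D (v j)) ?r) - \<xi> (v j) *\<^sub>R \<omega> (case_nat (D (v i)) ?r)"
      unfolding br by (simp only: u kform_diff[OF k 0] kform_scale[OF k 0])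
    also have "\<omega> (case_nat (D (v i)) ?r) = (-1) ^ i *\<^sub>R \<omega> ((omit j v)(i := D (v i)))"
      using ij by (intro kform_to_front[OF k]) auto
    also have "\<omega> (case_nat (D (v j)) ?r) = (-1) ^ (j - 1) *\<^sub>R \<omega> ((omit i v)(j - 1 := D (v j)))"
      unfolding omit_omit[OF ij(1)] using ij by (intro kform_to_front[OF k]) auto
    finally have c: "\<omega> (case_nat (br (v i) (v j)) ?r) =
        \<xi> (v i) *\<^sub>R (-1) ^ (j - 1) *\<^sub>R \<omega> ((omit i v)(j - 1 := D (v j))) -
        \<xi> (v j) *\<^sub>R (-1) ^ i *\<^sub>R \<omega> ((omit j v)(i := D (v i)))" .
    have n: "omit j v i = v i" "omit i v (j - 1) = v j" using ij by (cases j; simp add: omit_def)+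
    have s: "(-1::real) ^ (i + j) * (-1) ^ (j - 1) = - ((-1) ^ i)"
      "(-1::real) ^ (i + j) * (-1) ^ i = (-1) ^ j"
      using ij by (cases "even i"; cases "even j"; simp)+
    have "(-1) ^ (i + j) *\<^sub>R (a *\<^sub>R (-1) ^ (j - 1) *\<^sub>R X - b *\<^sub>R (-1) ^ i *\<^sub>R Y) =
        (a * ((-1) ^ (i + j) * (-1) ^ (j - 1))) *\<^sub>R X - (b * ((-1) ^ (i + j) * (-1) ^ i)) *\<^sub>R Y"
      for a b and X Y :: 'b
      by (simp add: scaleR_diff_right mult.left_commute)
    then show ?thesis
      unfolding c g_def n s by (simp add: mult.commute)
  qed
  have "ce_d br k \<omega> v = (\<Sum>j\<le>k. \<Sum>i<j. - (g i (j - 1) + g j i))"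
    unfolding ce_d_def by (intro sum.cong refl t) auto
  also have "\<dots> = - (\<Sum>i\<le>k. \<Sum>l<k. g i l)"
    unfolding sum_pairs_reindex[symmetric] by (simp only: sum_negf sum.distrib)
  also have "\<dots> = - wedge_left \<xi> k (deriv_act D k \<omega>) v"
    by (simp add: wedge_left_def deriv_act_def g_def scaleR_sum_right)
  finally show ?thesis .
qed

section \<open>Wedge products of 1-forms\<close>

lemma kform_sum:
  "(\<And>s. s \<in> S \<Longrightarrow> kform k (\<omega> s)) \<Longrightarrow> kform k (\<lambda>v. \<Sum>s\<in>S. \<omega> s v)"
  unfolding kform_def
  apply (intro conjI allI impI)
  subgoal by (rule sum.cong) auto
  subgoal by (rule linear_compose_sum) auto
  subgoal for v i j by (rule sum.neutral) (metis (no_types, lifting))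
  done

lemma kform_compose_linear:
  assumes k: "kform k \<omega>" and g: "linear g"
  shows "kform k (\<lambda>v. g (\<omega> v))"
  unfolding kform_def
proof (intro conjI allI impI)
  fix v w :: "nat \<Rightarrow> 'a" assume "\<forall>i<k. v i = w i"
  then show "g (\<omega> v) = g (\<omega> w)" using kform_cong[OF k, of v w] by simp
next
  fix v :: "nat \<Rightarrow> 'a" and i assume "i < k"
  then show "linear (\<lambda>x. g (\<omega> (v(i := x))))"
    using linear_compose[OF kform_linear[OF k] g] by (simp add: o_def)
next
  fix v :: "nat \<Rightarrow> 'a" and i j assume "i < k" "j < k" "i \<noteq> j \<and> v i = v j"
  then show "g (\<omega> v) = 0" using kform_alternating[OF k, of i j v] linear_0[OF g] by simp
qed

lemma kform_plus: "kform k f \<Longrightarrow> kform k g \<Longrightarrow> kform k (\<lambda>w. f w + g w)"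
  using kform_sum[of UNIV k "\<lambda>b. if b then f else g"] by (simp add: UNIV_bool add.commute)

lemma wedge1_det: "wedge1 k \<phi> v = Determinant.det (Matrix.mat k k (\<lambda>(i, j). \<phi> i (v j)))"
  unfolding wedge1_def Determinant.det_def
  by (auto simp: lessThan_atLeast0 intro!: sum.cong prod.cong
      dest: permutes_in_image[of _ "{0..<k}"])

lemma kform_wedge1:
  fixes \<phi> :: "nat \<Rightarrow> 'a::real_vector \<Rightarrow> complex"
  assumes \<phi>: "\<And>i. i < k \<Longrightarrow> linear (\<phi> i)"
  shows "kform k (wedge1 k \<phi>)"
  unfolding kform_def
proof (intro conjI allI impI)
  fix v w :: "nat \<Rightarrow> 'a" assume "\<forall>i<k. v i = w i"
  then show "wedge1 k \<phi> v = wedge1 k \<phi> w"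
    unfolding wedge1_det by (intro arg_cong[where f = Determinant.det] cong_mat) auto
next
  fix v :: "nat \<Rightarrow> 'a" and l assume l: "l < k"
  have "linear (\<lambda>x. \<Prod>i<k. \<phi> i ((v(l := x)) (\<sigma> i)))" if \<sigma>: "\<sigma> permutes {..<k}" for \<sigma>
  proof -
    from \<sigma> l obtain i where i: "i < k" "\<sigma> i = l"
      by (metis lessThan_iff permutes_def)
    have ne: "\<sigma> j \<noteq> l" if "j \<noteq> i" for j
      using \<sigma> i that by (metis permutes_def)
    have "(\<Prod>j<k. \<phi> j ((v(l := x)) (\<sigma> j))) = \<phi> i x * (\<Prod>j\<in>{..<k} - {i}. \<phi> j (v (\<sigma> j)))" for x
    proof -
      have "(\<Prod>j<k. \<phi> j ((v(l := x)) (\<sigma> j))) =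
          \<phi> i ((v(l := x)) (\<sigma> i)) * (\<Prod>j\<in>{..<k} - {i}. \<phi> j ((v(l := x)) (\<sigma> j)))"
        using i by (intro prod.remove) auto
      then show ?thesis using i ne by simp
    qed
    then show ?thesis
      using linear_compose[OF \<phi>[OF i(1)], of "\<lambda>z. z * (\<Prod>j\<in>{..<k} - {i}. \<phi> j (v (\<sigma> j)))"]
      by (simp add: o_def bounded_linear.linear[OF bounded_linear_mult_left])
  qed
  then have "linear (\<lambda>x. of_int (sign \<sigma>) * (\<Prod>i<k. \<phi> i ((v(l := x)) (\<sigma> i))))"
    if "\<sigma> permutes {..<k}" for \<sigma>
    using linear_compose[of _ "\<lambda>z. of_int (sign \<sigma>) * z"] that
    by (fastforce simp: o_def bounded_linear.linear[OF bounded_linear_mult_right])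
  then show "linear (\<lambda>x. wedge1 k \<phi> (v(l := x)))"
    unfolding wedge1_def by (intro linear_compose_sum) auto
next
  fix v :: "nat \<Rightarrow> 'a" and i j assume ij: "i < k" "j < k" "i \<noteq> j \<and> v i = v j"
  show "wedge1 k \<phi> v = 0"
    unfolding wedge1_det
    by (rule det_identical_columns[of _ k i j]) (use ij in \<open>auto intro!: eq_vecI\<close>)
qed

lemma wedge1_cnj: "cnj (wedge1 k \<phi> v) = wedge1 k (\<lambda>i x. cnj (\<phi> i x)) v"
  by (simp add: wedge1_def)

lemma wedge1_permute:
  assumes "\<sigma> permutes {..<k}"
  shows "wedge1 k (\<lambda>i. \<phi> (\<sigma> i)) v = of_int (sign \<sigma>) * wedge1 k \<phi> v"
proof -
  have \<sigma>: "\<sigma> permutes {0..<k}" using assms by (simp add: lessThan_atLeast0)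
  let ?A = "Matrix.mat k k (\<lambda>(i, j). \<phi> i (v j))"
  have "wedge1 k (\<lambda>i. \<phi> (\<sigma> i)) v = Determinant.det (Matrix.mat k k (\<lambda>(i, j). ?A $$ (\<sigma> i, j)))"
    unfolding wedge1_det using permutes_in_image[OF \<sigma>]
    by (intro arg_cong[where f = Determinant.det] cong_mat) auto
  also have "\<dots> = of_int (sign \<sigma>) * wedge1 k \<phi> v"
    unfolding wedge1_det using det_permute_rows[OF _ \<sigma>, of ?A] by simp
  finally show ?thesis .
qed

lemma wedge1_linear_combination:
  assumes C: "C \<in> carrier_mat k k"
    and \<psi>: "\<And>i j. i < k \<Longrightarrow> j < k \<Longrightarrow> \<psi> i (v j) = (\<Sum>l<k. C $$ (i, l) * \<phi> l (v j))"
  shows "wedge1 k \<psi> v = Determinant.det C * wedge1 k \<phi> v"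
proof -
  let ?A = "Matrix.mat k k (\<lambda>(i, j). \<phi> i (v j))"
  have "Matrix.mat k k (\<lambda>(i, j). \<psi> i (v j)) = C * ?A"
    using C by (intro eq_matI) (auto simp: \<psi> scalar_prod_def lessThan_atLeast0)
  then show ?thesis
    unfolding wedge1_det using det_mult[OF C, of ?A] by simp
qed

lemma wedge1_eigen:
  assumes "\<And>i j. i < k \<Longrightarrow> j < k \<Longrightarrow> \<phi> i (g (v j)) = \<mu> i * \<phi> i (v j)"
  shows "wedge1 k \<phi> (\<lambda>j. g (v j)) = (\<Prod>i<k. \<mu> i) * wedge1 k \<phi> v"
proof -
  have "(\<Prod>i<k. \<phi> i (g (v (\<sigma> i)))) = (\<Prod>i<k. \<mu> i) * (\<Prod>i<k. \<phi> i (v (\<sigma> i)))"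
    if \<sigma>: "\<sigma> permutes {..<k}" for \<sigma>
    unfolding prod.distrib[symmetric]
    using permutes_in_image[OF \<sigma>] by (intro prod.cong) (auto simp: assms)
  then show ?thesis
    unfolding wedge1_def sum_distrib_left by (intro sum.cong) (auto simp: mult_ac)
qed

text \<open>Every term of the expansion of the determinant contains each \<open>\<phi> i\<close> exactly once.\<close>

lemma deriv_act_wedge1:
  assumes eig: "\<And>i j. i < k \<Longrightarrow> j < k \<Longrightarrow> \<phi> i (D (v j)) = \<mu> i * \<phi> i (v j)"
  shows "deriv_act D k (wedge1 k \<phi>) v = (\<Sum>i<k. \<mu> i) * wedge1 k \<phi> v"
proof -
  have "(\<Sum>l<k. \<Prod>i<k. \<phi> i ((v(l := D (v l))) (\<sigma> i))) = (\<Sum>i<k. \<mu> i) * (\<Prod>i<k. \<phi> i (v (\<sigma> i)))"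
    if \<sigma>: "\<sigma> permutes {..<k}" for \<sigma>
  proof -
    have "(\<Sum>l<k. \<Prod>i<k. \<phi> i ((v(l := D (v l))) (\<sigma> i))) =
        (\<Sum>m<k. \<Prod>i<k. \<phi> i ((v(\<sigma> m := D (v (\<sigma> m)))) (\<sigma> i)))"
      using sum.permute[OF \<sigma>, of "\<lambda>l. \<Prod>i<k. \<phi> i ((v(l := D (v l))) (\<sigma> i))"] by (simp add: o_def)
    also have "\<dots> = (\<Sum>m<k. \<mu> m * (\<Prod>i<k. \<phi> i (v (\<sigma> i))))"
    proof (intro sum.cong refl)
      fix m assume m: "m \<in> {..<k}"
      have "\<sigma> m < k" using \<sigma> m permutes_in_image[of \<sigma> "{..<k}" m] by simp
      moreover have "\<sigma> i = \<sigma> m \<longleftrightarrow> i = m" for i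
        using \<sigma> by (metis permutes_def)
      ultimately show "(\<Prod>i<k. \<phi> i ((v(\<sigma> m := D (v (\<sigma> m)))) (\<sigma> i))) = \<mu> m * (\<Prod>i<k. \<phi> i (v (\<sigma> i)))"
        using m by (simp add: prod.remove[of "{..<k}" m] eig)
    qed
    finally show ?thesis by (simp add: sum_distrib_right)
  qed
  note * = this
  have "deriv_act D k (wedge1 k \<phi>) v =
      (\<Sum>\<sigma> | \<sigma> permutes {..<k}. of_int (sign \<sigma>) * (\<Sum>l<k. \<Prod>i<k. \<phi> i ((v(l := D (v l))) (\<sigma> i))))"
    unfolding deriv_act_def wedge1_def sum_distrib_left by (rule sum.swap)
  also have "\<dots> = (\<Sum>i<k. \<mu> i) * wedge1 k \<phi> v"
    unfolding wedge1_def sum_distrib_left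
    by (intro sum.cong refl) (simp only: * sum_distrib_left[symmetric] mem_Collect_eq mult.left_commute)
  finally show ?thesis .
qed

lemma wedge1_zero_row: "i < k \<Longrightarrow> (\<And>j. j < k \<Longrightarrow> \<phi> i (v j) = 0) \<Longrightarrow> wedge1 k \<phi> v = 0"
  unfolding wedge1_def
proof (intro sum.neutral ballI)
  fix \<sigma> assume "i < k" "\<And>j. j < k \<Longrightarrow> \<phi> i (v j) = 0" "\<sigma> \<in> {\<sigma>. \<sigma> permutes {..<k}}"
  then have "\<phi> i (v (\<sigma> i)) = 0" using permutes_in_image[of \<sigma> "{..<k}" i] by simp
  then have "(\<Prod>i<k. \<phi> i (v (\<sigma> i))) = 0" using \<open>i < k\<close> by (intro prod_zero) auto
  then show "of_int (sign \<sigma>) * (\<Prod>i<k. \<phi> i (v (\<sigma> i))) = 0" by simp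
qed

lemma wedge1_repeated:
  assumes "i < k" "j < k" "i \<noteq> j" "\<phi> i = \<phi> j"
  shows "wedge1 k \<phi> v = 0"
proof -
  let ?t = "Transposition.transpose i j"
  have "?t permutes {..<k}" using assms by (intro permutes_swap_id) auto
  then have "wedge1 k (\<lambda>l. \<phi> (?t l)) v = of_int (sign ?t) * wedge1 k \<phi> v"
    by (rule wedge1_permute)
  moreover have "(\<lambda>l. \<phi> (?t l)) = \<phi>"
    using assms by (auto simp: Transposition.transpose_def fun_eq_iff)
  ultimately show ?thesis using assms by (simp add: sign_swap_id)
qed

subsection \<open>Positive volume forms\<close>

text \<open>The permutation that sorts \<open>\<gamma>\<^sub>0, cnj \<gamma>\<^sub>0, \<gamma>\<^sub>1, cnj \<gamma>\<^sub>1, \<dots>\<close> into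
  \<open>\<gamma>\<^sub>0, \<gamma>\<^sub>1, \<dots>, cnj \<gamma>\<^sub>0, cnj \<gamma>\<^sub>1, \<dots>\<close>.\<close>

definition unshuffle :: "nat \<Rightarrow> nat \<Rightarrow> nat" where
  "unshuffle p i = (if i < 2 * p then (if even i then i div 2 else p + i div 2) else i)"

lemma unshuffle_permutes: "unshuffle p permutes {..<2 * p}"
proof (rule bij_imp_permutes)
  show "bij_betw (unshuffle p) {..<2 * p} {..<2 * p}"
    by (rule bij_betw_byWitness[where f' = "\<lambda>i. if i < p then 2 * i else 2 * (i - p) + 1"])
      (auto simp: unshuffle_def)
qed (auto simp: unshuffle_def)

definition split_forms :: "nat \<Rightarrow> (nat \<Rightarrow> 'a \<Rightarrow> complex) \<Rightarrow> nat \<Rightarrow> 'a \<Rightarrow> complex" where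
  "split_forms p \<gamma> i = (if i < p then \<gamma> i else (\<lambda>x. cnj (\<gamma> (i - p) x)))"

lemma positive_volume_split:
  "positive_volume p \<gamma> v =
     \<i> ^ p * of_int (sign (unshuffle p)) * wedge1 (2 * p) (split_forms p \<gamma>) v"
proof -
  have "wedge1 (2 * p) (\<lambda>i. if even i then \<gamma> (i div 2) else (\<lambda>x. cnj (\<gamma> (i div 2) x))) v =
      wedge1 (2 * p) (\<lambda>i. split_forms p \<gamma> (unshuffle p i)) v"
    unfolding wedge1_det
    by (intro arg_cong[where f = Determinant.det] cong_mat) (auto simp: unshuffle_def split_forms_def)
  also have "\<dots> = of_int (sign (unshuffle p)) * wedge1 (2 * p) (split_forms p \<gamma>) v"
    by (rule wedge1_permute[OF unshuffle_permutes])
  finally show ?thesis by (simp add: positive_volume_def)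
qed

lemma det_cnj: "Determinant.det (map_mat cnj C) = cnj (Determinant.det C)"
  unfolding Determinant.det_def
  by (auto simp: intro!: sum.cong prod.cong
      dest: permutes_in_image)

text \<open>In the sorted order a complex change of basis \<open>C\<close> acts by the block matrix with blocks
  \<open>C\<close> and \<open>cnj C\<close>, whose determinant is \<open>det C * cnj (det C)\<close>.\<close>

lemma positive_volume_linear_combination:
  assumes \<psi>: "\<And>i j. i < p \<Longrightarrow> j < 2 * p \<Longrightarrow> \<psi> i (v j) = (\<Sum>l<p. c i l * \<gamma> l (v j))"
  shows "positive_volume p \<psi> v =
    of_real ((cmod (Determinant.det (Matrix.mat p p (\<lambda>(i, l). c i l))))\<^sup>2) * positive_volume p \<gamma> v"
proof -
  let ?C = "Matrix.mat p p (\<lambda>(i, l). c i l)"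
  let ?B = "four_block_mat ?C (0\<^sub>m p p) (0\<^sub>m p p) (map_mat cnj ?C)"
  have B: "?B \<in> carrier_mat (2 * p) (2 * p)"
    by (auto simp: mult_2)
  have "split_forms p \<psi> i (v j) = (\<Sum>l<2 * p. ?B $$ (i, l) * split_forms p \<gamma> l (v j))"
    if ij: "i < 2 * p" "j < 2 * p" for i j
  proof -
    have "(\<Sum>l<2 * p. ?B $$ (i, l) * split_forms p \<gamma> l (v j)) =
        (\<Sum>l\<in>{..<p} \<union> {p..<2 * p}. ?B $$ (i, l) * split_forms p \<gamma> l (v j))"
      by (intro sum.cong) auto
    also have "\<dots> = (\<Sum>l<p. ?B $$ (i, l) * split_forms p \<gamma> l (v j)) +
        (\<Sum>l\<in>{p..<2 * p}. ?B $$ (i, l) * split_forms p \<gamma> l (v j))"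
      by (intro sum.union_disjoint) auto
    also have "(\<Sum>l\<in>{p..<2 * p}. ?B $$ (i, l) * split_forms p \<gamma> l (v j)) =
        (\<Sum>l<p. ?B $$ (i, p + l) * split_forms p \<gamma> (p + l) (v j))"
      by (rule sum.reindex_bij_witness[where i = "\<lambda>l. p + l" and j = "\<lambda>l. l - p"]) auto
    finally show ?thesis
      using ij by (cases "i < p") (auto simp: split_forms_def \<psi>)
  qed
  from wedge1_linear_combination[of ?B "2 * p" "split_forms p \<psi>" v "split_forms p \<gamma>", OF B this]
  have "wedge1 (2 * p) (split_forms p \<psi>) v = Determinant.det ?B * wedge1 (2 * p) (split_forms p \<gamma>) v"
    by blast
  also have "Determinant.det ?B = Determinant.det ?C * cnj (Determinant.det ?C)"
    by (subst det_four_block_mat_lower_left_zero[where n = p and m = p]) (auto simp: det_cnj)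
  also have "\<dots> = of_real ((cmod (Determinant.det ?C))\<^sup>2)"
    by (rule complex_norm_square[symmetric])
  finally show ?thesis
    by (simp add: positive_volume_split)
qed

text \<open>Conjugation exchanges \<open>\<gamma>\<^sub>i\<close> and \<open>cnj \<gamma>\<^sub>i\<close>; the sign \<open>(-1)\<^sup>p\<close> of these
  \<open>p\<close> transpositions is compensated by that of the conjugate of \<open>\<i>\<^sup>p\<close>.\<close>

definition swap_pairs :: "nat \<Rightarrow> nat \<Rightarrow> nat" where
  "swap_pairs p i = (if i < 2 * p then (if even i then Suc i else i - 1) else i)"

lemma swap_pairs: "swap_pairs p permutes {..<2 * p} \<and> sign (swap_pairs p) = (-1) ^ p"
proof (induction p)
  case 0
  have "swap_pairs 0 = id" by (auto simp: swap_pairs_def)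
  then show ?case by (metis permutes_id sign_id power_0)
next
  case (Suc p)
  let ?t = "Transposition.transpose (2 * p) (Suc (2 * p))"
  have eq: "swap_pairs (Suc p) = ?t \<circ> swap_pairs p"
  proof
    fix i
    consider "i < 2 * p" | "i = 2 * p" | "i = Suc (2 * p)" | "2 * Suc p \<le> i" by atomize_elim arith
    then show "swap_pairs (Suc p) i = (?t \<circ> swap_pairs p) i"
      by cases (auto simp: swap_pairs_def Transposition.transpose_def, presburger)
  qed
  have t: "?t permutes {..<2 * Suc p}" by (rule permutes_swap_id) auto
  have s: "swap_pairs p permutes {..<2 * Suc p}"
    by (rule permutes_subset[OF conjunct1[OF Suc]]) auto
  have "sign (swap_pairs (Suc p)) = sign ?t * sign (swap_pairs p)"
    unfolding eq
    by (rule sign_compose; rule permutation_permutes[THEN iffD2]) (use s t in \<open>blast intro: finite_lessThan\<close>)+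
  then show ?case
    using permutes_compose[OF s t] Suc.IH unfolding eq[symmetric] by (simp add: sign_swap_id)
qed

lemma positive_volume_real: "cnj (positive_volume p \<gamma> v) = positive_volume p \<gamma> v"
proof -
  let ?\<phi> = "\<lambda>i. if even i then \<gamma> (i div 2) else (\<lambda>x. cnj (\<gamma> (i div 2) x))"
  have "cnj (wedge1 (2 * p) ?\<phi> v) = wedge1 (2 * p) (\<lambda>i. ?\<phi> (swap_pairs p i)) v"
    unfolding wedge1_cnj unfolding wedge1_det
    by (intro arg_cong[where f = Determinant.det] cong_mat) (auto simp: swap_pairs_def elim!: oddE)
  also have "\<dots> = (-1) ^ p * wedge1 (2 * p) ?\<phi> v"
    using swap_pairs[of p] wedge1_permute[of "swap_pairs p" "2 * p" ?\<phi> v] by simp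
  finally show ?thesis
    by (simp add: positive_volume_def flip: power_mult_distrib)
qed

section \<open>Linear algebra over a complex structure\<close>

definition jscale :: "('a::real_vector \<Rightarrow> 'a) \<Rightarrow> complex \<Rightarrow> 'a \<Rightarrow> 'a" where
  "jscale J c w = Re c *\<^sub>R w + Im c *\<^sub>R J w"

text \<open>A complex structure turns the real space into a complex one, with \<open>jscale\<close> as its scalar
  multiplication; the notions prefixed by \<open>jv\<close> belong to the complex space.\<close>

locale complex_space =
  fixes J :: "'a::euclidean_space \<Rightarrow> 'a"
  assumes J: "complex_structure J"
begin

lemma J_linear: "linear J" and JJ [simp]: "J (J x) = - x"
  using J by (auto simp: complex_structure_def)

lemmas J_simps = linear_add[OF J_linear] linear_diff[OF J_linear] linear_neg[OF J_linear]
  linear_scale[OF J_linear] linear_0[OF J_linear]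

sublocale jv: vector_space "jscale J"
  by unfold_locales (auto simp: jscale_def J_simps algebra_simps)

lemma jscale_ii [simp]: "jscale J \<i> w = J w"
  by (simp add: jscale_def)

lemma jscale_of_real [simp]: "jscale J (of_real r) w = r *\<^sub>R w"
  by (simp add: jscale_def)

lemma jscale_mem: "subspace S \<Longrightarrow> J ` S \<subseteq> S \<Longrightarrow> w \<in> S \<Longrightarrow> jscale J c w \<in> S"
  unfolding jscale_def by (auto intro!: subspace_add subspace_scale)

lemma jv_subspaceI: "subspace S \<Longrightarrow> J ` S \<subseteq> S \<Longrightarrow> jv.subspace S"
  unfolding jv.subspace_def by (auto intro: jscale_mem subspace_add subspace_0)

lemma subspace_jv_span: "subspace (jv.span B)"
  unfolding real_vector.subspace_def
  using jv.span_scale[of _ B "of_real _"] by (auto intro: jv.span_add jv.span_zero)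

lemma J_jv_span: "x \<in> jv.span B \<Longrightarrow> J x \<in> jv.span B"
  using jv.span_scale[of x B \<i>] by simp

lemma span_J_closure: "span (B \<union> J ` B) = jv.span B"
proof
  show "span (B \<union> J ` B) \<subseteq> jv.span B"
    by (rule span_minimal[OF _ subspace_jv_span]) (auto intro: jv.span_base J_jv_span)
  have "J ` span (B \<union> J ` B) = span (J ` (B \<union> J ` B))"
    by (rule linear_span_image[OF J_linear, symmetric])
  also have "\<dots> \<subseteq> span (B \<union> J ` B)"
    by (rule span_minimal) (auto intro!: subspace_span span_neg intro: span_base)
  finally have "jv.subspace (span (B \<union> J ` B))"
    by (intro jv_subspaceI subspace_span)
  then show "jv.span B \<subseteq> span (B \<union> J ` B)"
    by (intro jv.span_minimal) (auto intro: span_base)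
qed

text \<open>A real relation with coefficients \<open>f\<close> between vectors of \<open>B\<close> and \<open>J ` B\<close> is a complex relation in
  \<open>B\<close> with coefficients \<open>f b + \<i> * f (J b)\<close>.\<close>

lemma independent_J_closure:
  assumes B: "jv.independent B"
  shows "independent (B \<union> J ` B)" "B \<inter> J ` B = {}" "inj_on J B"
proof -
  show inj: "inj_on J B"
    by (rule inj_onI) (metis JJ neg_equal_iff_equal)
  show disj: "B \<inter> J ` B = {}"
  proof (rule ccontr)
    assume "B \<inter> J ` B \<noteq> {}"
    then obtain b where b: "b \<in> B" "J b \<in> B" by auto
    have "J b \<in> jv.span {b}"
      using jv.span_scale[of b "{b}" \<i>] by (simp add: jv.span_base)
    moreover have "J b \<noteq> b"
    proof
      assume e: "J b = b"
      then have "b = - b" using JJ[of b] by simp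
      then have "b = 0" by (metis add.right_inverse real_vector.scale_eq_0_iff scaleR_2 zero_neq_numeral)
      then show False using b jv.dependent_zero B by metis
    qed
    ultimately have "J b \<in> jv.span (B - {J b})"
      using b jv.span_mono[of "{b}" "B - {J b}"] by auto
    then show False using B b(2) unfolding jv.dependent_def by blast
  qed
  have fin: "independent (C \<union> J ` C)" if C: "C \<subseteq> B" "finite C" for C
  proof (rule independent_if_scalars_zero)
    show "finite (C \<union> J ` C)" using C by simp
    fix f x assume s: "(\<Sum>x\<in>C \<union> J ` C. f x *\<^sub>R x) = 0" and x: "x \<in> C \<union> J ` C"
    have iC: "jv.independent C" using B C jv.dependent_mono by blast
    have "(\<Sum>x\<in>C \<union> J ` C. f x *\<^sub>R x) = (\<Sum>x\<in>C. f x *\<^sub>R x) + (\<Sum>x\<in>J ` C. f x *\<^sub>R x)"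
      using C disj by (intro sum.union_disjoint) auto
    also have "(\<Sum>x\<in>J ` C. f x *\<^sub>R x) = (\<Sum>x\<in>C. f (J x) *\<^sub>R J x)"
      using inj C by (subst sum.reindex) (auto intro: inj_on_subset)
    finally have "(\<Sum>x\<in>C. jscale J (Complex (f x) (f (J x))) x) = 0"
      using s by (simp add: jscale_def sum.distrib)
    then have "Complex (f y) (f (J y)) = 0" if "y \<in> C" for y
      using jv.independentD[OF iC C(2) subset_refl, of "\<lambda>x. Complex (f x) (f (J x))" y] that by simp
    then show "f x = 0" using x by (auto simp: complex_eq_iff)
  qed
  show "independent (B \<union> J ` B)"
    unfolding real_vector.independent_explicit_finite_subsets
  proof (intro allI impI)
    fix A u assume A: "A \<subseteq> B \<union> J ` B" "finite A" and u: "(\<Sum>v\<in>A. u v *\<^sub>R v) = 0"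
    define C where "C = (A \<inter> B) \<union> {b \<in> B. J b \<in> A}"
    have "finite {b \<in> B. J b \<in> A}"
      by (rule inj_on_finite[of J _ A]) (use A inj in \<open>auto intro: inj_on_subset\<close>)
    then have "finite C" "C \<subseteq> B" using A by (auto simp: C_def)
    then have "independent (C \<union> J ` C)" by (intro fin)
    moreover have "A \<subseteq> C \<union> J ` C" using A by (auto simp: C_def)
    ultimately show "\<forall>v\<in>A. u v = 0"
      using independentD[of "C \<union> J ` C" A u] A u by auto
  qed
qed

lemma finite_jv_independent: "jv.independent B \<Longrightarrow> finite B"
  using independent_J_closure(1)[of B] finiteI_independent by (metis finite_Un)

lemma dim_jv_span:
  assumes "jv.independent B"
  shows "dim (jv.span B) = 2 * card B"
proof -
  have "dim (jv.span B) = card (B \<union> J ` B)"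
    unfolding span_J_closure[symmetric] dim_span
    by (rule dim_eq_card_independent[OF independent_J_closure(1)[OF assms]])
  also have "\<dots> = 2 * card B"
    using independent_J_closure(2,3)[OF assms] finite_jv_independent[OF assms]
    by (subst card_Un_disjoint) (auto simp: card_image)
  finally show ?thesis .
qed

lemma invariant_subspace_basis:
  assumes W: "subspace W" "J ` W \<subseteq> W" "dim W = 2 * p"
  obtains b where "inj_on b {..<p}" "jv.independent (b ` {..<p})" "jv.span (b ` {..<p}) = W"
proof -
  obtain B where B: "B \<subseteq> W" "jv.independent B" "W \<subseteq> jv.span B"
    using jv.maximal_independent_subset by blast
  have W': "jv.span B = W"
    using B jv.span_minimal[OF B(1) jv_subspaceI[OF W(1,2)]] by auto
  have "card B = p" using dim_jv_span[OF B(2)] W W' by simp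
  then obtain b where "bij_betw b {..<p} B"
    using finite_jv_independent[OF B(2)] ex_bij_betw_nat_finite by (metis lessThan_atLeast0)
  then show thesis using that[of b] B W' by (auto simp: bij_betw_def)
qed

subsection \<open>Coordinates\<close>

text \<open>The complex coordinates in a family \<open>b\<close> with linearly independent range on \<open>I\<close>; outside
  the span of the family they vanish.\<close>

definition coord :: "(nat \<Rightarrow> 'a) \<Rightarrow> nat set \<Rightarrow> nat \<Rightarrow> 'a \<Rightarrow> complex" where
  "coord b I i x = jv.representation (b ` I) x (b i)"

context
  fixes b :: "nat \<Rightarrow> 'a" and I :: "nat set"
  assumes inj: "inj_on b I" and ind: "jv.independent (b ` I)"
begin

lemma coord_add:
  "x \<in> jv.span (b ` I) \<Longrightarrow> y \<in> jv.span (b ` I) \<Longrightarrow> coord b I i (x + y) = coord b I i x + coord b I i y"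
  unfolding coord_def by (simp add: jv.representation_add[OF ind])

lemma coord_jscale:
  "x \<in> jv.span (b ` I) \<Longrightarrow> coord b I i (jscale J c x) = c * coord b I i x"
  unfolding coord_def by (simp add: jv.representation_scale[OF ind])

lemma coord_scaleR:
  "x \<in> jv.span (b ` I) \<Longrightarrow> coord b I i (r *\<^sub>R x) = of_real r * coord b I i x"
  using coord_jscale[of x i "of_real r"] by simp

lemma coord_J:
  "x \<in> jv.span (b ` I) \<Longrightarrow> coord b I i (J x) = \<i> * coord b I i x"
  using coord_jscale[of x i \<i>] by simp

lemma coord_basis: "i \<in> I \<Longrightarrow> j \<in> I \<Longrightarrow> coord b I i (b j) = (if i = j then 1 else 0)"
  unfolding coord_def using inj_onD[OF inj, of i j]
  by (auto simp: jv.representation_basis[OF ind])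

lemma coord_expansion:
  assumes "x \<in> jv.span (b ` I)"
  shows "(\<Sum>i\<in>I. jscale J (coord b I i x) (b i)) = x"
proof -
  have "(\<Sum>c\<in>b ` I. jscale J (jv.representation (b ` I) x c) c) = x"
    by (rule jv.sum_representation_eq[OF ind assms finite_jv_independent[OF ind] subset_refl])
  then show ?thesis by (simp add: sum.reindex[OF inj] coord_def)
qed

end

lemma coord_basis10:
  assumes b: "inj_on b {..<p}" "jv.independent (b ` {..<p})"
  shows "basis10 J (jv.span (b ` {..<p})) p (coord b {..<p})"
  unfolding basis10_def
proof (intro conjI allI impI ballI)
  show "coord b {..<p} j \<in> forms10 J (jv.span (b ` {..<p}))" for j
    unfolding forms10_def by (auto simp: coord_add[OF b] coord_scaleR[OF b] coord_J[OF b])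
next
  fix c j assume c: "\<forall>x\<in>jv.span (b ` {..<p}). (\<Sum>j<p. c j * coord b {..<p} j x) = 0" and j: "j < p"
  have "(\<Sum>i<p. c i * coord b {..<p} i (b j)) = (\<Sum>i<p. if i = j then c i else 0)"
    using j by (intro sum.cong) (auto simp: coord_basis[OF b])
  then show "c j = 0" using c j by (auto simp: jv.span_base)
next
  fix \<phi> assume \<phi>: "\<phi> \<in> forms10 J (jv.span (b ` {..<p}))"
  let ?S = "jv.span (b ` {..<p})"
  have add: "\<phi> (x + y) = \<phi> x + \<phi> y" if "x \<in> ?S" "y \<in> ?S" for x y
    using \<phi> that by (auto simp: forms10_def)
  have sc: "\<phi> (r *\<^sub>R x) = of_real r * \<phi> x" if "x \<in> ?S" for r x
    using \<phi> that by (auto simp: forms10_def)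
  have Jf: "\<phi> (J x) = \<i> * \<phi> x" if "x \<in> ?S" for x
    using \<phi> that by (auto simp: forms10_def)
  have js: "\<phi> (jscale J c x) = c * \<phi> x" if x: "x \<in> ?S" for c x
  proof -
    have m: "Re c *\<^sub>R x \<in> ?S" "Im c *\<^sub>R J x \<in> ?S"
      using x J_jv_span[OF x] subspace_jv_span by (auto simp: subspace_scale)
    have "\<phi> (jscale J c x) = of_real (Re c) * \<phi> x + of_real (Im c) * (\<i> * \<phi> x)"
      unfolding jscale_def by (simp add: add[OF m] sc[OF x] sc[OF J_jv_span[OF x]] Jf[OF x])
    also have "\<dots> = (of_real (Re c) + \<i> * of_real (Im c)) * \<phi> x" by (simp add: algebra_simps)
    finally show ?thesis by (simp flip: complex_eq)
  qed
  have z: "\<phi> 0 = 0" using sc[of 0 0] jv.span_zero by simp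
  have su: "\<phi> (\<Sum>i\<in>F. f i) = (\<Sum>i\<in>F. \<phi> (f i))" if "finite F" "\<And>i. i \<in> F \<Longrightarrow> f i \<in> ?S" for F and f :: "nat \<Rightarrow> 'a"
    using that by (induction F rule: finite_induct) (auto simp: z add jv.span_sum)
  show "\<exists>c. \<forall>x\<in>?S. \<phi> x = (\<Sum>j<p. c j * coord b {..<p} j x)"
  proof (intro exI ballI)
    fix x assume x: "x \<in> ?S"
    have "\<phi> x = \<phi> (\<Sum>i<p. jscale J (coord b {..<p} i x) (b i))"
      by (simp add: coord_expansion[OF b x])
    also have "\<dots> = (\<Sum>i<p. \<phi> (b i) * coord b {..<p} i x)"
      by (subst su) (auto simp: js jv.span_base jv.span_scale mult.commute)
    finally show "\<phi> x = (\<Sum>i<p. \<phi> (b i) * coord b {..<p} i x)" .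
  qed
qed

subsection \<open>Frames\<close>

definition frame :: "(nat \<Rightarrow> 'a) \<Rightarrow> nat \<Rightarrow> 'a" where
  "frame w i = (if even i then w (i div 2) else J (w (i div 2)))"

lemma frame_image: "frame w ` {..<2 * p} = w ` {..<p} \<union> J ` w ` {..<p}"
proof -
  have "i < p \<Longrightarrow> w i = frame w (2 * i) \<and> 2 * i < 2 * p \<and> J (w i) = frame w (Suc (2 * i)) \<and> Suc (2 * i) < 2 * p" for i
    by (simp add: frame_def)
  moreover have "i < 2 * p \<Longrightarrow> frame w i \<in> w ` {..<p} \<union> J ` w ` {..<p}" for i
    by (simp add: frame_def)
  ultimately show ?thesis by (fastforce simp: image_iff)
qed

text \<open>A vanishing determinant would give a relation between the \<open>\<gamma>\<^sub>k\<close> and the \<open>cnj \<gamma>\<^sub>k\<close>; its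
  \<open>J\<close>-linear and \<open>J\<close>-antilinear parts would be relations between the \<open>\<gamma>\<^sub>k\<close> alone.\<close>

lemma positive_volume_frame_nonzero:
  assumes w: "W = jv.span (w ` {..<p})" and \<gamma>: "basis10 J W p \<gamma>"
  shows "positive_volume p \<gamma> (frame w) \<noteq> 0"
proof
  assume z: "positive_volume p \<gamma> (frame w) = 0"
  let ?A = "Matrix.mat (2 * p) (2 * p) (\<lambda>(i, j). split_forms p \<gamma> i (frame w j))"
  have "Determinant.det (transpose_mat ?A) = 0"
    using z by (subst det_transpose[of _ "2 * p"]) (auto simp: positive_volume_split wedge1_det sign_def split: if_splits)
  then obtain c where c: "c \<in> carrier_vec (2 * p)" "c \<noteq> 0\<^sub>v (2 * p)" "transpose_mat ?A *\<^sub>v c = 0\<^sub>v (2 * p)"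
    using det_0_iff_vec_prod_zero_field[of "transpose_mat ?A" "2 * p"] by auto
  have rel: "(\<Sum>i<2 * p. c $ i * split_forms p \<gamma> i (frame w j)) = 0" if j: "j < 2 * p" for j
  proof -
    have "(transpose_mat ?A *\<^sub>v c) $ j = 0" using c(3) j by simp
    then show ?thesis using j c(1) by (simp add: scalar_prod_def lessThan_atLeast0 mult.commute)
  qed
  define f where "f x = (\<Sum>k<p. c $ k * \<gamma> k x)" for x
  define g where "g x = (\<Sum>k<p. c $ (p + k) * cnj (\<gamma> k x))" for x
  have fg: "(\<Sum>i<2 * p. c $ i * split_forms p \<gamma> i x) = f x + g x" for x
  proof -
    have "(\<Sum>i<2 * p. c $ i * split_forms p \<gamma> i x) = (\<Sum>i\<in>{..<p} \<union> {p..<2 * p}. c $ i * split_forms p \<gamma> i x)"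
      by (intro sum.cong) auto
    also have "\<dots> = (\<Sum>i<p. c $ i * split_forms p \<gamma> i x) + (\<Sum>i\<in>{p..<2 * p}. c $ i * split_forms p \<gamma> i x)"
      by (intro sum.union_disjoint) auto
    also have "(\<Sum>i\<in>{p..<2 * p}. c $ i * split_forms p \<gamma> i x) = (\<Sum>k<p. c $ (p + k) * split_forms p \<gamma> (p + k) x)"
      by (rule sum.reindex_bij_witness[where i = "\<lambda>l. p + l" and j = "\<lambda>l. l - p"]) auto
    finally show ?thesis by (simp add: f_def g_def split_forms_def)
  qed
  have W: "W = span (frame w ` {..<2 * p})"
    unfolding frame_image span_J_closure w ..
  have \<gamma>W: "\<gamma> k (x + y) = \<gamma> k x + \<gamma> k y" "\<gamma> k (r *\<^sub>R x) = of_real r * \<gamma> k x" "\<gamma> k (J x) = \<i> * \<gamma> k x"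
    if "k < p" "x \<in> W" "y \<in> W" for k x y r
    using \<gamma> that by (auto simp: basis10_def forms10_def)
  have sW: "subspace W" unfolding w by (rule subspace_jv_span)
  have JW: "J x \<in> W" if "x \<in> W" for x using that unfolding w by (rule J_jv_span)
  have lin: "f (x + y) = f x + f y" "g (x + y) = g x + g y"
     "f (r *\<^sub>R x) = of_real r * f x" "g (r *\<^sub>R x) = of_real r * g x"
     "f (J x) = \<i> * f x" "g (J x) = - \<i> * g x" if "x \<in> W" "y \<in> W" for x y r
    using \<gamma>W that by (simp_all add: f_def g_def sum.distrib sum_distrib_left algebra_simps flip: sum_negf)
  have "x \<in> W \<and> f x + g x = 0" if "x \<in> span (frame w ` {..<2 * p})" for x
    using that
  proof (induction rule: span_induct_alt)
    case base
    have "0 \<in> W" using sW by (rule subspace_0)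
    then show ?case using lin(3,4)[of 0 0 0] by simp
  next
    case (step r x y)
    have x: "x \<in> W" unfolding W using step by (auto intro: span_base)
    have rx: "r *\<^sub>R x \<in> W" using x sW by (simp add: subspace_scale)
    have "f x + g x = 0" using step(1) rel fg by auto
    then have "of_real r * f x + of_real r * g x = 0" by (simp flip: distrib_left)
    then show ?case
      using step(2) rx sW lin(1,2)[OF rx, of y] lin(3,4)[OF x x, of r]
      by (auto simp: subspace_add algebra_simps)
  qed
  then have zero: "f x + g x = 0" if "x \<in> W" for x
    using that W by blast
  have "f x = 0 \<and> g x = 0" if x: "x \<in> W" for x
  proof -
    have "f x + g x = 0" "\<i> * f x - \<i> * g x = 0"
      using zero[OF x] zero[OF JW[OF x]] lin(5,6)[OF x x] by simp_all
    then show ?thesis by (simp add: right_diff_distrib[symmetric])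
  qed
  then have fz: "\<forall>x\<in>W. (\<Sum>k<p. c $ k * \<gamma> k x) = 0"
    and gz: "\<forall>x\<in>W. (\<Sum>k<p. cnj (c $ (p + k)) * \<gamma> k x) = 0"
  proof -
    show "\<forall>x\<in>W. (\<Sum>k<p. c $ k * \<gamma> k x) = 0" if "\<And>x. x \<in> W \<Longrightarrow> f x = 0 \<and> g x = 0"
      using that by (simp add: f_def)
    show "\<forall>x\<in>W. (\<Sum>k<p. cnj (c $ (p + k)) * \<gamma> k x) = 0" if "\<And>x. x \<in> W \<Longrightarrow> f x = 0 \<and> g x = 0"
    proof
      fix x assume "x \<in> W"
      then have "cnj (g x) = 0" using that by simp
      then show "(\<Sum>k<p. cnj (c $ (p + k)) * \<gamma> k x) = 0" by (simp add: g_def)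
    qed
  qed
  have ind: "\<forall>c. (\<forall>x\<in>W. (\<Sum>j<p. c j * \<gamma> j x) = 0) \<longrightarrow> (\<forall>j<p. c j = 0)"
    using \<gamma> by (simp add: basis10_def)
  have "\<forall>k<p. c $ k = 0"
    using fz spec[OF ind, of "\<lambda>k. c $ k"] by simp
  have "\<forall>k<p. cnj (c $ (p + k)) = 0"
    using gz spec[OF ind, of "\<lambda>k. cnj (c $ (p + k))"] by simp
  have "c $ i = 0" if "i < 2 * p" for i
  proof (cases "i < p")
    case False
    then obtain k where "i = p + k" "k < p"
      using \<open>i < 2 * p\<close> by (metis le_Suc_ex linorder_not_le mult_2 nat_add_left_cancel_less)
    then show ?thesis using \<open>\<forall>k<p. cnj (c $ (p + k)) = 0\<close> by simp
  qed (use \<open>\<forall>k<p. c $ k = 0\<close> in simp)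
  then have "c = 0\<^sub>v (2 * p)"
    using c(1) by (intro eq_vecI) auto
  then show False using c(2) by contradiction
qed

end

section \<open>The pluriclosed equation on an almost abelian algebra\<close>

text \<open>The vector \<open>y\<close> is the one that determines the presentation \<open>(lam, v, D)\<close>, the latter with \<open>D\<close>
  restricted to \<open>\<hh>\<close>.\<close>

locale almost_abelian_complex = complex_space J
  for J :: "'a::euclidean_space \<Rightarrow> 'a" +
  fixes br :: "'a \<Rightarrow> 'a \<Rightarrow> 'a" and \<aa> :: "'a set" and lam :: real and v y :: 'a
  assumes aa: "almost_abelian br \<aa>" and icj: "integrable_cs br J"
    and y: "y \<in> \<aa>" "y \<notin> J_part J \<aa>"
    and v: "v \<in> J_part J \<aa>" and br_y: "br (- J y) y = lam *\<^sub>R y + v"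
begin

abbreviation "\<hh> \<equiv> J_part J \<aa>"
abbreviation "x \<equiv> - J y"
abbreviation "D \<equiv> br x"

lemma sub_aa: "subspace \<aa>"
  using aa by (simp add: almost_abelian_def)

lemma mem_hh: "w \<in> \<hh> \<longleftrightarrow> w \<in> \<aa> \<and> J w \<in> \<aa>"
proof
  assume "w \<in> \<hh>"
  then show "w \<in> \<aa> \<and> J w \<in> \<aa>"
    using sub_aa by (auto simp: J_part_def subspace_neg)
next
  assume w: "w \<in> \<aa> \<and> J w \<in> \<aa>"
  then have "w = J (- J w)" "- J w \<in> \<aa>"
    using sub_aa by (auto simp: J_simps subspace_neg)
  then show "w \<in> \<hh>" using w by (auto simp: J_part_def)
qed

lemma subspace_hh: "subspace \<hh>"
  unfolding real_vector.subspace_def using sub_aa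
  by (auto simp: mem_hh J_simps subspace_add subspace_scale subspace_0)

lemma J_hh: "w \<in> \<hh> \<Longrightarrow> J w \<in> \<hh>"
  using sub_aa by (auto simp: mem_hh subspace_neg)

lemma x_notin: "x \<notin> \<aa>"
proof
  assume "x \<in> \<aa>"
  then have "J y \<in> \<aa>" using sub_aa subspace_neg by fastforce
  then show False using y by (simp add: mem_hh)
qed

lemma exists_functional: "\<exists>\<xi>. linear \<xi> \<and> (\<forall>z. \<xi> z = (0::real) \<longleftrightarrow> z \<in> \<aa>) \<and> \<xi> x = 1"
proof -
  have "dim \<aa> = DIM('a) - 1" using aa by (auto simp: almost_abelian_def)
  then obtain a where a: "a \<noteq> 0" "span \<aa> = {z. a \<bullet> z = 0}"
    using dim_eq_hyperplane by blast
  then have *: "z \<in> \<aa> \<longleftrightarrow> a \<bullet> z = 0" for z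
    using sub_aa by (metis mem_Collect_eq span_eq_iff)
  with x_notin have "a \<bullet> x \<noteq> 0" by blast
  then show ?thesis
    by (intro exI[of _ "\<lambda>z. (a \<bullet> z) / (a \<bullet> x)"])
      (auto simp: * inner_add_right add_divide_distrib intro!: linearI)
qed

text \<open>With \<open>\<eta>\<close> defined as \<open>J \<xi>\<close>, the forms \<open>\<xi>\<close> and \<open>\<eta>\<close> are dual to \<open>x\<close> and \<open>y\<close> and vanish on
  \<open>\<hh>\<close>. The kernel \<open>\<aa>\<close> and the value at \<open>x\<close> determine \<open>\<xi>\<close> uniquely.\<close>

definition \<xi> :: "'a \<Rightarrow> real" where
  "\<xi> = (SOME \<xi>. linear \<xi> \<and> (\<forall>z. \<xi> z = (0::real) \<longleftrightarrow> z \<in> \<aa>) \<and> \<xi> x = 1)"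

definition \<eta> :: "'a \<Rightarrow> real" where
  "\<eta> z = \<xi> (- J z)"

lemma xi: "linear \<xi>" "\<xi> z = 0 \<longleftrightarrow> z \<in> \<aa>" "\<xi> x = 1"
  using someI_ex[OF exists_functional] unfolding \<xi>_def by blast+

lemmas xi_simps = linear_add[OF xi(1)] linear_diff[OF xi(1)] linear_neg[OF xi(1)]
  linear_scale[OF xi(1)] linear_0[OF xi(1)]

lemma xi_J [simp]: "\<xi> (J z) = - \<eta> z"
  by (simp add: \<eta>_def xi_simps)

lemma eta_J [simp]: "\<eta> (J z) = \<xi> z"
  by (simp add: \<eta>_def xi_simps)

lemma linear_eta: "linear \<eta>"
  unfolding \<eta>_def by (intro linearI) (simp_all add: J_simps xi_simps)

lemmas eta_simps = linear_add[OF linear_eta] linear_diff[OF linear_eta] linear_neg[OF linear_eta]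
  linear_scale[OF linear_eta] linear_0[OF linear_eta]

lemma xi_y [simp]: "\<xi> y = 0" and eta_y [simp]: "\<eta> y = 1"
  using xi y by (simp_all add: \<eta>_def)

lemma xi_x [simp]: "\<xi> x = 1" and eta_x [simp]: "\<eta> x = 0"
  using xi by (simp_all add: eta_simps)

lemma hh_iff: "w \<in> \<hh> \<longleftrightarrow> \<xi> w = 0 \<and> \<eta> w = 0"
  unfolding mem_hh xi(2)[symmetric] by simp

definition \<pi> :: "'a \<Rightarrow> 'a" where
  "\<pi> z = z - \<xi> z *\<^sub>R x - \<eta> z *\<^sub>R y"

lemma pi_hh: "\<pi> z \<in> \<hh>"
  unfolding hh_iff \<pi>_def xi_simps eta_simps by simp

lemma decompose: "z = \<xi> z *\<^sub>R x + \<eta> z *\<^sub>R y + \<pi> z"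
  by (simp add: \<pi>_def)

subsection \<open>The bracket\<close>

lemma bilinear_br: "bilinear br"
  using aa by (simp add: almost_abelian_def lie_algebra_def)

lemma br_self [simp]: "br z z = 0"
  using aa by (simp add: almost_abelian_def lie_algebra_def)

lemma linear_D: "linear D"
  using bilinear_br by (simp add: bilinear_def)

lemma br_skew: "br a b = - br b a"
proof -
  have "br (a + b) (a + b) = 0" by (rule br_self)
  then have "br b a + br a b = 0" unfolding bilinear_ladd[OF bilinear_br] bilinear_radd[OF bilinear_br] by simp
  then show ?thesis by (simp add: eq_neg_iff_add_eq_0 add.commute)
qed

lemma br_formula: "br a b = \<xi> a *\<^sub>R D b - \<xi> b *\<^sub>R D a"
proof -
  have m: "z - \<xi> z *\<^sub>R x \<in> \<aa>" for z
    unfolding xi(2)[symmetric] xi_simps by simp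
  have "br (a - \<xi> a *\<^sub>R x) (b - \<xi> b *\<^sub>R x) = 0"
    using aa m by (simp add: almost_abelian_def)
  moreover have "br (a - \<xi> a *\<^sub>R x) (b - \<xi> b *\<^sub>R x) = br a b - \<xi> b *\<^sub>R br a x - \<xi> a *\<^sub>R (D b - \<xi> b *\<^sub>R D x)"
    by (simp only: bilinear_lsub[OF bilinear_br] bilinear_rsub[OF bilinear_br]
      bilinear_lmul[OF bilinear_br] bilinear_rmul[OF bilinear_br]) (simp add: algebra_simps)
  moreover have "br a x = - D a" by (rule br_skew)
  ultimately show ?thesis by (simp add: algebra_simps)
qed

lemma D_aa: "w \<in> \<aa> \<Longrightarrow> D w \<in> \<aa>"
  using aa by (simp add: almost_abelian_def)

text \<open>The Nijenhuis tensor at \<open>x\<close> and \<open>w\<close>: its brackets with \<open>J x = y\<close> lie in \<open>[\<aa>, \<aa>] = 0\<close>.\<close>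

lemma D_J: "w \<in> \<hh> \<Longrightarrow> D (J w) = J (D w)"
proof -
  assume w: "w \<in> \<hh>"
  have N: "br (J a) (J b) - J (br (J a) b) - J (br a (J b)) - br a b = 0" for a b
    using icj by (simp add: integrable_cs_def)
  have "br y w = 0" "br y (J w) = 0"
    using aa w y by (auto simp: almost_abelian_def mem_hh)
  moreover have "J x = y" by (simp add: J_simps)
  ultimately have "D w = - J (D (J w))"
    using N[of x w] by (simp add: J_simps)
  then show ?thesis by (simp add: J_simps)
qed

lemma D_hh: "w \<in> \<hh> \<Longrightarrow> D w \<in> \<hh>"
  using D_aa D_J[symmetric] J_hh by (simp add: mem_hh)

lemma eta_D: "\<eta> (D z) = lam * \<eta> z"
proof -
  have "D z = D (\<xi> z *\<^sub>R x + \<eta> z *\<^sub>R y + \<pi> z)" using decompose[of z] by simp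
  also have "\<dots> = \<eta> z *\<^sub>R (lam *\<^sub>R y + v) + D (\<pi> z)"
    by (simp only: linear_add[OF linear_D] linear_scale[OF linear_D] br_y br_self) simp
  also have "\<eta> \<dots> = lam * \<eta> z"
    using v D_hh[OF pi_hh[of z]] by (simp add: eta_simps hh_iff)
  finally show ?thesis .
qed

subsection \<open>Reduction to the maximal complex subspace\<close>

text \<open>A form \<open>\<xi> \<and> \<eta> \<and> \<tau>\<close> sees only the restriction of \<open>\<tau>\<close> to the common kernel of \<open>\<xi>\<close> and
  \<open>\<eta>\<close>: on vectors from \<open>{x, y} \<union> \<hh>\<close> it can be nonzero only if \<open>x\<close> and \<open>y\<close> both occur exactly
  once.\<close>

lemma wedge_xi_eta_zero_iff:
  fixes \<tau> :: "(nat \<Rightarrow> 'a) \<Rightarrow> 'b::real_vector"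
  assumes \<tau>: "kform k \<tau>"
  shows "(\<forall>w. wedge_left \<xi> (Suc k) (wedge_left \<eta> k \<tau>) w = 0) \<longleftrightarrow> (\<forall>w. (\<forall>i<k. w i \<in> \<hh>) \<longrightarrow> \<tau> w = 0)"
    (is "(\<forall>w. ?\<zeta> w = 0) \<longleftrightarrow> ?R")
proof
  assume z: "\<forall>w. ?\<zeta> w = 0"
  show ?R
  proof (intro allI impI)
    fix w assume w: "\<forall>i<k. w i \<in> \<hh>"
    have "?\<zeta> (case_nat x (case_nat y w)) = \<xi> x *\<^sub>R wedge_left \<eta> k \<tau> (case_nat y w)"
      by (rule wedge_left_front) (use w in \<open>auto simp: hh_iff split: nat.split\<close>)
    also have "wedge_left \<eta> k \<tau> (case_nat y w) = \<eta> y *\<^sub>R \<tau> w"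
      by (rule wedge_left_front) (use w in \<open>auto simp: hh_iff\<close>)
    finally show "\<tau> w = 0" using z by simp
  qed
next
  assume \<tau>0: ?R
  let ?\<zeta>1 = "wedge_left \<eta> k \<tau>"
  have k1: "kform (Suc k) ?\<zeta>1" by (intro kform_wedge_left \<tau> linear_eta)
  have k2: "kform (Suc (Suc k)) ?\<zeta>" by (intro kform_wedge_left k1 xi)
  have z1: "?\<zeta>1 w = 0" if w: "\<And>i. i < Suc k \<Longrightarrow> w i \<in> insert y \<hh>" for w
  proof (rule wedge_left_zero[OF \<tau> linear_eta])
    show "\<eta> (w i) = 0 \<or> w i = y" if "i \<le> k" for i
      using w[of i] that by (metis hh_iff insertE less_Suc_eq_le)
  next
    fix u assume u: "\<And>i. i < k \<Longrightarrow> u i \<in> w ` {..k} \<and> \<eta> (u i) = 0"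
    have "u i \<in> \<hh>" if "i < k" for i
    proof -
      from u[OF that] obtain l where l: "l \<le> k" "u i = w l" "\<eta> (w l) = 0" by auto
      then have "w l \<noteq> y" using eta_y by fastforce
      then show ?thesis using w[of l] l by auto
    qed
    then show "\<tau> u = 0" using \<tau>0 by blast
  qed
  have z2: "?\<zeta> w = 0" if w: "\<And>i. i \<le> Suc k \<Longrightarrow> w i \<in> insert x (insert y \<hh>)" for w
  proof (rule wedge_left_zero[OF k1 xi(1)])
    show "\<xi> (w i) = 0 \<or> w i = x" if "i \<le> Suc k" for i
      using w[OF that] xi_y by (metis hh_iff insertE)
  next
    fix u assume u: "\<And>i. i < Suc k \<Longrightarrow> u i \<in> w ` {..Suc k} \<and> \<xi> (u i) = 0"
    have "u i \<in> insert y \<hh>" if "i < Suc k" for i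
    proof -
      from u[OF that] obtain l where "l \<le> Suc k" "u i = w l" "\<xi> (w l) = 0" by auto
      then show ?thesis using w[of l] by auto
    qed
    then show "?\<zeta>1 u = 0" by (rule z1)
  qed
  have "?\<zeta> w = 0" if "m \<le> Suc (Suc k)" "\<And>i. m \<le> i \<Longrightarrow> i \<le> Suc k \<Longrightarrow> w i \<in> insert x (insert y \<hh>)" for m w
    using that
  proof (induction m arbitrary: w)
    case 0
    then show ?case by (intro z2) auto
  next
    case (Suc m)
    have m: "m < Suc (Suc k)" using Suc.prems by simp
    have ih: "?\<zeta> (w(m := z)) = 0" if "z \<in> insert x (insert y \<hh>)" for z
      using Suc.prems that by (intro Suc.IH) (auto simp: le_Suc_eq Suc_le_eq)
    have "?\<zeta> w = ?\<zeta> (w(m := \<xi> (w m) *\<^sub>R x + \<eta> (w m) *\<^sub>R y + \<pi> (w m)))"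
      by (simp only: decompose[symmetric] fun_upd_triv)
    also have "\<dots> = \<xi> (w m) *\<^sub>R ?\<zeta> (w(m := x)) + \<eta> (w m) *\<^sub>R ?\<zeta> (w(m := y)) + ?\<zeta> (w(m := \<pi> (w m)))"
      by (simp only: kform_add[OF k2 m] kform_scale[OF k2 m])
    also have "\<dots> = 0"
      using ih[of x] ih[of y] ih[of "\<pi> (w m)"] pi_hh[of "w m"] by simp
    finally show ?case .
  qed
  from this[of "Suc (Suc k)"] show "\<forall>w. ?\<zeta> w = 0" by simp
qed

text \<open>Conjugation by \<open>J\<close> turns \<open>\<xi>\<close> into \<open>\<eta>\<close> and \<open>D\<close> into \<open>- J D J\<close>, which agrees with \<open>D\<close> on \<open>\<hh>\<close> but
  need not on the whole algebra.\<close>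

lemma dc_formula:
  fixes \<Omega> :: "(nat \<Rightarrow> 'a) \<Rightarrow> 'b::real_vector"
  assumes k: "kform k \<Omega>" and inv: "\<And>w. \<Omega> (\<lambda>i. J (w i)) = \<Omega> w"
  shows "dc br J k \<Omega> = (\<lambda>w. - wedge_left \<eta> k (deriv_act (\<lambda>z. - J (D (J z))) k \<Omega>) w)"
proof
  fix w
  have i1: "J_act_inv J \<Omega> = \<Omega>" by (rule ext) (simp add: J_act_inv_def inv)
  have i2: "\<Omega> (\<lambda>i. - J (u i)) = \<Omega> u" for u
    using inv[of u] inv[of "\<lambda>i. J (J (u i))"] inv[of "\<lambda>i. J (u i)"] by (simp add: J_simps)
  have s: "deriv_act D k \<Omega> (\<lambda>i. - J (u i)) = deriv_act (\<lambda>z. - J (D (J z))) k \<Omega> u" for u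
  proof -
    have "(\<lambda>i. - J (u i))(l := D (- J (u l))) = (\<lambda>i. - J ((u(l := - J (D (J (u l))))) i))" for l
      by (auto simp: fun_eq_iff J_simps linear_neg[OF linear_D])
    then show ?thesis
      unfolding deriv_act_def by (simp only: i2)
  qed
  have "dc br J k \<Omega> w = - wedge_left \<xi> k (deriv_act D k \<Omega>) (\<lambda>i. - J (w i))"
    unfolding dc_def i1 J_act_def by (rule ce_d_almost_abelian[OF k br_formula])
  also have "\<dots> = - wedge_left \<eta> k (deriv_act (\<lambda>z. - J (D (J z))) k \<Omega>) w"
  proof -
    have "omit i (\<lambda>i. - J (w i)) = (\<lambda>l. - J (omit i w l))" for i
      by (auto simp: omit_def)
    then show ?thesis
      unfolding wedge_left_def by (simp add: s xi_simps)
  qed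
  finally show "dc br J k \<Omega> w = - wedge_left \<eta> k (deriv_act (\<lambda>z. - J (D (J z))) k \<Omega>) w" .
qed

text \<open>With \<open>\<sigma>\<close> the derivation \<open>- J D J\<close> applied to \<open>\<Omega>\<close>, the Leibniz rule and \<open>\<eta> (D z) = lam * \<eta> z\<close>
  turn \<open>d (\<eta> \<and> \<sigma>)\<close> into \<open>- \<xi> \<and> \<eta> \<and> (lam * \<sigma> + D.\<sigma>)\<close>, and only the restriction to \<open>\<hh>\<close> of the
  last factor matters.\<close>

theorem ddc_closed_iff:
  fixes \<Omega> :: "(nat \<Rightarrow> 'a) \<Rightarrow> 'b::real_vector"
  assumes k: "kform k \<Omega>" and inv: "\<And>w. \<Omega> (\<lambda>i. J (w i)) = \<Omega> w"
  shows "ddc_closed br J k \<Omega> \<longleftrightarrow> (\<forall>w. (\<forall>i<k. w i \<in> \<hh>) \<longrightarrow>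
    deriv_act D k (deriv_act D k \<Omega>) w + lam *\<^sub>R deriv_act D k \<Omega> w = 0)"
proof -
  let ?D = "\<lambda>z. - J (D (J z))"
  define \<sigma> where "\<sigma> = deriv_act ?D k \<Omega>"
  define \<tau> where "\<tau> w = lam *\<^sub>R \<sigma> w + deriv_act D k \<sigma> w" for w
  have "linear ?D"
    by (intro linearI) (simp_all add: J_simps linear_add[OF linear_D] linear_scale[OF linear_D])
  then have k\<sigma>: "kform k \<sigma>" unfolding \<sigma>_def by (rule kform_deriv_act[OF k])
  have kD: "kform k (deriv_act D k \<sigma>)" by (rule kform_deriv_act[OF k\<sigma> linear_D])
  have k\<tau>: "kform k \<tau>"
    unfolding \<tau>_def by (intro kform_plus kD kform_compose_linear[OF k\<sigma>] linear_scale_self)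
  have dc: "dc br J k \<Omega> = (\<lambda>w. - wedge_left \<eta> k \<sigma> w)"
    unfolding \<sigma>_def by (rule dc_formula[OF k inv])
  have kw: "kform (Suc k) (wedge_left \<eta> k \<sigma>)" by (rule kform_wedge_left[OF k\<sigma> linear_eta])
  have kdc: "kform (Suc k) (dc br J k \<Omega>)"
    unfolding dc by (rule kform_compose_linear[OF kw linear_uminus])
  have "deriv_act D (Suc k) (dc br J k \<Omega>) w = - wedge_left \<eta> k \<tau> w" for w
  proof -
    have "deriv_act D (Suc k) (dc br J k \<Omega>) w = - deriv_act D (Suc k) (wedge_left \<eta> k \<sigma>) w"
      unfolding dc by (simp add: deriv_act_def sum_negf)
    also have "deriv_act D (Suc k) (wedge_left \<eta> k \<sigma>) w = wedge_left \<eta> k \<tau> w"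
      unfolding deriv_act_wedge_left
      by (simp add: wedge_left_def eta_D \<tau>_def sum.distrib algebra_simps)
    finally show ?thesis .
  qed
  then have "ce_d br (Suc k) (dc br J k \<Omega>) w = wedge_left \<xi> (Suc k) (wedge_left \<eta> k \<tau>) w" for w
    unfolding ce_d_almost_abelian[OF kdc br_formula]
    by (simp add: wedge_left_def[of \<xi>] sum_negf)
  then have "ddc_closed br J k \<Omega> \<longleftrightarrow> (\<forall>w. (\<forall>i<k. w i \<in> \<hh>) \<longrightarrow> \<tau> w = 0)"
    unfolding ddc_closed_def wedge_xi_eta_zero_iff[OF k\<tau>, symmetric] by simp
  moreover have "\<tau> w = deriv_act D k (deriv_act D k \<Omega>) w + lam *\<^sub>R deriv_act D k \<Omega> w"
    if w: "\<forall>i<k. w i \<in> \<hh>" for w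
  proof -
    have DD: "?D z = D z" if "z \<in> \<hh>" for z
      using D_J[OF that] by simp
    have \<sigma>: "\<sigma> u = deriv_act D k \<Omega> u" if "\<forall>i<k. u i \<in> \<hh>" for u
      unfolding \<sigma>_def deriv_act_def using that DD by (intro sum.cong) auto
    have "deriv_act D k \<sigma> w = deriv_act D k (deriv_act D k \<Omega>) w"
      unfolding deriv_act_def[of D k \<sigma>] deriv_act_def[of D k "deriv_act D k \<Omega>"]
      using w D_hh by (intro sum.cong refl \<sigma>) auto
    with \<sigma>[OF w] show ?thesis by (simp add: \<tau>_def)
  qed
  ultimately show ?thesis by (auto simp: add.commute)
qed

end

section \<open>Necessity\<close>

lemma halves: "{..<p + p} = {..<p} \<union> {p..<p + p}" for p :: nat
  by auto

text \<open>A form of type \<open>(p, p)\<close> is \<open>J\<close>-invariant, as \<open>\<i> ^ p * (-\<i>) ^ p = 1\<close>, and is killed by the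
  derivation \<open>J\<close>, as \<open>p * \<i> + p * (-\<i>) = 0\<close>.\<close>

lemma pp_form_J:
  assumes "pq_form J p p \<Omega>"
  shows "\<Omega> (\<lambda>i. J (w i)) = \<Omega> w" and "deriv_act J (p + p) \<Omega> w = 0"
proof -
  define \<mu> where "\<mu> i = (if i < p then \<i> else - \<i>)" for i :: nat
  from assms obtain m :: nat and c \<alpha> \<beta> where \<alpha>\<beta>: "\<forall>s<m. (\<forall>i<p. \<alpha> s i \<in> forms10 J UNIV) \<and> (\<forall>i<p. \<beta> s i \<in> forms10 J UNIV)"
    and \<Omega>: "\<Omega> = (\<lambda>v. \<Sum>s<m. c s * wedge1 (p + p) (\<lambda>i. if i < p then \<alpha> s i else (\<lambda>x. cnj (\<beta> s (i - p) x))) v)"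
    unfolding pq_form_def by blast
  let ?\<phi> = "\<lambda>s i. if i < p then \<alpha> s i else (\<lambda>x. cnj (\<beta> s (i - p) x))"
  have eig: "?\<phi> s i (J x) = \<mu> i * ?\<phi> s i x" if "s < m" "i < p + p" for s i x
    using \<alpha>\<beta> that by (auto simp: \<mu>_def forms10_def)
  have "(\<Prod>i<p + p. \<mu> i) = 1"
    unfolding halves
    by (subst prod.union_disjoint) (auto simp: \<mu>_def simp flip: power_mult_distrib)
  moreover have "wedge1 (p + p) (?\<phi> s) (\<lambda>i. J (w i)) = (\<Prod>i<p + p. \<mu> i) * wedge1 (p + p) (?\<phi> s) w"
    if "s < m" for s
    by (rule wedge1_eigen) (use eig that in blast)
  ultimately show "\<Omega> (\<lambda>i. J (w i)) = \<Omega> w"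
    unfolding \<Omega> by (intro sum.cong) auto
  have "(\<Sum>i<p + p. \<mu> i) = 0"
    unfolding halves by (subst sum.union_disjoint) (auto simp: \<mu>_def)
  moreover have "deriv_act J (p + p) (wedge1 (p + p) (?\<phi> s)) w = (\<Sum>i<p + p. \<mu> i) * wedge1 (p + p) (?\<phi> s) w"
    if "s < m" for s
    by (rule deriv_act_wedge1) (use eig that in blast)
  ultimately have "deriv_act J (p + p) (wedge1 (p + p) (?\<phi> s)) w = 0" if "s < m" for s
    using that by simp
  moreover have "deriv_act J (p + p) \<Omega> w = (\<Sum>s<m. c s * deriv_act J (p + p) (wedge1 (p + p) (?\<phi> s)) w)"
    unfolding \<Omega> deriv_act_def sum_distrib_left by (rule sum.swap)
  ultimately show "deriv_act J (p + p) \<Omega> w = 0" by simp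
qed

lemma sum_pairs: "(\<Sum>l<2 * q. f l) = (\<Sum>i<q. f (2 * i) + f (Suc (2 * i)))" for f :: "nat \<Rightarrow> 'b::comm_monoid_add"
  by (induction q) (auto simp: add.assoc)

context complex_space
begin

lemma real_pp_form_J:
  assumes "real_pp_form J p \<Omega>"
  shows "\<Omega> (\<lambda>i. J (w i)) = \<Omega> w" and "deriv_act J (2 * p) \<Omega> w = 0"
proof -
  have pq: "pq_form J p p (\<lambda>v. complex_of_real (\<Omega> v))"
    using assms by (simp add: real_pp_form_def)
  show "\<Omega> (\<lambda>i. J (w i)) = \<Omega> w"
    using pp_form_J(1)[OF pq] by simp
  have "complex_of_real (deriv_act J (2 * p) \<Omega> w) = 0"
    using pp_form_J(2)[OF pq, of w] by (simp add: deriv_act_def mult_2)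
  then show "deriv_act J (2 * p) \<Omega> w = 0" by simp
qed

lemma transverse_frame_nonzero:
  assumes \<Omega>: "transverse J p \<Omega>" and w: "inj_on w {..<p}" "jv.independent (w ` {..<p})"
  shows "\<Omega> (frame w) \<noteq> 0"
proof -
  let ?W = "jv.span (w ` {..<p})"
  have "dim ?W = 2 * p"
    using dim_jv_span[OF w(2)] w(1) by (simp add: card_image)
  moreover have "J ` ?W \<subseteq> ?W" by (auto intro: J_jv_span)
  ultimately obtain \<gamma> r where \<gamma>: "basis10 J ?W p \<gamma>" "r > 0"
      "\<forall>v. (\<forall>i<2 * p. v i \<in> ?W) \<longrightarrow> of_real (\<Omega> v) = of_real r * positive_volume p \<gamma> v"
    using \<Omega> subspace_jv_span unfolding transverse_def by blast
  have "frame w i \<in> ?W" if "i < 2 * p" for i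
    using that J_jv_span[OF jv.span_base[of "w (i div 2)" "w ` {..<p}"]] jv.span_base[of "w (i div 2)" "w ` {..<p}"]
    by (auto simp: frame_def)
  then have "of_real (\<Omega> (frame w)) = of_real r * positive_volume p \<gamma> (frame w)"
    using \<gamma>(3) by blast
  then show ?thesis
    using \<gamma>(2) positive_volume_frame_nonzero[OF refl \<gamma>(1)] by auto
qed

text \<open>On a frame \<open>g\<^sub>0, J g\<^sub>0, g\<^sub>1, J g\<^sub>1, \<dots>\<close> whose span is invariant under \<open>T\<close>, only the diagonal
  entries of \<open>T\<close> contribute, each with its trace \<open>2 * Re c\<close> as a real endomorphism.\<close>

lemma frame_deriv_sum:
  fixes \<omega> :: "(nat \<Rightarrow> 'a) \<Rightarrow> real"
  assumes k: "kform k \<omega>" and q: "2 * q \<le> k" and u: "\<And>l. l < 2 * q \<Longrightarrow> u l = frame g l"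
    and TJ: "\<And>i. i < q \<Longrightarrow> T (J (g i)) = J (T (g i))"
    and T: "\<And>i. i < q \<Longrightarrow> T (g i) - jscale J (c i) (g i) \<in> jv.span (g ` ({..<q} - {i}))"
  shows "(\<Sum>l<2 * q. \<omega> (u(l := T (u l)))) = (\<Sum>i<q. 2 * Re (c i)) * \<omega> u"
proof -
  have "\<omega> (u(2 * i := T (u (2 * i)))) = Re (c i) *\<^sub>R \<omega> u \<and>
      \<omega> (u(Suc (2 * i) := T (u (Suc (2 * i))))) = Re (c i) *\<^sub>R \<omega> u" if i: "i < q" for i
  proof -
    define s where "s = T (g i) - jscale J (c i) (g i)"
    have even: "u (2 * j) = g j" and odd: "u (Suc (2 * j)) = J (g j)" if "j < q" for j
      using that by (simp_all add: u frame_def)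
    have s: "s \<in> jv.span (g ` ({..<q} - {i}))" using T[OF i] by (simp add: s_def)
    have "g ` ({..<q} - {i}) \<union> J ` g ` ({..<q} - {i}) \<subseteq> u ` ({..<k} - {2 * i, Suc (2 * i)})"
      (is "_ \<subseteq> ?U")
    proof -
      have "g j \<in> ?U \<and> J (g j) \<in> ?U" if "j \<in> {..<q} - {i}" for j
      proof -
        have j: "j < q" "j \<noteq> i" using that by auto
        have "2 * j \<in> {..<k} - {2 * i, Suc (2 * i)}" "Suc (2 * j) \<in> {..<k} - {2 * i, Suc (2 * i)}"
          using j q double_not_eq_Suc_double[of j i] Suc_double_not_eq_double[of j i] by auto
        from this[THEN imageI[of _ _ u]] show ?thesis
          unfolding even[OF j(1)] odd[OF j(1)] ..
      qed
      then show ?thesis by blast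
    qed
    then have sub: "jv.span (g ` ({..<q} - {i})) \<subseteq> span (u ` ({..<k} - {2 * i, Suc (2 * i)}))"
      unfolding span_J_closure[symmetric] by (rule span_mono)
    have "span (u ` ({..<k} - {2 * i, Suc (2 * i)})) \<subseteq> span (u ` ({..<k} - {2 * i}))"
      "span (u ` ({..<k} - {2 * i, Suc (2 * i)})) \<subseteq> span (u ` ({..<k} - {Suc (2 * i)}))"
      by (intro span_mono image_mono; blast)+
    with s J_jv_span[OF s] sub
    have s1: "s \<in> span (u ` ({..<k} - {2 * i}))" "J s \<in> span (u ` ({..<k} - {Suc (2 * i)}))"
      by (auto 0 3)
    have o: "J (g i) \<in> span (u ` ({..<k} - {2 * i}))" "g i \<in> span (u ` ({..<k} - {Suc (2 * i)}))"
    proof -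
      have "Suc (2 * i) \<in> {..<k} - {2 * i}" "2 * i \<in> {..<k} - {Suc (2 * i)}"
        using i q by auto
      from this[THEN imageI[of _ _ u]]
      show "J (g i) \<in> span (u ` ({..<k} - {2 * i}))" "g i \<in> span (u ` ({..<k} - {Suc (2 * i)}))"
        unfolding even[OF i] odd[OF i] by (auto intro: span_base)
    qed
    have "T (u (2 * i)) - Re (c i) *\<^sub>R u (2 * i) = Im (c i) *\<^sub>R J (g i) + s"
      using even[OF i] by (simp add: s_def jscale_def)
    also have "\<dots> \<in> span (u ` ({..<k} - {2 * i}))"
      by (intro span_add span_scale o s1)
    finally have 1: "\<omega> (u(2 * i := T (u (2 * i)))) = Re (c i) *\<^sub>R \<omega> u"
      using i q by (intro kform_replace_slot[OF k]) auto
    have "T (u (Suc (2 * i))) - Re (c i) *\<^sub>R u (Suc (2 * i)) = J s - Im (c i) *\<^sub>R g i"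
      using odd[OF i] by (simp add: TJ[OF i] s_def jscale_def J_simps)
    also have "\<dots> \<in> span (u ` ({..<k} - {Suc (2 * i)}))"
      by (intro span_diff span_scale o s1)
    finally have "\<omega> (u(Suc (2 * i) := T (u (Suc (2 * i))))) = Re (c i) *\<^sub>R \<omega> u"
      using i q by (intro kform_replace_slot[OF k]) auto
    with 1 show ?thesis by blast
  qed
  then show ?thesis
    unfolding sum_pairs sum_distrib_right by (intro sum.cong) auto
qed

end

text \<open>Let \<open>\<epsilon> j\<close> mark the vectors of a Jordan basis that are mapped to a multiple of themselves plus
  their predecessor. The set \<open>I\<close> spans an invariant subspace, modulo which the vectors \<open>k\<close> and \<open>Suc k\<close>
  form a Jordan pair. If there is a mark in the initial segment of length \<open>q + 2\<close>, the last such mark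
  is used: nothing above the pair is mapped into it, so that \<open>I\<close> is the rest of the segment. Otherwise
  the initial segment of length \<open>q\<close> consists of eigenvectors, and the first mark of all gives a pair
  above it.\<close>

lemma jordan_pair_over_invariant_set:
  fixes \<epsilon> :: "nat \<Rightarrow> bool"
  assumes \<epsilon>: "\<exists>k<m. \<epsilon> k" and \<epsilon>0: "\<not> \<epsilon> 0" and q: "q + 2 \<le> m"
  obtains k I where "Suc k < m" "\<epsilon> (Suc k)" "I \<subseteq> {..<m}" "card I = q" "k \<notin> I" "Suc k \<notin> I"
    "\<And>j. j \<in> I \<Longrightarrow> \<epsilon> j \<Longrightarrow> j - 1 \<in> I" "\<epsilon> k \<Longrightarrow> k - 1 \<in> I"
proof (cases "\<exists>k\<le>Suc q. \<epsilon> k")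
  case True
  define k where "k = Max {k. k \<le> Suc q \<and> \<epsilon> k}"
  have fin: "finite {k. k \<le> Suc q \<and> \<epsilon> k}" by (rule finite_subset[of _ "{..Suc q}"]) auto
  have k: "k \<le> Suc q" "\<epsilon> k" using Max_in[OF fin] True by (auto simp: k_def)
  have max: "\<not> \<epsilon> j" if "k < j" "j \<le> Suc q" for j
    using Max_ge[OF fin, of j] that unfolding k_def[symmetric] by auto
  obtain k' where k': "k = Suc k'" using k \<epsilon>0 by (cases k) auto
  show thesis
  proof (rule that[of k' "{..Suc q} - {k', Suc k'}"])
    show "card ({..Suc q} - {k', Suc k'}) = q"
      using k k' by (subst card_Diff_subset) auto
    show "j - 1 \<in> {..Suc q} - {k', Suc k'}" if "j \<in> {..Suc q} - {k', Suc k'}" "\<epsilon> j" for j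
    proof -
      have "j < k'" using that max[of j] k' by force
      then show ?thesis using k k' by auto
    qed
    show "k' - 1 \<in> {..Suc q} - {k', Suc k'}" if "\<epsilon> k'"
      using that \<epsilon>0 k k' by (cases k') auto
  qed (use k k' q in auto)
next
  case False
  define k where "k = (LEAST k. k < m \<and> \<epsilon> k)"
  have k: "k < m" "\<epsilon> k" using LeastI_ex[of "\<lambda>k. k < m \<and> \<epsilon> k"] \<epsilon> by (auto simp: k_def)
  have min: "\<not> \<epsilon> j" if "j < k" for j
    using not_less_Least[of j "\<lambda>k. k < m \<and> \<epsilon> k"] that k by (auto simp: k_def)
  have kq: "Suc q < k" using False k by (meson not_le)
  obtain k' where k': "k = Suc k'" using kq by (cases k) auto
  show thesis
  proof (rule that[of k' "{..<q}"])
    show "j - 1 \<in> {..<q}" if "j \<in> {..<q}" for j using that by auto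
    show "k' - 1 \<in> {..<q}" if "\<epsilon> k'" using min[of k'] that k' by simp
  qed (use k k' kq q in auto)
qed

text \<open>The equation of the pluriclosed forms on a Jordan pair, with \<open>h11\<close>, \<open>h12\<close>, \<open>h22\<close> the values at
  \<open>(e\<^sub>1, J e\<^sub>1)\<close>, \<open>(e\<^sub>1, J e\<^sub>2)\<close>, \<open>(e\<^sub>2, J e\<^sub>2)\<close>. If \<open>h11\<close> were nonzero, the three equations would give in
  turn \<open>s * (s + lam) = 0\<close>, \<open>2 * s + lam = 0\<close> and \<open>2 * h11 = 0\<close>.\<close>

lemma jordan_pair_values_zero:
  fixes s lam h11 h12 h22 :: real
  assumes "s * (s * h11) + lam * (s * h11) = 0"
    and "s * (s * h12 + h11) + s * h11 + lam * (s * h12 + h11) = 0"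
    and "s * (s * h22 + 2 * h12) + 2 * (s * h12 + h11) + lam * (s * h22 + 2 * h12) = 0"
  shows "h11 = 0"
proof (rule ccontr)
  assume h: "h11 \<noteq> 0"
  have "s * (s + lam) * h11 = 0" using assms(1) by (simp add: algebra_simps)
  with h have 1: "s * (s + lam) = 0" by simp
  have "s * (s + lam) * h12 + (2 * s + lam) * h11 = 0" using assms(2) by (simp add: algebra_simps)
  with h have 2: "2 * s + lam = 0" unfolding 1 by simp
  have "s * (s + lam) * h22 + 2 * (2 * s + lam) * h12 + 2 * h11 = 0"
    using assms(3) by (simp add: algebra_simps)
  with h show False unfolding 1 2 by simp
qed

context almost_abelian_complex
begin

text \<open>The system satisfied by the values of a form on a Jordan pair \<open>e\<^sub>1, e\<^sub>2\<close>: the operator acts on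
  the triple \<open>(X (e\<^sub>1, J e\<^sub>1), X (e\<^sub>1, J e\<^sub>2), X (e\<^sub>2, J e\<^sub>2))\<close> as \<open>s + N\<close> with \<open>N\<close> nilpotent.\<close>

lemma jordan_pair_step:
  fixes X Y :: "'a \<Rightarrow> 'a \<Rightarrow> real"
  assumes X: "bilinear X" and alt: "\<And>a b. X a b = - X b a"
    and skew: "\<And>a b. a \<in> \<hh> \<Longrightarrow> b \<in> \<hh> \<Longrightarrow> X (J a) b = - X a (J b)"
    and R: "\<And>r b. r \<in> R \<Longrightarrow> X r b = 0" and JR: "\<And>r. r \<in> R \<Longrightarrow> J r \<in> R"
    and Y: "\<And>a b. Y a b = c * X a b + X (D a) b + X a (D b)"
    and e: "e1 \<in> \<hh>" "e2 \<in> \<hh>"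
    and D1: "D e1 = jscale J z e1 + r" and r: "r \<in> R" and D2: "D e2 = jscale J z e2 + e1"
    and s: "s = c + 2 * Re z"
  shows "Y e1 (J e1) = s * X e1 (J e1)"
    and "Y e1 (J e2) = s * X e1 (J e2) + X e1 (J e1)"
    and "Y e2 (J e2) = s * X e2 (J e2) + 2 * X e1 (J e2)"
proof -
  note bl = bilinear_ladd[OF X] bilinear_radd[OF X] bilinear_lmul[OF X] bilinear_rmul[OF X]
    bilinear_lneg[OF X] bilinear_rneg[OF X] bilinear_rsub[OF X]
  have aa0: "X a a = 0" for a using alt[of a a] by simp
  have R2: "X b r' = 0" if "r' \<in> R" for r' b using R[OF that] alt[of b r'] by simp
  note Rs = R[OF r] R[OF JR[OF r]] R2[OF r] R2[OF JR[OF r]]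
  have J1: "D (J e1) = Re z *\<^sub>R J e1 - Im z *\<^sub>R e1 + J r"
    unfolding D_J[OF e(1)] D1 by (simp add: jscale_def J_simps)
  have J2: "D (J e2) = Re z *\<^sub>R J e2 - Im z *\<^sub>R e2 + J e1"
    unfolding D_J[OF e(2)] D2 by (simp add: jscale_def J_simps)
  have JJ12: "X (J e1) (J e2) = X e1 e2" "X (J e1) (J e1) = 0" "X (J e2) (J e2) = 0" "X e1 e1 = 0" "X e2 e2 = 0"
    using skew[OF e(1) J_hh[OF e(2)]] by (simp_all add: bl aa0)
  have X21: "X e2 (J e1) = X e1 (J e2)"
    using alt[of e2 "J e1"] skew[OF e] by simp
  show "Y e1 (J e1) = s * X e1 (J e1)"
    unfolding Y D1 J1 s jscale_def by (simp add: bl Rs JJ12 algebra_simps)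
  show "Y e1 (J e2) = s * X e1 (J e2) + X e1 (J e1)"
    unfolding Y D1 J2 s jscale_def by (simp add: bl Rs JJ12 algebra_simps)
  show "Y e2 (J e2) = s * X e2 (J e2) + 2 * X e1 (J e2)"
    unfolding Y D2 J2 s jscale_def by (simp add: bl Rs JJ12 X21 algebra_simps)
qed

text \<open>The frame of \<open>g\<^sub>0, \<dots>, g\<^sub>q\<^sub>-\<^sub>1\<close> followed by \<open>a\<close> and \<open>b\<close>; inserted into a form of degree \<open>2 * q + 2\<close>
  it leaves a 2-form in \<open>a\<close> and \<open>b\<close>.\<close>

definition with_ends :: "(nat \<Rightarrow> 'a) \<Rightarrow> nat \<Rightarrow> 'a \<Rightarrow> 'a \<Rightarrow> nat \<Rightarrow> 'a" where
  "with_ends g q a b = (frame g)(2 * q := a, Suc (2 * q) := b)"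

lemma with_ends_bilinear:
  fixes \<omega> :: "(nat \<Rightarrow> 'a) \<Rightarrow> real"
  assumes k: "kform (Suc (Suc (2 * q))) \<omega>"
  shows "bilinear (\<lambda>a b. \<omega> (with_ends g q a b))"
    and "\<omega> (with_ends g q a b) = - \<omega> (with_ends g q b a)"
    and "r \<in> jv.span (g ` {..<q}) \<Longrightarrow> \<omega> (with_ends g q r b) = 0"
proof -
  show "\<omega> (with_ends g q a b) = - \<omega> (with_ends g q b a)" for a b
    unfolding with_ends_def by (rule kform_swap[OF k]) auto
  note alt = this
  have "linear (\<lambda>b. \<omega> (with_ends g q a b))" for a
    unfolding with_ends_def by (rule kform_linear[OF k]) simp
  moreover from this have "linear (\<lambda>a. \<omega> (with_ends g q a b))" for b
    unfolding alt[of _ b] by (rule linear_compose_neg)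
  ultimately show "bilinear (\<lambda>a b. \<omega> (with_ends g q a b))"
    by (simp add: bilinear_def)
  assume r: "r \<in> jv.span (g ` {..<q})"
  let ?u = "with_ends g q 0 b"
  have "g ` {..<q} \<union> J ` g ` {..<q} \<subseteq> ?u ` ({..<Suc (Suc (2 * q))} - {2 * q})"
    unfolding frame_image[symmetric] by (force simp: with_ends_def)
  then have "jv.span (g ` {..<q}) \<subseteq> span (?u ` ({..<Suc (Suc (2 * q))} - {2 * q}))"
    unfolding span_J_closure[symmetric] by (rule span_mono)
  with r have "\<omega> (?u(2 * q := r)) = 0 *\<^sub>R \<omega> ?u"
    by (intro kform_replace_slot[OF k]) auto
  moreover have "?u(2 * q := r) = with_ends g q r b"
    by (auto simp: with_ends_def fun_eq_iff)
  ultimately show "\<omega> (with_ends g q r b) = 0" by simp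
qed

lemma with_ends_deriv:
  fixes \<omega> :: "(nat \<Rightarrow> 'a) \<Rightarrow> real"
  assumes k: "kform (Suc (Suc (2 * q))) \<omega>"
    and TJ: "\<And>i. i < q \<Longrightarrow> T (J (g i)) = J (T (g i))"
    and T: "\<And>i. i < q \<Longrightarrow> T (g i) - jscale J (c i) (g i) \<in> jv.span (g ` ({..<q} - {i}))"
  shows "deriv_act T (Suc (Suc (2 * q))) \<omega> (with_ends g q a b) =
    (\<Sum>i<q. 2 * Re (c i)) * \<omega> (with_ends g q a b) +
    \<omega> (with_ends g q (T a) b) + \<omega> (with_ends g q a (T b))"
proof -
  let ?u = "with_ends g q a b"
  have "(\<Sum>l<2 * q. \<omega> (?u(l := T (?u l)))) = (\<Sum>i<q. 2 * Re (c i)) * \<omega> ?u"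
    by (rule frame_deriv_sum[OF k _ _ TJ T]) (auto simp: with_ends_def)
  moreover have "?u(2 * q := T (?u (2 * q))) = with_ends g q (T a) b"
    "?u(Suc (2 * q) := T (?u (Suc (2 * q)))) = with_ends g q a (T b)"
    by (auto simp: with_ends_def fun_eq_iff)
  ultimately show ?thesis by (simp only: deriv_act_def sum.lessThan_Suc)
qed

text \<open>The entries of the Jordan matrix are the \<open>\<zeta> j\<close> on the diagonal and ones above it in the columns
  \<open>j\<close> with \<open>\<epsilon> j\<close>. Such a column is never the first one, so \<open>j - 1\<close> is a true predecessor.\<close>

definition jordan_basis :: "nat \<Rightarrow> (nat \<Rightarrow> 'a) \<Rightarrow> (nat \<Rightarrow> complex) \<Rightarrow> (nat \<Rightarrow> bool) \<Rightarrow> bool" where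
  "jordan_basis m f \<zeta> \<epsilon> \<longleftrightarrow> inj_on f {..<m} \<and> jv.independent (f ` {..<m}) \<and> jv.span (f ` {..<m}) = \<hh> \<and>
     \<not> \<epsilon> 0 \<and> (\<forall>j<m. D (f j) = jscale J (\<zeta> j) (f j) + (if \<epsilon> j then f (j - 1) else 0)) \<and>
     (\<forall>j<m. \<epsilon> j \<longrightarrow> \<zeta> (j - 1) = \<zeta> j)"

lemma jordan_basis_mem: "jordan_basis m f \<zeta> \<epsilon> \<Longrightarrow> j < m \<Longrightarrow> f j \<in> \<hh>"
  unfolding jordan_basis_def using jv.span_base[of "f j" "f ` {..<m}"] by auto

lemma jordan_basis_subfamily:
  assumes jb: "jordan_basis m f \<zeta> \<epsilon>" and h: "inj_on h {..<q}" "h ` {..<q} \<subseteq> {..<m}"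
  shows "inj_on (\<lambda>i. f (h i)) {..<q}" and "jv.independent ((\<lambda>i. f (h i)) ` {..<q})"
proof -
  have f: "inj_on f {..<m}" "jv.independent (f ` {..<m})"
    using jb by (auto simp: jordan_basis_def)
  show "inj_on (\<lambda>i. f (h i)) {..<q}"
    using comp_inj_on[OF h(1) inj_on_subset[OF f(1) h(2)]] by (simp add: o_def)
  show "jv.independent ((\<lambda>i. f (h i)) ` {..<q})"
    by (rule jv.independent_mono[OF f(2)]) (use h(2) in auto)
qed

lemma p_pluriclosed_on_hh:
  assumes \<Omega>: "p_pluriclosed_structure br J p \<Omega>" and w: "\<And>i. i < 2 * p \<Longrightarrow> w i \<in> \<hh>"
  shows "deriv_act D (2 * p) (deriv_act D (2 * p) \<Omega>) w + lam * deriv_act D (2 * p) \<Omega> w = 0"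
proof -
  have r: "real_pp_form J p \<Omega>" and c: "ddc_closed br J (2 * p) \<Omega>"
    using \<Omega> by (auto simp: p_pluriclosed_structure_def transverse_def)
  have k: "kform (2 * p) \<Omega>" using r by (simp add: real_pp_form_def)
  show ?thesis
    using c w unfolding ddc_closed_iff[OF k real_pp_form_J(1)[OF r]] by simp
qed

text \<open>Otherwise some Jordan pair \<open>e\<^sub>1, e\<^sub>2\<close> lies over an invariant subspace of complex dimension
  \<open>p - 1\<close>, and the structure would vanish on that subspace extended by \<open>e\<^sub>1\<close>.\<close>

theorem pluriclosed_imp_diagonal:
  assumes \<Omega>: "p_pluriclosed_structure br J p \<Omega>" and jb: "jordan_basis m f \<zeta> \<epsilon>"
    and p: "1 \<le> p" "Suc p \<le> m"
  shows "\<forall>j<m. \<not> \<epsilon> j"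
proof (rule ccontr)
  assume "\<not> (\<forall>j<m. \<not> \<epsilon> j)"
  moreover obtain q where q: "p = Suc q" using p by (cases p) auto
  moreover have "\<not> \<epsilon> 0" using jb by (simp add: jordan_basis_def)
  ultimately obtain k I where k: "Suc k < m" "\<epsilon> (Suc k)" and I: "I \<subseteq> {..<m}" "card I = q" "k \<notin> I" "Suc k \<notin> I"
    "\<And>j. j \<in> I \<Longrightarrow> \<epsilon> j \<Longrightarrow> j - 1 \<in> I" "\<epsilon> k \<Longrightarrow> k - 1 \<in> I"
    using jordan_pair_over_invariant_set[of m \<epsilon> q] p by auto
  have "finite I" using I(1) finite_subset by blast
  then obtain h where h: "bij_betw h {..<q} I"
    using I(2) ex_bij_betw_nat_finite by (metis lessThan_atLeast0)
  define g where "g i = f (h i)" for i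
  let ?k = "Suc (Suc (2 * q))" and ?e1 = "f k" and ?e2 = "f (Suc k)"
  let ?c = "\<Sum>i<q. 2 * Re (\<zeta> (h i))" and ?R = "jv.span (g ` {..<q})"
  have two_p: "2 * p = ?k" using q by simp
  have r: "real_pp_form J p \<Omega>"
    using \<Omega> by (simp add: p_pluriclosed_structure_def transverse_def)
  have k\<Omega>: "kform ?k \<Omega>" using r two_p by (simp add: real_pp_form_def)
  have kD: "kform ?k (deriv_act D ?k \<Omega>)" by (rule kform_deriv_act[OF k\<Omega> linear_D])
  have hI: "h i \<in> I" "h i < m" if "i < q" for i
    using h I(1) that by (auto simp: bij_betw_def)
  have gI: "g ` {..<q} = f ` I" using h by (auto simp: g_def bij_betw_def)
  have Df: "D (f j) = jscale J (\<zeta> j) (f j) + (if \<epsilon> j then f (j - 1) else 0)" if "j < m" for j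
    using jb that by (simp add: jordan_basis_def)
  have ghh: "g i \<in> \<hh>" if "i < q" for i
    using jordan_basis_mem[OF jb hI(2)[OF that]] by (simp add: g_def)
  have Dg: "D (g i) - jscale J (\<zeta> (h i)) (g i) \<in> jv.span (g ` ({..<q} - {i}))" if i: "i < q" for i
  proof (cases "\<epsilon> (h i)")
    case True
    then have "h i - 1 \<in> I" "h i \<noteq> 0"
      using I(5) hI(1)[OF i] jb by (auto simp: jordan_basis_def intro: gr0I)
    moreover from this obtain l where "l < q" "h l = h i - 1"
      using h unfolding bij_betw_def by (metis imageE lessThan_iff)
    ultimately have "l < q" "l \<noteq> i" "f (h i - 1) = g l" by (auto simp: g_def)
    then show ?thesis
      using True by (auto simp: g_def[of i] Df[OF hI(2)[OF i]] intro!: jv.span_base)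
  next
    case False
    then show ?thesis by (simp add: g_def Df[OF hI(2)[OF i]] jv.span_zero)
  qed
  \<comment> \<open>The 2-forms that remain of \<open>\<Omega>\<close>, \<open>D.\<Omega>\<close> and \<open>D.(D.\<Omega>)\<close> after insertion of a basis of the invariant
    subspace.\<close>
  define X where "X a b = \<Omega> (with_ends g q a b)" for a b
  define Y where "Y a b = deriv_act D ?k \<Omega> (with_ends g q a b)" for a b
  define Z where "Z a b = deriv_act D ?k (deriv_act D ?k \<Omega>) (with_ends g q a b)" for a b
  have Y: "Y a b = ?c * X a b + X (D a) b + X a (D b)" for a b
    unfolding X_def Y_def by (rule with_ends_deriv[OF k\<Omega> D_J[OF ghh] Dg])
  have Z: "Z a b = ?c * Y a b + Y (D a) b + Y a (D b)" for a b
    unfolding Y_def Z_def by (rule with_ends_deriv[OF kD D_J[OF ghh] Dg])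
  \<comment> \<open>A form of type \<open>(p, p)\<close> is killed by the derivation \<open>J\<close>, which has no real trace on the frame
    of \<open>g\<close>.\<close>
  have skewX: "X (J a) b = - X a (J b)" for a b
  proof -
    have "deriv_act J ?k \<Omega> (with_ends g q a b) =
        (\<Sum>i<q. 2 * Re \<i>) * X a b + X (J a) b + X a (J b)"
      unfolding X_def by (rule with_ends_deriv[OF k\<Omega>]) (simp_all add: jv.span_zero)
    moreover have "deriv_act J ?k \<Omega> (with_ends g q a b) = 0"
      using real_pp_form_J(2)[OF r] by (simp only: two_p)
    ultimately show ?thesis by simp
  qed
  have skewY: "Y (J a) b = - Y a (J b)" if "a \<in> \<hh>" "b \<in> \<hh>" for a b
    unfolding Y by (simp add: D_J[OF that(1)] D_J[OF that(2)] skewX)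
  have e: "?e1 \<in> \<hh>" "?e2 \<in> \<hh>" using jordan_basis_mem[OF jb] k by auto
  define r where "r = (if \<epsilon> k then f (k - 1) else 0)"
  have rR: "r \<in> ?R" unfolding r_def gI using I(6) by (auto intro: jv.span_base jv.span_zero)
  have \<zeta>: "\<zeta> (Suc k) = \<zeta> k" using jb k by (force simp: jordan_basis_def)
  have D1: "D ?e1 = jscale J (\<zeta> k) ?e1 + r" using Df[of k] k by (simp add: r_def)
  have D2: "D ?e2 = jscale J (\<zeta> k) ?e2 + ?e1" using Df[of "Suc k"] k \<zeta> by simp
  define s where "s = ?c + 2 * Re (\<zeta> k)"
  note stepX = jordan_pair_step[OF with_ends_bilinear(1)[OF k\<Omega>, of g, folded X_def]
    with_ends_bilinear(2)[OF k\<Omega>, of g, folded X_def] skewX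
    with_ends_bilinear(3)[OF k\<Omega>, of _ g, folded X_def] J_jv_span Y e D1 rR D2 s_def]
  note stepY = jordan_pair_step[OF with_ends_bilinear(1)[OF kD, of g, folded Y_def]
    with_ends_bilinear(2)[OF kD, of g, folded Y_def] skewY
    with_ends_bilinear(3)[OF kD, of _ g, folded Y_def] J_jv_span Z e D1 rR D2 s_def]
  have eq: "Z a b + lam * Y a b = 0" if "a \<in> \<hh>" "b \<in> \<hh>" for a b
  proof -
    have "with_ends g q a b i \<in> \<hh>" if "i < 2 * p" for i
      using that two_p ghh[of "i div 2"] J_hh[OF ghh[of "i div 2"]] \<open>a \<in> \<hh>\<close> \<open>b \<in> \<hh>\<close>
      by (auto simp: with_ends_def frame_def less_Suc_eq)
    from p_pluriclosed_on_hh[OF \<Omega> this] show ?thesis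
      by (simp only: Y_def Z_def two_p)
  qed
  have sX: "Y ?e1 (J ?e1) = s * X ?e1 (J ?e1)" "Y ?e1 (J ?e2) = s * X ?e1 (J ?e2) + X ?e1 (J ?e1)"
    "Y ?e2 (J ?e2) = s * X ?e2 (J ?e2) + 2 * X ?e1 (J ?e2)"
    by (rule stepX; assumption)+
  have sY: "Z ?e1 (J ?e1) = s * Y ?e1 (J ?e1)" "Z ?e1 (J ?e2) = s * Y ?e1 (J ?e2) + Y ?e1 (J ?e1)"
    "Z ?e2 (J ?e2) = s * Y ?e2 (J ?e2) + 2 * Y ?e1 (J ?e2)"
    by (rule stepY; assumption)+
  have "X ?e1 (J ?e1) = 0"
    using eq[OF e(1) J_hh[OF e(1)]] eq[OF e(1) J_hh[OF e(2)]] eq[OF e(2) J_hh[OF e(2)]]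
    unfolding sY sX by (rule jordan_pair_values_zero)
  moreover have "X ?e1 (J ?e1) \<noteq> 0"
  proof -
    let ?h = "h(q := k)"
    have "inj_on ?h {..<p}" "?h ` {..<p} \<subseteq> {..<m}"
      using h I(1,3) k hI by (auto simp: q bij_betw_def inj_on_def lessThan_Suc)
    from jordan_basis_subfamily[OF jb this]
    have "\<Omega> (frame (\<lambda>i. f (?h i))) \<noteq> 0"
      using \<Omega> by (intro transverse_frame_nonzero) (simp_all add: p_pluriclosed_structure_def)
    moreover have "\<Omega> (frame (\<lambda>i. f (?h i))) = X ?e1 (J ?e1)"
      unfolding X_def by (rule kform_cong[OF k\<Omega>]) (auto simp: with_ends_def frame_def g_def)
    ultimately show ?thesis by simp
  qed
  ultimately show False by contradiction
qed

text \<open>The span of eigenvectors is invariant, so that the derivation multiplies the value on their frame by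
  the real trace \<open>s\<close> of \<open>D\<close> on it; the equation becomes \<open>s * (s + lam) = 0\<close>.\<close>

theorem pluriclosed_imp_trace:
  assumes \<Omega>: "p_pluriclosed_structure br J p \<Omega>" and jb: "jordan_basis m f \<zeta> \<epsilon>"
    and d: "\<forall>j<m. \<not> \<epsilon> j" and I: "I \<subseteq> {..<m}" "card I = p"
  shows "(\<Sum>i\<in>I. 2 * Re (\<zeta> i)) = 0 \<or> (\<Sum>i\<in>I. 2 * Re (\<zeta> i)) = - lam"
proof -
  have "finite I" using I(1) finite_subset by blast
  then obtain h where h: "bij_betw h {..<p} I"
    using I(2) ex_bij_betw_nat_finite by (metis lessThan_atLeast0)
  define g where "g i = f (h i)" for i
  have hm: "h i < m" if "i < p" for i
    using h I(1) that by (auto simp: bij_betw_def)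
  have ghh: "g i \<in> \<hh>" if "i < p" for i
    using jordan_basis_mem[OF jb hm[OF that]] by (simp add: g_def)
  have Dg: "D (g i) - jscale J (\<zeta> (h i)) (g i) \<in> jv.span (g ` ({..<p} - {i}))" if "i < p" for i
    using jb d hm[OF that] by (auto simp: g_def jordan_basis_def jv.span_zero)
  have k: "kform (2 * p) \<Omega>"
    using \<Omega> by (simp add: p_pluriclosed_structure_def transverse_def real_pp_form_def)
  have kD: "kform (2 * p) (deriv_act D (2 * p) \<Omega>)" by (rule kform_deriv_act[OF k linear_D])
  define s where "s = (\<Sum>i<p. 2 * Re (\<zeta> (h i)))"
  have s: "s = (\<Sum>i\<in>I. 2 * Re (\<zeta> i))"
    unfolding s_def by (rule sum.reindex_bij_betw[OF h])
  have 1: "deriv_act D (2 * p) \<Omega> (frame g) = s * \<Omega> (frame g)"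
    unfolding s_def deriv_act_def by (rule frame_deriv_sum[OF k le_refl refl D_J[OF ghh] Dg])
  have 2: "deriv_act D (2 * p) (deriv_act D (2 * p) \<Omega>) (frame g) = s * deriv_act D (2 * p) \<Omega> (frame g)"
    unfolding s_def deriv_act_def[of D "2 * p" "deriv_act D (2 * p) \<Omega>"]
    by (rule frame_deriv_sum[OF kD le_refl refl D_J[OF ghh] Dg])
  have "frame g i \<in> \<hh>" if "i < 2 * p" for i
    using that ghh[of "i div 2"] J_hh[OF ghh[of "i div 2"]] by (auto simp: frame_def)
  from p_pluriclosed_on_hh[OF \<Omega>, of "frame g", OF this]
  have "s * (s + lam) * \<Omega> (frame g) = 0" unfolding 2 1 by (simp add: algebra_simps)
  moreover have "\<Omega> (frame g) \<noteq> 0"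
  proof (rule transverse_frame_nonzero)
    show "transverse J p \<Omega>" using \<Omega> by (simp add: p_pluriclosed_structure_def)
    show "inj_on g {..<p}" "jv.independent (g ` {..<p})"
      using jordan_basis_subfamily[OF jb, of h p] h I(1) by (auto simp: g_def[abs_def] bij_betw_def)
  qed
  ultimately have "s * (s + lam) = 0" by simp
  then show ?thesis unfolding s[symmetric] by (auto simp: eq_neg_iff_add_eq_0)
qed

end

section \<open>Jordan bases\<close>

lemma proots_prod_linear:
  "finite T \<Longrightarrow> proots (\<Prod>j\<in>T. [:- g j, 1:]) = image_mset g (mset_set T)" for g :: "'b \<Rightarrow> complex"
  by (induction T rule: finite_induct) (simp_all add: proots_mult del: mult_pCons_left mult_pCons_right)

lemma jordan_matrix_entries:
  fixes n_as :: "(nat \<times> 'b::{zero,one}) list"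
  shows "\<exists>\<zeta> \<epsilon>. \<not> \<epsilon> 0 \<and> (\<forall>i<sum_list (map fst n_as). \<forall>j<sum_list (map fst n_as).
      jordan_matrix n_as $$ (i, j) = (if i = j then \<zeta> j else if Suc i = j \<and> \<epsilon> j then 1 else 0)) \<and>
    (\<forall>j<sum_list (map fst n_as). \<epsilon> j \<longrightarrow> \<zeta> (j - 1) = \<zeta> j)"
proof (induction n_as)
  case Nil
  show ?case by (intro exI[of _ "\<lambda>_. 0"] exI[of _ "\<lambda>_. False"]) auto
next
  case (Cons na n_as)
  obtain n a where na: "na = (n, a)" by (cases na)
  let ?m = "sum_list (map fst n_as)"
  from Cons.IH obtain \<zeta> \<epsilon> where \<zeta>: "\<not> \<epsilon> 0"
    "\<And>i j. i < ?m \<Longrightarrow> j < ?m \<Longrightarrow> jordan_matrix n_as $$ (i, j) = (if i = j then \<zeta> j else if Suc i = j \<and> \<epsilon> j then 1 else 0)"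
    "\<And>j. j < ?m \<Longrightarrow> \<epsilon> j \<Longrightarrow> \<zeta> (j - 1) = \<zeta> j"
    by blast
  define \<zeta>' where "\<zeta>' j = (if j < n then a else \<zeta> (j - n))" for j
  define \<epsilon>' where "\<epsilon>' j = (if j < n then j \<noteq> 0 else \<epsilon> (j - n))" for j
  have "\<not> \<epsilon>' 0" using \<zeta>(1) by (simp add: \<epsilon>'_def)
  moreover have "jordan_matrix (na # n_as) $$ (i, j) = (if i = j then \<zeta>' j else if Suc i = j \<and> \<epsilon>' j then 1 else 0)"
    if ij: "i < n + ?m" "j < n + ?m" for i j
  proof -
    have e: "\<not> \<epsilon> (j - n)" if "Suc i = j" "i < n" "\<not> j < n"
    proof -
      have "j = n" using that by simp
      then show ?thesis using \<zeta>(1) by simp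
    qed
    show ?thesis
      unfolding na jordan_matrix_Cons using ij e
      by (auto simp: \<zeta>'_def \<epsilon>'_def \<zeta>(2))
  qed
  moreover have "\<zeta>' (j - 1) = \<zeta>' j" if "j < n + ?m" "\<epsilon>' j" for j
  proof (cases "j < n")
    case False
    then have e: "\<epsilon> (j - n)" using that by (simp add: \<epsilon>'_def)
    then have "j - n \<noteq> 0" using \<zeta>(1) by (metis)
    then show ?thesis using False that \<zeta>(3)[OF _ e]
      by (auto simp: \<zeta>'_def Suc_diff_Suc diff_commute)
  qed (auto simp: \<zeta>'_def)
  ultimately show ?case
    using na by (intro exI[of _ \<zeta>'] exI[of _ \<epsilon>']) auto
qed

context complex_space
begin

lemma family_independentI:
  fixes m :: nat and f :: "nat \<Rightarrow> 'a"
  assumes c: "\<And>c j. (\<Sum>i<m. jscale J (c i) (f i)) = 0 \<Longrightarrow> j < m \<Longrightarrow> c j = 0"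
  shows "inj_on f {..<m}" and "jv.independent (f ` {..<m})"
proof -
  show inj: "inj_on f {..<m}"
  proof (rule inj_onI, rule ccontr)
    fix i j assume ij: "i \<in> {..<m}" "j \<in> {..<m}" "f i = f j" "i \<noteq> j"
    let ?c = "\<lambda>l. if l = i then 1 else if l = j then - 1 else (0::complex)"
    have "(\<Sum>l<m. jscale J (?c l) (f l)) = (\<Sum>l\<in>{i, j}. jscale J (?c l) (f l))"
      using ij by (intro sum.mono_neutral_right) auto
    also have "\<dots> = 0" using ij by (simp add: jv.scale_minus_left)
    finally show False using c[of ?c i] ij by simp
  qed
  show "jv.independent (f ` {..<m})"
  proof (rule jv.independent_if_scalars_zero)
    fix u x assume "(\<Sum>x\<in>f ` {..<m}. jscale J (u x) x) = 0" "x \<in> f ` {..<m}"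
    then show "u x = 0" using c[of "\<lambda>i. u (f i)"] by (auto simp: sum.reindex[OF inj])
  qed simp
qed

lemma family_independentD:
  fixes m :: nat and f :: "nat \<Rightarrow> 'a"
  assumes f: "inj_on f {..<m}" "jv.independent (f ` {..<m})"
    and c: "(\<Sum>i<m. jscale J (c i) (f i)) = 0" and j: "j < m"
  shows "c j = 0"
proof -
  let ?u = "\<lambda>x. c (inv_into {..<m} f x)"
  have "(\<Sum>x\<in>f ` {..<m}. jscale J (?u x) x) = 0"
    using c f(1) by (simp add: sum.reindex)
  from jv.independentD[OF f(2) _ subset_refl this, of "f j"] show ?thesis
    using j f(1) by simp
qed

subsection \<open>The (1,0)-part of the complexification\<close>

text \<open>The map \<open>iota\<close> is a complex-linear isomorphism of \<open>(S, J)\<close> onto the (1,0)-part of the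
  complexification of \<open>S\<close>; \<open>iota_bar\<close> is an antilinear one onto the (0,1)-part.\<close>

definition iota :: "'a \<Rightarrow> 'a \<times> 'a" where "iota w = (w, - J w)"

definition iota_bar :: "'a \<Rightarrow> 'a \<times> 'a" where "iota_bar w = (w, J w)"

lemma iota_simps:
  "iota (a + b) = iota a + iota b" "iota (jscale J c a) = cscale c (iota a)" "iota 0 = 0"
  "iota_bar (a + b) = iota_bar a + iota_bar b" "iota_bar (jscale J c a) = cscale (cnj c) (iota_bar a)"
  "iota_bar 0 = 0"
  by (simp_all add: iota_def iota_bar_def cscale_def jscale_def J_simps zero_prod_def algebra_simps)

lemma iota_sum: "iota (\<Sum>i\<in>I. f i) = (\<Sum>i\<in>I. iota (f i))"
  by (induction I rule: infinite_finite_induct) (auto simp: iota_simps)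

lemma iota_inj: "iota a = iota b \<longleftrightarrow> a = b"
  by (auto simp: iota_def)

lemma cx_part10_iff: "x \<in> cx_part10 J S \<longleftrightarrow> x \<in> S \<times> S \<and> x = iota (fst x)"
proof -
  have "map_prod J J x = cscale \<i> x \<longleftrightarrow> x = iota (fst x)"
    by (cases x) (auto simp: iota_def cscale_def minus_equation_iff J_simps)
  then show ?thesis by (simp add: cx_part10_def)
qed

lemma iota_span: "w \<in> jv.span B \<Longrightarrow> iota w \<in> cx.span (iota ` B)"
  by (induction rule: jv.span_induct_alt)
    (auto simp: iota_simps cx.span_zero intro!: cx.span_add cx.span_scale intro: cx.span_base)

lemma iota_bar_span: "w \<in> jv.span B \<Longrightarrow> iota_bar w \<in> cx.span (iota_bar ` B)"
  by (induction rule: jv.span_induct_alt)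
    (auto simp: iota_simps cx.span_zero intro!: cx.span_add cx.span_scale intro: cx.span_base)

lemma span_iota_image: "x \<in> cx.span (iota ` B) \<Longrightarrow> fst x \<in> jv.span B \<and> x = iota (fst x)"
proof (induction rule: cx.span_induct_alt)
  case base
  then show ?case by (simp add: iota_simps jv.span_zero)
next
  case (step c x y)
  then obtain b where b: "b \<in> B" "x = iota b" by auto
  then have "cscale c x = iota (jscale J c b)" by (simp add: iota_simps)
  moreover have "jscale J c b \<in> jv.span B" using b by (intro jv.span_scale jv.span_base)
  moreover have "iota (jscale J c b) + iota (fst y) = iota (jscale J c b + fst y)"
    by (simp only: iota_simps)
  ultimately show ?case using step(2) jv.span_add[of "jscale J c b" B "fst y"]
    by (metis fst_conv iota_def)
qed

end

context almost_abelian_complex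
begin

lemma iota_D: "w \<in> \<hh> \<Longrightarrow> map_prod D D (iota w) = iota (D w)"
  and iota_bar_D: "w \<in> \<hh> \<Longrightarrow> map_prod D D (iota_bar w) = iota_bar (D w)"
  by (simp_all add: iota_def iota_bar_def linear_neg[OF linear_D] D_J)

lemma D_jscale: "w \<in> \<hh> \<Longrightarrow> D (jscale J c w) = jscale J c (D w)"
  by (simp add: jscale_def linear_add[OF linear_D] linear_scale[OF linear_D] D_J)

lemma jscale_hh: "w \<in> \<hh> \<Longrightarrow> jscale J c w \<in> \<hh>"
  by (intro jscale_mem subspace_hh) (auto intro: J_hh)

lemma D_sum_jscale:
  assumes "\<And>i. i \<in> I \<Longrightarrow> w i \<in> \<hh>"
  shows "D (\<Sum>i\<in>I. jscale J (c i) (w i)) = (\<Sum>i\<in>I. jscale J (c i) (D (w i)))"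
  using assms by (simp add: linear_sum[OF linear_D] D_jscale)

text \<open>The matrix of \<open>D\<close> on the (1,0)-part is also its matrix on \<open>\<hh>\<close> as a complex space, and the
  columns of a matrix that transforms it into Jordan form are the coordinates of a Jordan basis.\<close>

lemma jordan_basis_exists:
  assumes ev: "eigenvalues_with_mult (cx_part10 J \<hh>) (map_prod A A) S z" and S: "finite S"
    and A: "\<And>w. w \<in> \<hh> \<Longrightarrow> A w = D w"
  obtains m f \<zeta> \<epsilon> where "jordan_basis m f \<zeta> \<epsilon>" "image_mset \<zeta> (mset_set {..<m}) = image_mset z (mset_set S)"
proof -
  from ev obtain m e M where e: "inj_on e {..<m}" "cx.independent (e ` {..<m})"
      "cx.span (e ` {..<m}) = cx_part10 J \<hh>"
    and M: "M \<in> carrier_mat m m"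
    and Fe: "\<And>j. j < m \<Longrightarrow> map_prod A A (e j) = (\<Sum>i<m. cscale (M $$ (i, j)) (e i))"
    and cp: "char_poly M = (\<Prod>j\<in>S. [:- z j, 1:])"
    unfolding eigenvalues_with_mult_def by blast
  define w where "w j = fst (e j)" for j
  have ew: "e j = iota (w j)" and whh: "w j \<in> \<hh>" if "j < m" for j
  proof -
    have "e j \<in> cx_part10 J \<hh>" using that unfolding e(3)[symmetric] by (intro cx.span_base) auto
    then show "e j = iota (w j)" "w j \<in> \<hh>" by (auto simp: cx_part10_iff w_def mem_Times_iff)
  qed
  have eimg: "e ` {..<m} = iota ` w ` {..<m}" using ew by (auto simp: image_iff)
  have Dw: "D (w j) = (\<Sum>i<m. jscale J (M $$ (i, j)) (w i))" if j: "j < m" for j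
  proof -
    have "iota (D (w j)) = map_prod A A (e j)"
      using A[OF whh[OF j]] A[OF subspace_neg[OF subspace_hh J_hh[OF whh[OF j]]]] D_J[OF whh[OF j]]
      by (simp add: ew[OF j] iota_def linear_neg[OF linear_D])
    also have "\<dots> = iota (\<Sum>i<m. jscale J (M $$ (i, j)) (w i))"
      unfolding Fe[OF j] iota_sum by (intro sum.cong) (auto simp: iota_simps ew)
    finally show ?thesis by (simp add: iota_inj)
  qed
  have wind: "c j = 0" if c: "(\<Sum>i<m. jscale J (c i) (w i)) = 0" and j: "j < m" for c j
  proof -
    let ?u = "\<lambda>x. c (inv_into {..<m} e x)"
    have "(\<Sum>x\<in>e ` {..<m}. cscale (?u x) x) = (\<Sum>i<m. cscale (c i) (e i))"
      using e(1) by (simp add: sum.reindex)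
    also have "\<dots> = iota (\<Sum>i<m. jscale J (c i) (w i))"
      unfolding iota_sum by (intro sum.cong) (auto simp: iota_simps ew)
    finally have "(\<Sum>x\<in>e ` {..<m}. cscale (?u x) x) = 0" by (simp add: c iota_simps)
    from cx.independentD[OF e(2) _ subset_refl this, of "e j"] show ?thesis
      using j e(1) by simp
  qed
  have wspan: "\<hh> \<subseteq> jv.span (w ` {..<m})"
  proof
    fix x assume "x \<in> \<hh>"
    then have "iota x \<in> cx_part10 J \<hh>"
      using J_hh[of x] subspace_neg[OF subspace_hh] by (auto simp: cx_part10_iff iota_def)
    then have "iota x \<in> cx.span (iota ` w ` {..<m})" using e(3) eimg by simp
    from span_iota_image[OF this] show "x \<in> jv.span (w ` {..<m})" by (simp add: iota_def)
  qed
  obtain as where "char_poly M = (\<Prod>a\<leftarrow>as. [:- a, 1:])"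
  proof -
    obtain xs where xs: "distinct xs" "set xs = S" using S finite_distinct_list by blast
    have "char_poly M = (\<Prod>a\<leftarrow>map z xs. [:- a, 1:])"
      unfolding cp xs(2)[symmetric] by (simp add: prod.distinct_set_conv_list[OF xs(1)] o_def)
    then show thesis by (rule that)
  qed
  from jordan_nf_exists[OF M this] obtain n_as where "jordan_nf M n_as" by blast
  then have sim: "similar_mat M (jordan_matrix n_as)" by (simp add: jordan_nf_def)
  let ?Jm = "jordan_matrix n_as"
  from similar_matD[OF sim] obtain n P Q where PQ: "{M, ?Jm, P, Q} \<subseteq> carrier_mat n n"
    "P * Q = 1\<^sub>m n" "Q * P = 1\<^sub>m n" "M = P * ?Jm * Q" by blast
  have n: "n = m" using PQ(1) M by auto
  have P: "P \<in> carrier_mat m m" and Q: "Q \<in> carrier_mat m m" and Jm: "?Jm \<in> carrier_mat m m"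
    using PQ(1) n by auto
  have msum: "sum_list (map fst n_as) = m" using Jm by auto
  obtain \<zeta> \<epsilon> where \<zeta>: "\<not> \<epsilon> 0"
    "\<And>i j. i < m \<Longrightarrow> j < m \<Longrightarrow> ?Jm $$ (i, j) = (if i = j then \<zeta> j else if Suc i = j \<and> \<epsilon> j then 1 else 0)"
    "\<And>j. j < m \<Longrightarrow> \<epsilon> j \<Longrightarrow> \<zeta> (j - 1) = \<zeta> j"
    using jordan_matrix_entries[of n_as] unfolding msum by blast
  have MP: "M * P = P * ?Jm"
  proof -
    have "M * P = P * ?Jm * (Q * P)"
      unfolding PQ(4) by (rule assoc_mult_mat[OF mult_carrier_mat[OF P Jm] Q P])
    also have "\<dots> = P * ?Jm" unfolding PQ(3) n by (rule right_mult_one_mat[OF mult_carrier_mat[OF P Jm]])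
    finally show ?thesis .
  qed
  have mm: "(X * Y) $$ (i, j) = (\<Sum>l<m. X $$ (i, l) * Y $$ (l, j))"
    if "X \<in> carrier_mat m m" "Y \<in> carrier_mat m m" "i < m" "j < m" for X Y :: "complex mat" and i j
    using that by (simp add: scalar_prod_def lessThan_atLeast0)
  \<comment> \<open>The columns of \<open>P\<close> are the coordinates of the Jordan basis, since \<open>M P = P Jm\<close>.\<close>
  define f where "f j = (\<Sum>i<m. jscale J (P $$ (i, j)) (w i))" for j
  have comb: "(\<Sum>j<m. jscale J (c j) (\<Sum>i<m. jscale J (X i j) (b i))) = (\<Sum>i<m. jscale J (\<Sum>j<m. X i j * c j) (b i))"
    for c X and b :: "nat \<Rightarrow> 'a"
  proof -
    have "(\<Sum>j<m. jscale J (c j) (\<Sum>i<m. jscale J (X i j) (b i))) =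
        (\<Sum>j<m. \<Sum>i<m. jscale J (X i j * c j) (b i))"
      by (simp add: jv.scale_sum_right mult.commute)
    also have "\<dots> = (\<Sum>i<m. \<Sum>j<m. jscale J (X i j * c j) (b i))" by (rule sum.swap)
    finally show ?thesis by (simp add: jv.scale_sum_left)
  qed
  have fhh: "f j \<in> \<hh>" for j
    unfolding f_def by (intro subspace_sum[OF subspace_hh] jscale_hh whh) auto
  have Df: "D (f j) = (\<Sum>i<m. jscale J (?Jm $$ (i, j)) (f i))" if j: "j < m" for j
  proof -
    have "D (f j) = (\<Sum>l<m. jscale J (P $$ (l, j)) (\<Sum>i<m. jscale J (M $$ (i, l)) (w i)))"
      unfolding f_def using whh Dw by (subst D_sum_jscale) auto
    also have "\<dots> = (\<Sum>i<m. jscale J ((M * P) $$ (i, j)) (w i))"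
      unfolding comb using j by (intro sum.cong) (simp_all add: mm[OF M P] del: index_mult_mat)
    also have "\<dots> = (\<Sum>l<m. jscale J (?Jm $$ (l, j)) (\<Sum>i<m. jscale J (P $$ (i, l)) (w i)))"
      unfolding comb MP using j by (intro sum.cong) (simp_all add: mm[OF P Jm] del: index_mult_mat)
    finally show ?thesis by (simp add: f_def)
  qed
  have find: "c j = 0" if c: "(\<Sum>i<m. jscale J (c i) (f i)) = 0" and j: "j < m" for c j
  proof -
    define d where "d i = (\<Sum>l<m. P $$ (i, l) * c l)" for i
    have d: "d i = 0" if "i < m" for i
      using c wind[of d i] that unfolding f_def comb d_def by simp
    have "c j = (\<Sum>l<m. (1\<^sub>m m) $$ (j, l) * c l)"
      using j by (simp add: if_distrib[of "\<lambda>x. x * _"] cong: if_cong)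
    also have "\<dots> = (\<Sum>l<m. \<Sum>i<m. Q $$ (j, i) * P $$ (i, l) * c l)"
      using j PQ(3) n by (intro sum.cong refl) (simp add: mm[OF Q P, symmetric] sum_distrib_right[symmetric] del: index_mult_mat)
    also have "\<dots> = (\<Sum>i<m. Q $$ (j, i) * d i)"
      unfolding d_def by (subst sum.swap) (simp add: sum_distrib_left mult.assoc)
    also have "\<dots> = 0" using d by simp
    finally show ?thesis .
  qed
  have fspan: "jv.span (f ` {..<m}) = \<hh>"
  proof
    show "jv.span (f ` {..<m}) \<subseteq> \<hh>"
      by (rule jv.span_minimal) (auto intro!: jv_subspaceI subspace_hh fhh J_hh)
    have "w i \<in> jv.span (f ` {..<m})" if i: "i < m" for i
    proof -
      have "w i = (\<Sum>l<m. jscale J ((1\<^sub>m m) $$ (l, i)) (w l))"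
        using i by (simp add: if_distrib[of "\<lambda>x. jscale J x _"] cong: if_cong)
      also have "\<dots> = (\<Sum>j<m. jscale J (Q $$ (j, i)) (f j))"
        unfolding f_def comb PQ(2)[unfolded n, symmetric] using i
        by (intro sum.cong) (simp_all add: mm[OF P Q] del: index_mult_mat)
      also have "\<dots> \<in> jv.span (f ` {..<m})"
        by (intro jv.span_sum jv.span_scale jv.span_base) auto
      finally show ?thesis .
    qed
    then have "jv.span (w ` {..<m}) \<subseteq> jv.span (f ` {..<m})"
      by (intro jv.span_minimal jv.subspace_span) auto
    then show "\<hh> \<subseteq> jv.span (f ` {..<m})" using wspan by blast
  qed
  have Dfj: "D (f j) = jscale J (\<zeta> j) (f j) + (if \<epsilon> j then f (j - 1) else 0)" if j: "j < m" for j
  proof -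
    have "D (f j) = (\<Sum>i<m. (if i = j then jscale J (\<zeta> j) (f j) else 0) + (if i = j - 1 \<and> \<epsilon> j then f (j - 1) else 0))"
      unfolding Df[OF j] using j \<zeta>(1)
      by (intro sum.cong refl) (cases j; auto simp: \<zeta>(2))
    moreover have "j - 1 < m" using j by simp
    ultimately show ?thesis using j by (simp add: sum.distrib)
  qed
  have "inj_on f {..<m}" "jv.independent (f ` {..<m})"
    by (rule family_independentI, rule find, assumption+)+
  then have "jordan_basis m f \<zeta> \<epsilon>"
    unfolding jordan_basis_def using fspan \<zeta>(1,3) Dfj by (intro conjI allI impI)
  moreover have "image_mset \<zeta> (mset_set {..<m}) = image_mset z (mset_set S)"
  proof -
    have "char_poly M = char_poly ?Jm" by (rule char_poly_similar[OF sim])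
    also have "\<dots> = (\<Prod>a\<leftarrow>diag_mat ?Jm. [:- a, 1:])"
      by (rule char_poly_upper_triangular[OF Jm]) (auto intro: upper_triangularI simp: \<zeta>(2) msum)
    also have "diag_mat ?Jm = map \<zeta> [0..<m]"
      using Jm by (auto simp: diag_mat_def \<zeta>(2) msum)
    also have "(\<Prod>a\<leftarrow>map \<zeta> [0..<m]. [:- a, 1:]) = (\<Prod>j<m. [:- \<zeta> j, 1:])"
      by (simp add: o_def lessThan_atLeast0 prod.distinct_set_conv_list[symmetric])
    finally show ?thesis
      using proots_prod_linear[of "{..<m}" \<zeta>] proots_prod_linear[OF S, of z] cp by simp
  qed
  ultimately show thesis by (rule that)
qed

text \<open>A first Jordan pair \<open>f\<^sub>k\<^sub>-\<^sub>1, f\<^sub>k\<close> satisfies \<open>(D - \<zeta>)\<^sup>2 f\<^sub>k = 0 \<noteq> (D - \<zeta>) f\<^sub>k\<close>, which no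
  combination of eigenvectors does.\<close>

lemma diagonalizable_imp_jordan_diagonal:
  assumes dg: "diagonalizable_over_C \<hh> D" and jb: "jordan_basis m f \<zeta> \<epsilon>"
  shows "\<forall>j<m. \<not> \<epsilon> j"
proof (rule ccontr)
  assume "\<not> (\<forall>j<m. \<not> \<epsilon> j)"
  then have ex: "\<exists>k. k < m \<and> \<epsilon> k" by blast
  define k where "k = (LEAST k. k < m \<and> \<epsilon> k)"
  have k: "k < m" "\<epsilon> k" using LeastI_ex[OF ex] by (auto simp: k_def)
  have "k \<noteq> 0" using k jb by (metis jordan_basis_def)
  then have km: "k - 1 < k" by simp
  then have "\<not> \<epsilon> (k - 1)" using not_less_Least[of "k - 1" "\<lambda>k. k < m \<and> \<epsilon> k"] k by (auto simp: k_def)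
  then have Dk1: "D (f (k - 1)) = jscale J (\<zeta> k) (f (k - 1))" and Dk: "D (f k) = jscale J (\<zeta> k) (f k) + f (k - 1)"
    using jb k km by (auto simp: jordan_basis_def)
  have fh: "f k \<in> \<hh>" "f (k - 1) \<in> \<hh>" using jordan_basis_mem[OF jb] k km by auto
  obtain B where B: "cx.independent B" "cx.span B = \<hh> \<times> \<hh>" "\<forall>b\<in>B. \<exists>c. map_prod D D b = cscale c b"
    using dg unfolding diagonalizable_over_C_def by blast
  then obtain c where c: "\<And>b. b \<in> B \<Longrightarrow> map_prod D D b = cscale (c b) b" by metis
  define N where "N x = map_prod D D x - cscale (\<zeta> k) x" for x
  have Nlin: "N (a + b) = N a + N b" "N (cscale s a) = cscale s (N a)" "N 0 = 0" for a b s
    by (cases a; cases b; simp add: N_def cscale_def linear_add[OF linear_D] linear_scale[OF linear_D]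
      linear_diff[OF linear_D] linear_0[OF linear_D] algebra_simps zero_prod_def)+
  have N1: "N (iota (f k)) = iota (f (k - 1))"
    unfolding N_def iota_D[OF fh(1)] Dk iota_simps by simp
  have N2: "N (iota (f (k - 1))) = 0"
    unfolding N_def iota_D[OF fh(2)] Dk1 iota_simps by simp
  have "iota (f k) \<in> cx.span B"
    unfolding B(2) using fh J_hh subspace_neg[OF subspace_hh] by (auto simp: iota_def)
  then obtain T r where T: "finite T" "T \<subseteq> B" "iota (f k) = (\<Sum>b\<in>T. cscale (r b) b)"
    unfolding cx.span_explicit by auto
  have NT: "N (\<Sum>b\<in>T. cscale (s b) b) = (\<Sum>b\<in>T. cscale (s b * (c b - \<zeta> k)) b)" for s
  proof -
    have "N (\<Sum>b\<in>T. cscale (s b) b) = (\<Sum>b\<in>T. N (cscale (s b) b))"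
      by (induction T rule: infinite_finite_induct) (auto simp: Nlin(1,3))
    also have "\<dots> = (\<Sum>b\<in>T. cscale (s b * (c b - \<zeta> k)) b)"
    proof (intro sum.cong refl)
      fix b assume "b \<in> T"
      then have "b \<in> B" using T(2) by blast
      then have "N b = cscale (c b - \<zeta> k) b"
        unfolding N_def by (simp only: c cx.scale_left_diff_distrib)
      then show "N (cscale (s b) b) = cscale (s b * (c b - \<zeta> k)) b" by (simp add: Nlin(2))
    qed
    finally show ?thesis .
  qed
  have e1: "iota (f (k - 1)) = (\<Sum>b\<in>T. cscale (r b * (c b - \<zeta> k)) b)"
    using N1 unfolding T(3) NT ..
  have e2: "(\<Sum>b\<in>T. cscale (r b * (c b - \<zeta> k) * (c b - \<zeta> k)) b) = 0"
    using N2 unfolding e1 NT .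
  have "r b * (c b - \<zeta> k) = 0" if b: "b \<in> T" for b
    using cx.independentD[OF B(1) T(1,2) e2 b] by auto
  then have "iota (f (k - 1)) = 0" unfolding e1 by (intro sum.neutral ballI) (simp only: cx.scale_zero_left)
  then have "f (k - 1) = 0" by (simp add: iota_def zero_prod_def)
  moreover have "f (k - 1) \<in> f ` {..<m}" using k km by auto
  ultimately show False
    using jb jv.dependent_zero[of "f ` {..<m}"] by (metis jordan_basis_def)
qed

text \<open>Conversely a complex eigenbasis of \<open>\<hh>\<close> spans the (1,0)-part, and its conjugate the
  (0,1)-part, of the complexification.\<close>

lemma jordan_diagonal_imp_diagonalizable:
  assumes jb: "jordan_basis m f \<zeta> \<epsilon>" and d: "\<forall>j<m. \<not> \<epsilon> j"
  shows "diagonalizable_over_C \<hh> D"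
proof -
  let ?f = "f ` {..<m}"
  let ?B = "iota ` ?f \<union> iota_bar ` ?f"
  have fspan: "jv.span ?f = \<hh>" using jb by (simp add: jordan_basis_def)
  have eig: "\<exists>c. map_prod D D b = cscale c b" if "b \<in> ?B" for b
  proof -
    from that obtain j where j: "j < m" "b = iota (f j) \<or> b = iota_bar (f j)" by auto
    have Dj: "D (f j) = jscale J (\<zeta> j) (f j)" using jb d j by (simp add: jordan_basis_def)
    show ?thesis
      using j(2) iota_D[OF jordan_basis_mem[OF jb j(1)]] iota_bar_D[OF jordan_basis_mem[OF jb j(1)]]
      by (auto simp: Dj iota_simps)
  qed
  have sp: "cx.span ?B = \<hh> \<times> \<hh>"
  proof
    have neg: "- a \<in> \<hh>" if "a \<in> \<hh>" for a using that by (rule subspace_neg[OF subspace_hh])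
    have "cx.subspace (\<hh> \<times> \<hh>)"
      unfolding cx.subspace_def using subspace_hh
      by (auto simp: cscale_def zero_prod_def subspace_0 subspace_add subspace_diff subspace_scale)
    then show "cx.span ?B \<subseteq> \<hh> \<times> \<hh>"
      using jordan_basis_mem[OF jb] J_hh neg by (intro cx.span_minimal) (auto simp: iota_def iota_bar_def)
    show "\<hh> \<times> \<hh> \<subseteq> cx.span ?B"
    proof clarify
      fix a b assume ab: "a \<in> \<hh>" "b \<in> \<hh>"
      let ?p = "(1/2) *\<^sub>R (a + J b)" and ?q = "(1/2) *\<^sub>R (a - J b)"
      have "?p \<in> \<hh>" "?q \<in> \<hh>"
        using ab J_hh subspace_hh by (auto intro!: subspace_scale subspace_add subspace_diff)
      then have "iota ?p \<in> cx.span ?B" "iota_bar ?q \<in> cx.span ?B"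
        using iota_span[of ?p ?f] iota_bar_span[of ?q ?f] fspan
          cx.span_mono[of "iota ` ?f" ?B] cx.span_mono[of "iota_bar ` ?f" ?B] by auto
      then have "iota ?p + iota_bar ?q \<in> cx.span ?B" by (rule cx.span_add)
      moreover have "iota ?p + iota_bar ?q = (a, b)"
        by (simp add: iota_def iota_bar_def J_simps algebra_simps flip: scaleR_add_left)
      ultimately show "(a, b) \<in> cx.span ?B" by simp
    qed
  qed
  obtain B where B: "B \<subseteq> ?B" "cx.independent B" "?B \<subseteq> cx.span B"
    using cx.maximal_independent_subset by blast
  have "cx.span B = cx.span ?B"
    using B cx.span_mono[OF B(1)] cx.span_minimal[OF B(3) cx.subspace_span] by blast
  then have "cx.span B = \<hh> \<times> \<hh>" using sp by simp
  moreover have "\<forall>b\<in>B. \<exists>c. map_prod D D b = cscale c b"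
    using eig B(1) by (meson subsetD)
  ultimately show ?thesis
    unfolding diagonalizable_over_C_def using B(2) by (intro exI[of _ B] conjI)
qed

end

section \<open>Sums of positive volume forms\<close>

lemma forms10_linear: "\<gamma> \<in> forms10 J UNIV \<Longrightarrow> linear \<gamma>"
  unfolding forms10_def by (intro linearI) (auto simp: scaleR_conv_of_real)

lemma linear_cnj: "linear \<phi> \<Longrightarrow> linear (\<lambda>x. cnj (\<phi> x))"
  using linear_compose[of \<phi> cnj] bounded_linear.linear[OF bounded_linear_cnj] by (simp add: o_def)

lemma kform_positive_volume:
  assumes "\<And>i. i < p \<Longrightarrow> \<gamma> i \<in> forms10 J UNIV"
  shows "kform (2 * p) (positive_volume p \<gamma>)"
proof -
  have "linear (\<gamma> i)" if "i < p" for i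
    using forms10_linear[OF assms[OF that]] .
  then have "kform (2 * p) (wedge1 (2 * p) (split_forms p \<gamma>))"
    by (intro kform_wedge1) (auto simp: split_forms_def intro!: linear_cnj)
  then have "kform (2 * p) (\<lambda>v. \<i> ^ p * of_int (sign (unshuffle p)) * wedge1 (2 * p) (split_forms p \<gamma>) v)"
    by (rule kform_compose_linear) (rule bounded_linear.linear[OF bounded_linear_mult_right])
  then show ?thesis by (simp add: positive_volume_split[abs_def])
qed

text \<open>The real part only changes the type, as the positive volume forms are real. For \<open>\<Gamma>\<close> ranging over
  all ways of choosing \<open>p\<close> forms, with repetition, from a basis \<open>\<gamma> j\<close>, this is the \<open>p\<close>-th power of the
  2-form \<open>\<Sum>j. \<i> \<gamma> j \<and> cnj (\<gamma> j)\<close>: choices with repetitions contribute zero.\<close>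

definition volume_sum :: "nat \<Rightarrow> 't set \<Rightarrow> ('t \<Rightarrow> nat \<Rightarrow> 'a \<Rightarrow> complex) \<Rightarrow> (nat \<Rightarrow> 'a) \<Rightarrow> real" where
  "volume_sum p T \<Gamma> v = Re (\<Sum>t\<in>T. positive_volume p (\<Gamma> t) v)"

lemma of_real_volume_sum: "of_real (volume_sum p T \<Gamma> v) = (\<Sum>t\<in>T. positive_volume p (\<Gamma> t) v)"
proof -
  have "cnj (\<Sum>t\<in>T. positive_volume p (\<Gamma> t) v) = (\<Sum>t\<in>T. positive_volume p (\<Gamma> t) v)"
    by (simp add: positive_volume_real)
  then show ?thesis unfolding volume_sum_def by (metis Reals_cnj_iff of_real_Re)
qed

lemma volume_sum_real_pp_form:
  assumes T: "finite T" and \<Gamma>: "\<And>t i. t \<in> T \<Longrightarrow> i < p \<Longrightarrow> \<Gamma> t i \<in> forms10 J UNIV"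
  shows "real_pp_form J p (volume_sum p T \<Gamma>)"
  unfolding real_pp_form_def
proof
  have "kform (2 * p) (\<lambda>v. \<Sum>t\<in>T. positive_volume p (\<Gamma> t) v)"
    by (intro kform_sum kform_positive_volume[where J = J] \<Gamma>)
  then show "kform (2 * p) (volume_sum p T \<Gamma>)"
    unfolding volume_sum_def[abs_def]
    by (rule kform_compose_linear) (rule bounded_linear.linear[OF bounded_linear_Re])
  obtain e where e: "bij_betw e {..<card T} T"
    using ex_bij_betw_nat_finite[OF T] by (auto simp: lessThan_atLeast0)
  have eT: "e s \<in> T" if "s < card T" for s using e that by (auto simp: bij_betw_def)
  have "of_real (volume_sum p T \<Gamma> v) = (\<Sum>s<card T. (\<i> ^ p * of_int (sign (unshuffle p))) *
      wedge1 (p + p) (\<lambda>i. if i < p then \<Gamma> (e s) i else (\<lambda>x. cnj (\<Gamma> (e s) (i - p) x))) v)" for v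
    unfolding of_real_volume_sum sum.reindex_bij_betw[OF e, symmetric] positive_volume_split
    by (simp add: mult_2 split_forms_def[abs_def])
  then show "pq_form J p p (\<lambda>v. of_real (volume_sum p T \<Gamma> v))"
    unfolding pq_form_def
    by (intro exI[of _ "card T"] exI[of _ "\<lambda>s. \<i> ^ p * of_int (sign (unshuffle p))"]
        exI[of _ "\<lambda>s i. \<Gamma> (e s) i"] conjI) (auto intro!: \<Gamma> eT)
qed

context complex_space
begin

text \<open>Exchange: \<open>p\<close> independent vectors can replace \<open>p\<close> members of a basis, and the minor of
  their coordinates that belongs to the replaced members does not vanish.\<close>

lemma exists_nonzero_minor:
  assumes b: "inj_on b {..<M}" "jv.independent (b ` {..<M})" "jv.span (b ` {..<M}) = UNIV"
    and w: "inj_on w {..<p}" "jv.independent (w ` {..<p})"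
  obtains h where "h \<in> {..<p} \<rightarrow>\<^sub>E {..<M}"
    "Determinant.det (Matrix.mat p p (\<lambda>(i, l). coord b {..<M} (h i) (w l))) \<noteq> 0"
proof -
  let ?W = "w ` {..<p}" and ?b = "b ` {..<M}"
  obtain B where B: "?W \<subseteq> B" "B \<subseteq> ?W \<union> ?b" "jv.independent B" "?W \<union> ?b \<subseteq> jv.span B"
    using jv.maximal_independent_subset_extend[of ?W "?W \<union> ?b"] w(2) by blast
  have Bspan: "jv.span B = UNIV"
    using jv.span_minimal[of ?b "jv.span B"] B(4) b(3) by auto
  have cB: "card B = M"
    using dim_jv_span[OF B(3)] dim_jv_span[OF b(2)] b(1,3) Bspan by (simp add: card_image)
  define S where "S = B - ?W"
  have Sb: "S \<subseteq> ?b" using B(2) by (auto simp: S_def)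
  have finB: "finite B" by (rule finite_jv_independent[OF B(3)])
  have cS: "card S + p = M"
    using card_Diff_subset[of ?W B] B(1) finB w(1) cB card_mono[OF finB B(1)]
    by (simp add: S_def card_image)
  \<comment> \<open>The indices of the members of \<open>b\<close> that \<open>w\<close> replaces.\<close>
  define I where "I = {i. i < M \<and> b i \<notin> S}"
  have "b ` ({..<M} - I) = S" using Sb by (auto simp: I_def)
  moreover have "card (b ` ({..<M} - I)) = card ({..<M} - I)"
    by (intro card_image inj_on_subset[OF b(1)]) auto
  moreover have IM: "I \<subseteq> {..<M}" by (auto simp: I_def)
  moreover have "card ({..<M} - I) = M - card I"
    using IM by (subst card_Diff_subset) (auto intro: finite_subset)
  moreover have "card I \<le> M" using card_mono[OF _ IM] by simp
  ultimately have "card I = p" using cS by simp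
  moreover have "finite I" by (simp add: I_def)
  ultimately obtain h0 where h0: "bij_betw h0 {..<p} I"
    using ex_bij_betw_nat_finite by (metis lessThan_atLeast0)
  define h where "h = restrict h0 {..<p}"
  have h: "h ` {..<p} = I" using h0 by (auto simp: h_def bij_betw_def)
  let ?A = "Matrix.mat p p (\<lambda>(i, l). coord b {..<M} (h i) (w l))"
  have "Determinant.det ?A \<noteq> 0"
  proof
    assume "Determinant.det ?A = 0"
    then obtain c where c: "c \<in> carrier_vec p" "c \<noteq> 0\<^sub>v p" "?A *\<^sub>v c = 0\<^sub>v p"
      using det_0_iff_vec_prod_zero_field[of ?A p] by auto
    define u where "u = (\<Sum>l<p. jscale J (c $ l) (w l))"
    have co: "coord b {..<M} i u = (\<Sum>l<p. c $ l * coord b {..<M} i (w l))" for i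
      unfolding u_def
    proof (induction p)
      case 0
      show ?case using coord_jscale[OF b(1,2), of 0 i 0] b(3) by simp
    next
      case (Suc p)
      then show ?case
        using coord_add[OF b(1,2)] coord_jscale[OF b(1,2)] b(3) by simp
    qed
    have "coord b {..<M} i u = 0" if "i \<in> I" for i
    proof -
      from that h obtain i' where i': "i' < p" "i = h i'" by auto
      have "(?A *\<^sub>v c) $ i' = 0" using c(3) i' by simp
      then have "(\<Sum>l<p. c $ l * coord b {..<M} (h i') (w l)) = 0"
        using i' c(1) by (simp add: scalar_prod_def atLeast0LessThan mult.commute)
      then show ?thesis using i'(2) co by simp
    qed
    then have "u = (\<Sum>i\<in>{..<M} - I. jscale J (coord b {..<M} i u) (b i))"
      using coord_expansion[OF b(1,2), of u] b(3) IM
      by (subst sum.mono_neutral_left[of "{..<M}" "{..<M} - I"]) auto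
    also have "\<dots> \<in> jv.span S"
    proof (intro jv.span_sum jv.span_scale jv.span_base)
      show "b i \<in> S" if "i \<in> {..<M} - I" for i using that by (auto simp: I_def)
    qed
    finally have uS: "u \<in> jv.span S" .
    have uW: "u \<in> jv.span ?W"
      unfolding u_def by (intro jv.span_sum jv.span_scale jv.span_base) auto
    have "jv.representation B u x = 0" for x
    proof -
      have 1: "jv.representation B u x = jv.representation S u x"
        using jv.representation_extend[OF B(3) uS] by (auto simp: S_def)
      have 2: "jv.representation B u x = jv.representation ?W u x"
        using jv.representation_extend[OF B(3) uW B(1)] by simp
      show ?thesis
        using 1 2 jv.representation_ne_zero[of S u x] jv.representation_ne_zero[of ?W u x]
        by (auto simp: S_def)
    qed
    then have "u = 0"
      using jv.sum_representation_eq[OF B(3) _ finB subset_refl, of u] Bspan by simp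
    then have "c $ l = 0" if "l < p" for l
      unfolding u_def by (rule family_independentD[OF w _ that])
    then have "c = 0\<^sub>v p" using c(1) by (intro eq_vecI) auto
    then show False using c(2) by contradiction
  qed
  moreover have "h \<in> {..<p} \<rightarrow>\<^sub>E {..<M}"
    using h0 IM by (auto simp: h_def bij_betw_def)
  ultimately show thesis by (rule that[rotated])
qed

text \<open>On a \<open>p\<close>-dimensional complex subspace every summand is the squared modulus of a minor times
  the volume form of the subspace.\<close>

lemma volume_sum_transverse:
  assumes b: "inj_on b {..<M}" "jv.independent (b ` {..<M})" "jv.span (b ` {..<M}) = UNIV"
  shows "transverse J p (volume_sum p ({..<p} \<rightarrow>\<^sub>E {..<M}) (\<lambda>h i. coord b {..<M} (h i)))"
    (is "transverse J p ?\<Omega>")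
proof -
  let ?T = "{..<p} \<rightarrow>\<^sub>E {..<M}"
  have finT: "finite ?T" by (intro finite_PiE) auto
  have \<gamma>: "coord b {..<M} i \<in> forms10 J UNIV" for i
    unfolding forms10_def using coord_add[OF b(1,2)] coord_scaleR[OF b(1,2)] coord_J[OF b(1,2)] b(3) by simp
  have "\<exists>\<gamma> r. basis10 J W p \<gamma> \<and> r > 0 \<and>
      (\<forall>v. (\<forall>i<2 * p. v i \<in> W) \<longrightarrow> of_real (?\<Omega> v) = of_real r * positive_volume p \<gamma> v)"
    if W: "subspace W" "J ` W \<subseteq> W" "dim W = 2 * p" for W
  proof -
    obtain w where w: "inj_on w {..<p}" "jv.independent (w ` {..<p})" "jv.span (w ` {..<p}) = W"
      using invariant_subspace_basis[OF W] .
    let ?C = "\<lambda>h. Matrix.mat p p (\<lambda>(i, l). coord b {..<M} (h i) (w l))"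
    define r where "r = (\<Sum>h\<in>?T. (cmod (Determinant.det (?C h)))\<^sup>2)"
    have co: "coord b {..<M} i x = (\<Sum>l<p. coord b {..<M} i (w l) * coord w {..<p} l x)" if x: "x \<in> W" for i x
    proof -
      have s: "coord b {..<M} i (\<Sum>l\<in>L. jscale J (c l) (w l)) = (\<Sum>l\<in>L. coord b {..<M} i (w l) * c l)"
        if "finite L" for L and c :: "nat \<Rightarrow> complex"
        using that
      proof (induction L rule: finite_induct)
        case empty
        show ?case using coord_jscale[OF b(1,2), of 0 i 0] b(3) by simp
      next
        case (insert l L)
        then show ?case
          using coord_add[OF b(1,2)] coord_jscale[OF b(1,2)] b(3) by (simp add: mult.commute)
      qed
      have "(\<Sum>l<p. jscale J (coord w {..<p} l x) (w l)) = x"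
        using coord_expansion[OF w(1,2), of x] x w(3) by simp
      then show ?thesis using s[of "{..<p}" "\<lambda>l. coord w {..<p} l x"] by simp
    qed
    have "r > 0"
    proof -
      obtain h where h: "h \<in> ?T" "Determinant.det (?C h) \<noteq> 0"
        using exists_nonzero_minor[OF b w(1,2)] .
      have "0 < (cmod (Determinant.det (?C h)))\<^sup>2" using h(2) by simp
      also have "\<dots> \<le> r"
        unfolding r_def using h(1) finT by (intro member_le_sum) auto
      finally show ?thesis .
    qed
    moreover have "of_real (?\<Omega> v) = of_real r * positive_volume p (coord w {..<p}) v"
      if v: "\<forall>i<2 * p. v i \<in> W" for v
    proof -
      have "positive_volume p (\<lambda>i. coord b {..<M} (h i)) v =
          of_real ((cmod (Determinant.det (?C h)))\<^sup>2) * positive_volume p (coord w {..<p}) v" for h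
        by (rule positive_volume_linear_combination) (use v co in blast)
      then show ?thesis
        unfolding of_real_volume_sum r_def by (simp add: sum_distrib_right)
    qed
    moreover have "basis10 J W p (coord w {..<p})"
      using coord_basis10[OF w(1,2)] w(3) by simp
    ultimately show ?thesis by blast
  qed
  moreover have "real_pp_form J p ?\<Omega>"
    by (rule volume_sum_real_pp_form[OF finT \<gamma>])
  ultimately show ?thesis
    unfolding transverse_def by simp
qed

end

context almost_abelian_complex
begin

lemma deriv_act_positive_volume:
  assumes w: "\<And>j. j < 2 * p \<Longrightarrow> w j \<in> \<hh>"
    and eig: "\<And>i x. i < p \<Longrightarrow> x \<in> \<hh> \<Longrightarrow> \<gamma> i (D x) = \<mu> i * \<gamma> i x"
  shows "deriv_act D (2 * p) (positive_volume p \<gamma>) w = of_real (\<Sum>i<p. 2 * Re (\<mu> i)) * positive_volume p \<gamma> w"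
proof -
  define \<nu> where "\<nu> i = (if i < p then \<mu> i else cnj (\<mu> (i - p)))" for i
  have "(\<Sum>i<2 * p. \<nu> i) = (\<Sum>i<p. \<mu> i) + (\<Sum>i\<in>{p..<p + p}. cnj (\<mu> (i - p)))"
    unfolding mult_2 halves by (subst sum.union_disjoint) (auto simp: \<nu>_def)
  also have "(\<Sum>i\<in>{p..<p + p}. cnj (\<mu> (i - p))) = (\<Sum>i<p. cnj (\<mu> i))"
    by (rule sum.reindex_bij_witness[where i = "\<lambda>l. p + l" and j = "\<lambda>l. l - p"]) auto
  finally have \<nu>: "(\<Sum>i<2 * p. \<nu> i) = of_real (\<Sum>i<p. 2 * Re (\<mu> i))"
    by (simp add: complex_add_cnj flip: sum.distrib)
  have "deriv_act D (2 * p) (wedge1 (2 * p) (split_forms p \<gamma>)) w = (\<Sum>i<2 * p. \<nu> i) * wedge1 (2 * p) (split_forms p \<gamma>) w"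
    by (rule deriv_act_wedge1) (use w eig in \<open>auto simp: split_forms_def \<nu>_def\<close>)
  then show ?thesis
    unfolding \<nu> by (simp add: positive_volume_split deriv_act_def sum_distrib_left[symmetric] mult.left_commute)
qed

text \<open>A volume form of eigenvectors with trace \<open>s\<close> contributes the factor \<open>s * (s + lam)\<close>.\<close>

lemma volume_sum_ddc_closed:
  assumes T: "finite T" and \<Gamma>: "\<And>t i. t \<in> T \<Longrightarrow> i < p \<Longrightarrow> \<Gamma> t i \<in> forms10 J UNIV"
    and eig: "\<And>t i x. t \<in> T \<Longrightarrow> i < p \<Longrightarrow> x \<in> \<hh> \<Longrightarrow> \<Gamma> t i (D x) = \<mu> t i * \<Gamma> t i x"
    and s: "\<And>t w. t \<in> T \<Longrightarrow> (\<And>j. j < 2 * p \<Longrightarrow> w j \<in> \<hh>) \<Longrightarrow> positive_volume p (\<Gamma> t) w \<noteq> 0 \<Longrightarrow>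
      (\<Sum>i<p. 2 * Re (\<mu> t i)) = 0 \<or> (\<Sum>i<p. 2 * Re (\<mu> t i)) = - lam"
  shows "ddc_closed br J (2 * p) (volume_sum p T \<Gamma>)"
proof -
  let ?\<Omega> = "volume_sum p T \<Gamma>" and ?s = "\<lambda>t. \<Sum>i<p. 2 * Re (\<mu> t i)"
  have r: "real_pp_form J p ?\<Omega>" by (rule volume_sum_real_pp_form[OF T \<Gamma>])
  have k: "kform (2 * p) ?\<Omega>" using r by (simp add: real_pp_form_def)
  define \<Phi> where "\<Phi> g w = Re (\<Sum>t\<in>T. of_real (g t) * positive_volume p (\<Gamma> t) w)" for g w
  have \<Phi>: "deriv_act D (2 * p) (\<Phi> g) w = \<Phi> (\<lambda>t. g t * ?s t) w" if w: "\<And>j. j < 2 * p \<Longrightarrow> w j \<in> \<hh>" for g w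
  proof -
    have "deriv_act D (2 * p) (\<Phi> g) w =
        Re (\<Sum>t\<in>T. of_real (g t) * deriv_act D (2 * p) (positive_volume p (\<Gamma> t)) w)"
      unfolding deriv_act_def \<Phi>_def Re_sum[symmetric] sum_distrib_left by (subst sum.swap) (rule refl)
    also have "(\<Sum>t\<in>T. of_real (g t) * deriv_act D (2 * p) (positive_volume p (\<Gamma> t)) w) =
        (\<Sum>t\<in>T. of_real (g t * ?s t) * positive_volume p (\<Gamma> t) w)"
    proof (intro sum.cong refl)
      fix t assume t: "t \<in> T"
      have "deriv_act D (2 * p) (positive_volume p (\<Gamma> t)) w = of_real (?s t) * positive_volume p (\<Gamma> t) w"
        by (rule deriv_act_positive_volume) (use w eig[OF t] in auto)
      then show "of_real (g t) * deriv_act D (2 * p) (positive_volume p (\<Gamma> t)) w =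
          of_real (g t * ?s t) * positive_volume p (\<Gamma> t) w" by simp
    qed
    finally show ?thesis unfolding \<Phi>_def[of "\<lambda>t. g t * ?s t"] .
  qed
  have \<Omega>\<Phi>: "?\<Omega> = \<Phi> (\<lambda>_. 1)" by (simp add: \<Phi>_def volume_sum_def fun_eq_iff)
  show ?thesis
    unfolding ddc_closed_iff[OF k real_pp_form_J(1)[OF r]]
  proof (intro allI impI)
    fix w assume "\<forall>i<2 * p. w i \<in> \<hh>"
    then have w: "w j \<in> \<hh>" if "j < 2 * p" for j using that by blast
    have 1: "deriv_act D (2 * p) ?\<Omega> u = \<Phi> ?s u" if "\<And>j. j < 2 * p \<Longrightarrow> u j \<in> \<hh>" for u
      unfolding \<Omega>\<Phi> using \<Phi>[of u "\<lambda>_. 1"] that by simp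
    have "deriv_act D (2 * p) (deriv_act D (2 * p) ?\<Omega>) w = deriv_act D (2 * p) (\<Phi> ?s) w"
      unfolding deriv_act_def[of D "2 * p" "deriv_act D (2 * p) ?\<Omega>"] deriv_act_def[of D "2 * p" "\<Phi> ?s"]
      by (intro sum.cong refl 1) (auto simp: w D_hh)
    also have "\<dots> = \<Phi> (\<lambda>t. ?s t * ?s t) w" using w by (rule \<Phi>)
    finally have "deriv_act D (2 * p) (deriv_act D (2 * p) ?\<Omega>) w + lam *\<^sub>R deriv_act D (2 * p) ?\<Omega> w =
        Re (\<Sum>t\<in>T. of_real (?s t * (?s t + lam)) * positive_volume p (\<Gamma> t) w)"
      using 1[of w] w by (simp add: \<Phi>_def sum_distrib_left distrib_left distrib_right sum.distrib mult_ac)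
    also have "(\<Sum>t\<in>T. of_real (?s t * (?s t + lam)) * positive_volume p (\<Gamma> t) w) = 0"
    proof (intro sum.neutral ballI)
      fix t assume t: "t \<in> T"
      show "of_real (?s t * (?s t + lam)) * positive_volume p (\<Gamma> t) w = 0"
        using s[OF t, of w] w by (cases "positive_volume p (\<Gamma> t) w = 0") (auto simp flip: of_real_add of_real_mult of_real_sum)
    qed
    finally show "deriv_act D (2 * p) (deriv_act D (2 * p) ?\<Omega>) w + lam *\<^sub>R deriv_act D (2 * p) ?\<Omega> w = 0" by simp
  qed
qed

end

section \<open>Sufficiency\<close>

lemma wedge1_2: "wedge1 2 \<phi> v = \<phi> 0 (v 0) * \<phi> 1 (v 1) - \<phi> 0 (v 1) * \<phi> 1 (v 0)"
proof -
  have set2: "{..<2::nat} = {0, 1}" by auto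
  have p: "{\<sigma>. \<sigma> permutes {0, 1::nat}} = {id, Transposition.transpose 0 1}"
    by (auto simp: permutes_doubleton_iff)
  have "id \<noteq> Transposition.transpose 0 (1::nat)" by (metis id_apply transpose_apply_first zero_neq_one)
  then show ?thesis
    unfolding wedge1_def set2 p by (simp add: sign_swap_id sign_id)
qed

lemma positive_volume_1:
  "positive_volume (Suc 0) \<gamma> v =
    \<i> * (\<gamma> 0 (v 0) * cnj (\<gamma> 0 (v (Suc 0))) - \<gamma> 0 (v (Suc 0)) * cnj (\<gamma> 0 (v 0)))"
proof -
  have "2 * Suc 0 = 2" by simp
  then show ?thesis
    unfolding positive_volume_def by (simp only: wedge1_2) simp
qed

context almost_abelian_complex
begin

text \<open>A complex basis \<open>f\<close> of \<open>\<hh>\<close> is completed by \<open>x\<close> to one of the whole algebra, as \<open>y = J x\<close>; the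
  index \<open>m\<close> belongs to \<open>x\<close>.\<close>

definition adapted_basis :: "nat \<Rightarrow> (nat \<Rightarrow> 'a) \<Rightarrow> nat \<Rightarrow> 'a" where
  "adapted_basis m f i = (if i < m then f i else x)"

definition adapted_form :: "nat \<Rightarrow> (nat \<Rightarrow> 'a) \<Rightarrow> nat \<Rightarrow> 'a \<Rightarrow> complex" where
  "adapted_form m f = coord (adapted_basis m f) {..<Suc m}"

context
  fixes m f \<zeta> \<epsilon>
  assumes jb: "jordan_basis m f \<zeta> \<epsilon>" and diag: "\<forall>j<m. \<not> \<epsilon> j"
begin

lemma adapted_basis_image: "adapted_basis m f ` {..<Suc m} = insert x (f ` {..<m})"
  by (auto simp: adapted_basis_def lessThan_Suc image_iff)

lemma adapted_basis:
  "inj_on (adapted_basis m f) {..<Suc m}"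
  "jv.independent (adapted_basis m f ` {..<Suc m})"
  "jv.span (adapted_basis m f ` {..<Suc m}) = UNIV"
proof -
  have f: "inj_on f {..<m}" "jv.independent (f ` {..<m})" "jv.span (f ` {..<m}) = \<hh>"
    using jb by (auto simp: jordan_basis_def)
  have x: "x \<notin> \<hh>" by (simp add: hh_iff)
  then have xf: "x \<notin> f ` {..<m}" using f(3) jv.span_base by metis
  have "inj_on (adapted_basis m f) {..<m}"
    using f(1) by (auto simp: inj_on_def adapted_basis_def)
  then show "inj_on (adapted_basis m f) {..<Suc m}"
    using xf by (auto simp: lessThan_Suc adapted_basis_def)
  show "jv.independent (adapted_basis m f ` {..<Suc m})"
    unfolding adapted_basis_image using f(2,3) x by (simp add: jv.independent_insert)
  show "jv.span (adapted_basis m f ` {..<Suc m}) = UNIV"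
  proof -
    let ?S = "jv.span (insert x (f ` {..<m}))"
    have xS: "x \<in> ?S" by (intro jv.span_base) simp
    have "J x \<in> ?S" by (rule J_jv_span[OF xS])
    then have yS: "y \<in> ?S" by (simp add: J_simps)
    have "\<hh> \<subseteq> ?S" unfolding f(3)[symmetric] by (intro jv.span_mono) auto
    then have "\<xi> z *\<^sub>R x + \<eta> z *\<^sub>R y + \<pi> z \<in> ?S" for z
      using xS yS pi_hh[of z] subspace_jv_span by (intro subspace_add subspace_scale) auto
    then have "z \<in> ?S" for z by (subst decompose[of z])
    then show ?thesis unfolding adapted_basis_image by blast
  qed
qed

lemma adapted_form_simps:
  "adapted_form m f i (a + b) = adapted_form m f i a + adapted_form m f i b"
  "adapted_form m f i (jscale J c a) = c * adapted_form m f i a"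
  "adapted_form m f i (r *\<^sub>R a) = of_real r * adapted_form m f i a"
  "adapted_form m f i (J a) = \<i> * adapted_form m f i a"
  "adapted_form m f i 0 = 0"
  unfolding adapted_form_def
  using coord_add[OF adapted_basis(1,2)] coord_jscale[OF adapted_basis(1,2)]
    coord_scaleR[OF adapted_basis(1,2)] coord_J[OF adapted_basis(1,2)]
    coord_jscale[OF adapted_basis(1,2), of 0 i 0] adapted_basis(3) by simp_all

lemma adapted_form_basis: "i < Suc m \<Longrightarrow> j < m \<Longrightarrow> adapted_form m f i (f j) = (if i = j then 1 else 0)"
  using coord_basis[OF adapted_basis(1,2), of i j] by (simp add: adapted_form_def adapted_basis_def)

lemma adapted_form_10: "adapted_form m f i \<in> forms10 J UNIV"
  by (simp add: forms10_def adapted_form_simps)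

lemma adapted_form_eigen:
  assumes w: "w \<in> \<hh>" and i: "i < Suc m"
  shows "adapted_form m f i (D w) = \<zeta> i * adapted_form m f i w" and "adapted_form m f m w = 0"
proof -
  have "w \<in> jv.span (f ` {..<m})" using w jb by (simp add: jordan_basis_def)
  then have "adapted_form m f i (D w) = \<zeta> i * adapted_form m f i w \<and> adapted_form m f m w = 0"
  proof (induction rule: jv.span_induct_alt)
    case base
    show ?case by (simp add: adapted_form_simps linear_0[OF linear_D])
  next
    case (step c z y)
    then obtain j where j: "j < m" "z = f j" by auto
    have "D z = jscale J (\<zeta> j) z" "z \<in> \<hh>"
      using jb diag j jordan_basis_mem[OF jb j(1)] by (auto simp: jordan_basis_def)
    then show ?case
      using step(2) j i
      by (simp add: linear_add[OF linear_D] D_jscale adapted_form_simps adapted_form_basis algebra_simps)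
  qed
  then show "adapted_form m f i (D w) = \<zeta> i * adapted_form m f i w" "adapted_form m f m w = 0" by auto
qed

text \<open>In the power of the 2-form \<open>\<Sum>j. \<i> \<gamma> j \<and> cnj (\<gamma> j)\<close> the choices \<open>h\<close> that involve \<open>x\<close> vanish
  on \<open>\<hh>\<close>, those with repetitions vanish altogether, and the others have a sum of \<open>p\<close> distinct traces as
  eigenvalue.\<close>

theorem diagonal_imp_pluriclosed:
  assumes sums: "\<And>I. I \<subseteq> {..<m} \<Longrightarrow> card I = p \<Longrightarrow>
    (\<Sum>i\<in>I. 2 * Re (\<zeta> i)) = 0 \<or> (\<Sum>i\<in>I. 2 * Re (\<zeta> i)) = - lam"
  shows "\<exists>\<Omega>. p_pluriclosed_structure br J p \<Omega>"
proof
  let ?T = "{..<p} \<rightarrow>\<^sub>E {..<Suc m}" and ?\<Gamma> = "\<lambda>h i. adapted_form m f (h i)"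
  have "transverse J p (volume_sum p ?T ?\<Gamma>)"
    unfolding adapted_form_def by (rule volume_sum_transverse[OF adapted_basis])
  moreover have "ddc_closed br J (2 * p) (volume_sum p ?T ?\<Gamma>)"
  proof (rule volume_sum_ddc_closed[where \<mu> = "\<lambda>h i. \<zeta> (h i)"])
    show "finite ?T" by (intro finite_PiE) auto
    show "adapted_form m f (h i) \<in> forms10 J UNIV" for h i by (rule adapted_form_10)
    show "adapted_form m f (h i) (D w) = \<zeta> (h i) * adapted_form m f (h i) w"
      if "h \<in> ?T" "i < p" "w \<in> \<hh>" for h i w
      using that by (intro adapted_form_eigen(1)) auto
    fix h w assume h: "h \<in> ?T" and w: "\<And>j. j < 2 * p \<Longrightarrow> w j \<in> \<hh>"
      and nz: "positive_volume p (?\<Gamma> h) w \<noteq> 0"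
    have nz': "wedge1 (2 * p) (split_forms p (?\<Gamma> h)) w \<noteq> 0"
      using nz by (simp add: positive_volume_split)
    have hm: "h i < m" if i: "i < p" for i
    proof (rule ccontr)
      assume "\<not> h i < m"
      then have "h i = m" using h i by (fastforce simp: less_Suc_eq)
      then have "split_forms p (?\<Gamma> h) i (w j) = 0" if "j < 2 * p" for j
        using adapted_form_eigen(2)[OF w[OF that], of m] i by (simp add: split_forms_def)
      then show False using wedge1_zero_row[of i "2 * p" "split_forms p (?\<Gamma> h)" w] nz' i by simp
    qed
    have inj: "inj_on h {..<p}"
    proof (rule inj_onI, rule ccontr)
      fix i j assume "i \<in> {..<p}" "j \<in> {..<p}" "h i = h j" "i \<noteq> j"
      then show False
        using wedge1_repeated[of i "2 * p" j "split_forms p (?\<Gamma> h)" w] nz' by (simp add: split_forms_def)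
    qed
    have "(\<Sum>i<p. 2 * Re (\<zeta> (h i))) = (\<Sum>j\<in>h ` {..<p}. 2 * Re (\<zeta> j))"
      using inj by (simp add: sum.reindex)
    moreover have "h ` {..<p} \<subseteq> {..<m}" "card (h ` {..<p}) = p"
      using hm inj by (auto simp: card_image)
    ultimately show "(\<Sum>i<p. 2 * Re (\<zeta> (h i))) = 0 \<or> (\<Sum>i<p. 2 * Re (\<zeta> (h i))) = - lam"
      using sums by metis
  qed
  ultimately show "p_pluriclosed_structure br J p (volume_sum p ?T ?\<Gamma>)"
    by (simp add: p_pluriclosed_structure_def)
qed

text \<open>The case of degree one. The factor 2 makes the fundamental form of \<open>g\<close> equal to the sum of the
  \<open>\<i> \<gamma> j \<and> cnj (\<gamma> j)\<close>.\<close>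

theorem diagonal_imp_pluriclosed_metric:
  assumes \<zeta>: "\<And>j. j < m \<Longrightarrow> 2 * Re (\<zeta> j) = 0 \<or> 2 * Re (\<zeta> j) = - lam"
  shows "\<exists>g. pluriclosed_metric br J g"
proof
  let ?\<gamma> = "adapted_form m f"
  define g where "g a b = 2 * Re (\<Sum>t<Suc m. ?\<gamma> t a * cnj (?\<gamma> t b))" for a b
  have "bilinear g"
    unfolding bilinear_def g_def
    by (intro conjI allI linearI)
      (simp_all add: adapted_form_simps distrib_left distrib_right sum.distrib sum_distrib_left mult_ac
        del: sum.lessThan_Suc)
  moreover have "g a b = g b a" for a b
    unfolding g_def by (simp add: mult_ac del: sum.lessThan_Suc)
  moreover have "g (J a) (J b) = g a b" for a b
    unfolding g_def by (simp add: adapted_form_simps mult_ac del: sum.lessThan_Suc)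
  moreover have "g a a > 0" if a: "a \<noteq> 0" for a
  proof -
    have e: "g a a = 2 * (\<Sum>t<Suc m. (cmod (?\<gamma> t a))\<^sup>2)"
      unfolding g_def by (simp add: complex_mult_cnj cmod_power2 del: sum.lessThan_Suc)
    have "\<exists>t<Suc m. ?\<gamma> t a \<noteq> 0"
    proof (rule ccontr)
      assume "\<not> (\<exists>t<Suc m. ?\<gamma> t a \<noteq> 0)"
      then have "(\<Sum>t<Suc m. jscale J (?\<gamma> t a) (adapted_basis m f t)) = 0" by (intro sum.neutral) auto
      then show False
        using a coord_expansion[OF adapted_basis(1,2), of a] adapted_basis(3) by (simp add: adapted_form_def)
    qed
    then have "(\<Sum>t<Suc m. (cmod (?\<gamma> t a))\<^sup>2) > 0"
      by (auto intro!: sum_pos2 simp del: sum.lessThan_Suc)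
    then show ?thesis unfolding e by simp
  qed
  moreover have "ddc_closed br J 2 (\<lambda>v. g (J (v 0)) (v 1))"
  proof -
    have "(\<lambda>v. g (J (v 0)) (v 1)) = volume_sum 1 {..<Suc m} (\<lambda>t i. ?\<gamma> t)"
      unfolding volume_sum_def[abs_def] g_def One_nat_def positive_volume_1
      by (simp add: adapted_form_simps sum_distrib_left fun_eq_iff algebra_simps del: sum.lessThan_Suc)
    moreover have "ddc_closed br J (2 * 1) (volume_sum 1 {..<Suc m} (\<lambda>t i. ?\<gamma> t))"
    proof (rule volume_sum_ddc_closed[where \<mu> = "\<lambda>t i. \<zeta> t"])
      show "?\<gamma> t (D w) = \<zeta> t * ?\<gamma> t w" if "t \<in> {..<Suc m}" "w \<in> \<hh>" for t w
        using that by (intro adapted_form_eigen(1)) auto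
      fix t w assume t: "t \<in> {..<Suc m}" and w: "\<And>j. j < 2 * 1 \<Longrightarrow> w j \<in> \<hh>"
        and nz: "positive_volume 1 (\<lambda>i. ?\<gamma> t) w \<noteq> 0"
      have "t \<noteq> m"
        using nz adapted_form_eigen(2)[OF w[of 0], of m] adapted_form_eigen(2)[OF w[of 1], of m]
        by (auto simp: positive_volume_1)
      then show "(\<Sum>i<1::nat. 2 * Re (\<zeta> t)) = 0 \<or> (\<Sum>i<1::nat. 2 * Re (\<zeta> t)) = - lam"
        using \<zeta>[of t] t by simp
    qed (auto intro: adapted_form_10)
    ultimately show ?thesis by simp
  qed
  ultimately show "pluriclosed_metric br J g"
    unfolding pluriclosed_metric_def hermitian_metric_def by blast
qed

end

end

section \<open>Families of numbers with two subset sums\<close>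

lemma image_mset_two_valued:
  assumes S: "finite S" and P: "P \<subseteq> S" and g: "\<And>j. j \<in> S \<Longrightarrow> g j = (if j \<in> P then a else b)"
  shows "image_mset g (mset_set S) = replicate_mset (card P) a + replicate_mset (card S - card P) b"
proof -
  have fP: "finite P" using S P finite_subset by blast
  have "mset_set S = mset_set P + mset_set (S - P)"
    using S P by (subst mset_set_Union[symmetric]) (auto simp: Un_absorb1 intro: finite_subset)
  moreover have "image_mset g (mset_set P) = replicate_mset (card P) a"
    using g P fP by (subst image_mset_cong[where g = "\<lambda>_. a"]) (auto simp: image_mset_const_eq)
  moreover have "image_mset g (mset_set (S - P)) = replicate_mset (card (S - P)) b"
    using g S by (subst image_mset_cong[where g = "\<lambda>_. b"]) (auto simp: image_mset_const_eq)
  ultimately show ?thesis using card_Diff_subset[OF fP P] by simp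
qed

lemma two_valued_permutation:
  assumes S: "finite S" and K: "K \<subseteq> S" and P: "P \<subseteq> S" "card P = card K"
    and u: "\<And>j. j \<in> S \<Longrightarrow> u j = (if j \<in> K then a else b)"
  obtains \<sigma> where "\<sigma> permutes S" "\<And>j. j \<in> S \<Longrightarrow> u (\<sigma> j) = (if j \<in> P then a else b)"
proof -
  let ?g = "\<lambda>j. if j \<in> P then a else b"
  have "image_mset ?g (mset_set S) = image_mset u (mset_set S)"
    using image_mset_two_valued[OF S P(1), of ?g a b] image_mset_two_valued[OF S K u] P(2) by simp
  from image_mset_eq_implies_permutes[OF S this] obtain \<sigma> where "\<sigma> permutes S" "\<forall>j\<in>S. ?g j = u (\<sigma> j)" .
  then show thesis using that[of \<sigma>] by simp
qed

lemma sum_two_valued: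
  fixes u :: "'i \<Rightarrow> real"
  assumes "finite I" "\<And>j. j \<in> I \<Longrightarrow> u j = (if j \<in> K then a else b)"
  shows "sum u I = real (card I) * a + real (card (I - K)) * (b - a)"
proof -
  have "sum u I = (\<Sum>j\<in>I. a) + (\<Sum>j\<in>I. if j \<in> K then 0 else b - a)"
    unfolding sum.distrib[symmetric] by (rule sum.cong) (auto simp: assms(2))
  also have "(\<Sum>j\<in>I. if j \<in> K then 0 else b - a) = (\<Sum>j\<in>I - K. b - a)"
    by (rule sum.mono_neutral_cong_right) (use assms(1) in auto)
  finally show ?thesis by simp
qed

lemma subset_with_part:
  assumes S: "finite S" and K: "K \<subseteq> S" and r: "r \<le> p" "r \<le> card (S - K)" "p - r \<le> card K"
  obtains I where "I \<subseteq> S" "card I = p" "card (I - K) = r"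
proof -
  have fK: "finite K" "finite (S - K)" using S K finite_subset by auto
  obtain X where X: "X \<subseteq> S - K" "card X = r" using r(2) fK by (meson obtain_subset_with_card_n)
  obtain Y where Y: "Y \<subseteq> K" "card Y = p - r" using r(3) fK by (meson obtain_subset_with_card_n)
  have "finite X" "finite Y" using finite_subset[OF X(1) fK(2)] finite_subset[OF Y(1) fK(1)] .
  then have "card (X \<union> Y) = p" using X Y r(1) by (subst card_Un_disjoint) auto
  moreover have "X \<union> Y - K = X" using X Y by auto
  ultimately show thesis using that[of "X \<union> Y"] X Y K by auto
qed

text \<open>Two members of the family can be exchanged in some sum of \<open>p\<close> members, so that they differ by
  \<open>0\<close> or \<open>\<plusminus> lam\<close>.\<close>

lemma subset_sums_two_values:
  fixes u :: "'i \<Rightarrow> real"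
  assumes S: "finite S" and p: "1 \<le> p" "p < card S"
    and sums: "\<And>I. I \<subseteq> S \<Longrightarrow> card I = p \<Longrightarrow> sum u I = 0 \<or> sum u I = - lam"
  obtains t where "\<And>j. j \<in> S \<Longrightarrow> u j = t \<or> u j = t + lam"
proof -
  have diff: "u i - u j = 0 \<or> u i - u j = lam \<or> u i - u j = - lam" if ij: "i \<in> S" "j \<in> S" "i \<noteq> j" for i j
  proof -
    have "p - 1 \<le> card (S - {i, j})" using S ij p by (simp add: card_Diff_subset)
    then obtain X where X: "X \<subseteq> S - {i, j}" "card X = p - 1" by (meson obtain_subset_with_card_n)
    then have fX: "finite X" "i \<notin> X" "j \<notin> X" using S finite_subset by auto
    have "sum u (insert i X) = u i + sum u X" "sum u (insert j X) = u j + sum u X"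
      using fX by auto
    moreover have "sum u (insert i X) = 0 \<or> sum u (insert i X) = - lam"
      "sum u (insert j X) = 0 \<or> sum u (insert j X) = - lam"
    proof -
      have "insert i X \<subseteq> S" "card (insert i X) = p" "insert j X \<subseteq> S" "card (insert j X) = p"
        using X fX ij p by auto
      then show "sum u (insert i X) = 0 \<or> sum u (insert i X) = - lam"
        "sum u (insert j X) = 0 \<or> sum u (insert j X) = - lam"
        using sums by metis+
    qed
    ultimately show ?thesis by linarith
  qed
  obtain i where i: "i \<in> S" using p(2) by fastforce
  show thesis
  proof (cases "\<exists>j\<in>S. u j = u i - lam")
    case True
    then obtain j where j: "j \<in> S" "u j = u i - lam" by auto
    have "u l = u j \<or> u l = u j + lam" if "l \<in> S" for l
    proof (cases "l = i \<or> l = j")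
      case False
      then show ?thesis
        using diff[OF that i] diff[OF that j(1)] j(2) by (smt (verit))
    qed (use j(2) in auto)
    then show thesis by (rule that)
  next
    case False
    have "u l = u i \<or> u l = u i + lam" if "l \<in> S" for l
      using diff[OF that i] False that by (cases "l = i") (auto simp: algebra_simps)
    then show thesis by (rule that)
  qed
qed

lemma subset_sums_permute:
  fixes u :: "'i \<Rightarrow> real"
  assumes \<tau>: "bij_betw \<tau> X Y" and g: "\<And>i. i \<in> X \<Longrightarrow> g i = u (\<tau> i)"
    and sums: "\<And>I. I \<subseteq> X \<Longrightarrow> card I = p \<Longrightarrow> sum g I = a \<or> sum g I = b"
    and I: "I \<subseteq> Y" "card I = p"
  shows "sum u I = a \<or> sum u I = b"
proof -
  let ?I = "{i \<in> X. \<tau> i \<in> I}"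
  have b: "bij_betw \<tau> ?I I"
    using \<tau> I(1) by (auto simp: bij_betw_def inj_on_def image_iff)
  have "sum g ?I = (\<Sum>i\<in>?I. u (\<tau> i))" by (rule sum.cong) (auto simp: g)
  also have "\<dots> = sum u I" by (rule sum.reindex_bij_betw[OF b])
  finally have "sum g ?I = sum u I" .
  moreover have "card ?I = p" using bij_betw_same_card[OF b] I(2) by simp
  ultimately show ?thesis using sums[of ?I] by auto
qed

definition trace_cases :: "nat \<Rightarrow> nat \<Rightarrow> real \<Rightarrow> (nat \<Rightarrow> real) \<Rightarrow> bool" where
  "trace_cases n p lam u \<longleftrightarrow>
    (p = n - 2 \<and>
      (\<exists>k\<in>{0..n - 1}. let t = (real k + 1 - real n) / (real n - 2) * lam in
        (\<forall>j\<in>{2..k + 1}. u j = t) \<and> (\<forall>j\<in>{k + 2..n}. u j = t + lam))) \<or>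
    (p \<le> n - 3 \<and>
      ((\<forall>j\<in>{2..n}. u j = 0) \<or>
       (\<forall>j\<in>{2..n}. u j = - lam / real p) \<or>
       ((\<forall>j\<in>{2..n - 1}. u j = 0) \<and> u n = - lam) \<or>
       ((\<forall>j\<in>{2..n - 1}. u j = - lam / real p) \<and>
         u n = (real p - 1) / real p * lam)))"

text \<open>With \<open>k\<close> of the \<open>n - 1\<close> numbers equal to \<open>t\<close> and the others to \<open>t + lam\<close>, the sums are
  \<open>p * t + r * lam\<close>, where \<open>r\<close> runs through the interval from \<open>p - min p k\<close> to \<open>min p (n - 1 - k)\<close>. For
  \<open>lam \<noteq> 0\<close> the length of this interval is at most one, and if it is one the sums determine \<open>t\<close>. For
  \<open>0 < k < n - 1\<close> this leaves \<open>p = n - 2\<close> with any \<open>k\<close>, or \<open>k = n - 2\<close>, or \<open>k = 1\<close>.\<close>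

lemma subset_sums_classification:
  fixes u :: "nat \<Rightarrow> real"
  assumes n: "4 \<le> n" and p: "2 \<le> p" "p \<le> n - 2"
    and sums: "\<And>I. I \<subseteq> {2..n} \<Longrightarrow> card I = p \<Longrightarrow> sum u I = 0 \<or> sum u I = - lam"
  shows "\<exists>\<sigma>. \<sigma> permutes {2..n} \<and> trace_cases n p lam (\<lambda>j. u (\<sigma> j))"
proof -
  let ?S = "{2..n}"
  have cS: "card ?S = n - 1" by simp
  have p0: "real p \<noteq> 0" and n2: "real n - 2 > 0" using p n by auto
  have pc: "p < card ?S" unfolding cS using p n by arith
  obtain t where t: "\<And>j. j \<in> ?S \<Longrightarrow> u j = t \<or> u j = t + lam"
  proof (rule subset_sums_two_values[of ?S p u lam])
    show "1 \<le> p" using p by simp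
  qed (use pc sums in auto)
  define K where "K = {j \<in> ?S. u j = t}"
  define k where "k = card K"
  have K: "K \<subseteq> ?S" by (auto simp: K_def)
  have kn: "k \<le> n - 1" using card_mono[OF _ K] by (simp add: k_def)
  have cSK: "card (?S - K) = n - 1 - k"
    using card_Diff_subset[of K ?S] K finite_subset[OF K] by (simp add: k_def)
  have u: "u j = (if j \<in> K then t else t + lam)" if "j \<in> ?S" for j
    using t[OF that] that by (auto simp: K_def)
  have range: "real p * t + real r * lam = 0 \<or> real p * t + real r * lam = - lam"
    if r: "r \<le> p" "r \<le> n - 1 - k" "p - r \<le> k" for r
  proof -
    obtain I where I: "I \<subseteq> ?S" "card I = p" "card (I - K) = r"
      using subset_with_part[OF _ K, of r p] r cSK by (auto simp: k_def)
    have "finite I" using I(1) finite_subset by blast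
    then have "sum u I = real (card I) * t + real (card (I - K)) * (t + lam - t)"
      using I(1) u by (intro sum_two_valued) auto
    then show ?thesis using sums[OF I(1,2)] I by simp
  qed
  have const: ?thesis if c: "\<And>j. j \<in> ?S \<Longrightarrow> u j = c" for c
  proof -
    obtain I where I: "I \<subseteq> ?S" "card I = p"
      using obtain_subset_with_card_n[OF less_imp_le[OF pc]] by auto
    have "sum u I = (\<Sum>j\<in>I. c)" using I(1) c by (intro sum.cong) auto
    then have "sum u I = real p * c" using I(2) by simp
    then have "real p * c = 0 \<or> real p * c = - lam" using sums[OF I] by simp
    then have "c = 0 \<or> c = - lam / real p" using p0 by (auto simp: field_simps)
    moreover have "trace_cases n p lam (\<lambda>j. u (id j))"
    proof (cases "p = n - 2")
      case True
      then have pn: "real p = real n - 2" using n by (simp add: of_nat_diff)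
      from \<open>c = 0 \<or> c = - lam / real p\<close> show ?thesis
      proof
        assume "c = 0"
        then have "\<exists>k\<in>{0..n - 1}. let t = (real k + 1 - real n) / (real n - 2) * lam in
            (\<forall>j\<in>{2..k + 1}. u j = t) \<and> (\<forall>j\<in>{k + 2..n}. u j = t + lam)"
          using c n by (intro bexI[of _ "n - 1"]) (auto simp: of_nat_diff)
        then show ?thesis using True by (simp add: trace_cases_def)
      next
        assume "c = - lam / real p"
        moreover have "- lam / real p = (real 0 + 1 - real n) / (real n - 2) * lam + lam"
          unfolding pn using n2 by (simp add: field_simps)
        ultimately have "\<exists>k\<in>{0..n - 1}. let t = (real k + 1 - real n) / (real n - 2) * lam in
            (\<forall>j\<in>{2..k + 1}. u j = t) \<and> (\<forall>j\<in>{k + 2..n}. u j = t + lam)"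
          using c by (intro bexI[of _ 0]) (auto simp: Let_def)
        then show ?thesis using True by (simp add: trace_cases_def)
      qed
    next
      case False
      then have "p \<le> n - 3" using p by simp
      then show ?thesis using calculation c by (auto simp: trace_cases_def)
    qed
    ultimately show ?thesis using permutes_id by blast
  qed
  show ?thesis
  proof (cases "lam = 0 \<or> k = 0 \<or> k = n - 1")
    case True
    have "\<exists>c. \<forall>j\<in>?S. u j = c"
    proof -
      consider "lam = 0" | "k = 0" | "k = n - 1" using True by blast
      then show ?thesis
      proof cases
        case 1
        then show ?thesis using t by auto
      next
        case 2
        then have "K = {}" using K finite_subset[OF K] by (simp add: k_def)
        then show ?thesis using u by auto
      next
        case 3
        then have "K = ?S" using card_subset_eq[OF _ K] by (simp add: k_def)
        then show ?thesis using u by auto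
      qed
    qed
    then show ?thesis using const by blast
  next
    case False
    then have lam: "lam \<noteq> 0" and k: "1 \<le> k" "k \<le> n - 2" using kn by auto
    have two: "real p * t + real r * lam = - lam"
      if r: "Suc r \<le> p" "Suc r \<le> n - 1 - k" "p - r \<le> k" for r
    proof -
      have "p - Suc r \<le> k" using r(3) by simp
      then show ?thesis
        using range[of r] range[of "Suc r"] r lam by (auto simp: algebra_simps)
    qed
    have three: "\<not> (Suc (Suc r) \<le> p \<and> Suc (Suc r) \<le> n - 1 - k \<and> p - r \<le> k)" for r
    proof
      assume r: "Suc (Suc r) \<le> p \<and> Suc (Suc r) \<le> n - 1 - k \<and> p - r \<le> k"
      then have "p - Suc r \<le> k" by (elim conjE) arith
      then show False using two[of r] two[of "Suc r"] r lam by (auto simp: algebra_simps)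
    qed
    show ?thesis
    proof (cases "p = n - 2")
      case True
      have pn: "real p = real n - 2" using True n by (simp add: of_nat_diff)
      have "real p * t + real (n - 2 - k) * lam = - lam"
        by (rule two) (use True k n in auto)
      then have "t * (real n - 2) = (real k + 1 - real n) * lam"
        using k n unfolding pn by (simp add: of_nat_diff algebra_simps)
      then have te: "t = (real k + 1 - real n) / (real n - 2) * lam"
        using n2 by (simp add: field_simps)
      obtain \<sigma> where \<sigma>: "\<sigma> permutes ?S" "\<And>j. j \<in> ?S \<Longrightarrow> u (\<sigma> j) = (if j \<in> {2..k + 1} then t else t + lam)"
      proof (rule two_valued_permutation[OF finite_atLeastAtMost K, of "{2..k + 1}" u t "t + lam"])
        have "k + 1 \<le> n" using k n by arith
        then show "{2..k + 1} \<subseteq> ?S" by auto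
      qed (use u k_def in auto)
      have "\<exists>k\<in>{0..n - 1}. let t = (real k + 1 - real n) / (real n - 2) * lam in
            (\<forall>j\<in>{2..k + 1}. u (\<sigma> j) = t) \<and> (\<forall>j\<in>{k + 2..n}. u (\<sigma> j) = t + lam)"
      proof (rule bexI[of _ k])
        have "k + 1 \<le> n" using k n by arith
        then have "u (\<sigma> j) = t" if "j \<in> {2..k + 1}" for j
          using \<sigma>(2)[of j] that by simp
        moreover have "u (\<sigma> j) = t + lam" if "j \<in> {k + 2..n}" for j
          using \<sigma>(2)[of j] that by simp
        ultimately show "let t = (real k + 1 - real n) / (real n - 2) * lam in
            (\<forall>j\<in>{2..k + 1}. u (\<sigma> j) = t) \<and> (\<forall>j\<in>{k + 2..n}. u (\<sigma> j) = t + lam)"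
          unfolding Let_def te[symmetric] by blast
      qed (use k in auto)
      then show ?thesis using \<sigma>(1) True by (intro exI[of _ \<sigma>]) (simp add: trace_cases_def)
    next
      case ne: False
      then have p3: "p \<le> n - 3" using p by simp
      show ?thesis
      proof (cases "p \<le> k")
        case True
        have "real p * t + real 0 * lam = - lam" by (rule two) (use True p k n in auto)
        then have te: "t = - lam / real p" using p0 by (simp add: field_simps)
        have "k = n - 2" using three[of 0] True p k by simp
        then obtain \<sigma> where \<sigma>: "\<sigma> permutes ?S" "\<And>j. j \<in> ?S \<Longrightarrow> u (\<sigma> j) = (if j \<in> {2..n - 1} then t else t + lam)"
          using two_valued_permutation[OF _ K, of "{2..n - 1}" u t "t + lam"] u n by (auto simp: k_def)
        have "t + lam = (real p - 1) / real p * lam" unfolding te using p0 by (simp add: field_simps)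
        then have "(\<forall>j\<in>{2..n - 1}. u (\<sigma> j) = - lam / real p) \<and> u (\<sigma> n) = (real p - 1) / real p * lam"
          using \<sigma>(2) te n by auto
        then show ?thesis using \<sigma>(1) p3 by (intro exI[of _ \<sigma>]) (simp add: trace_cases_def)
      next
        case False
        have "real p * t + real (p - k) * lam = - lam" by (rule two) (use False p3 k n in auto)
        moreover have k1: "k = 1" using three[of "p - k"] False p3 k by force
        ultimately have "real p * (t + lam) = 0" using p by (simp add: of_nat_diff algebra_simps)
        then have te: "t = - lam" using p0 by simp
        have SK: "?S - K \<subseteq> ?S" "card {2..n - 1} = card (?S - K)" using cSK k1 by auto
        obtain \<sigma> where \<sigma>: "\<sigma> permutes ?S" "\<And>j. j \<in> ?S \<Longrightarrow> u (\<sigma> j) = (if j \<in> {2..n - 1} then t + lam else t)"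
          by (rule two_valued_permutation[OF finite_atLeastAtMost SK(1) _ SK(2), of u "t + lam" t])
            (use u in auto)
        then have "(\<forall>j\<in>{2..n - 1}. u (\<sigma> j) = 0) \<and> u (\<sigma> n) = - lam"
          using te n by auto
        then show ?thesis using \<sigma>(1) p3 by (intro exI[of _ \<sigma>]) (simp add: trace_cases_def)
      qed
    qed
  qed
qed

lemma subset_sums_of_classification:
  fixes u :: "nat \<Rightarrow> real"
  assumes n: "4 \<le> n" and p: "2 \<le> p" "p \<le> n - 2"
    and C: "trace_cases n p lam u"
    and I: "I \<subseteq> {2..n}" "card I = p"
  shows "sum u I = 0 \<or> sum u I = - lam"
proof -
  have p0: "real p \<noteq> 0" using p by simp
  have fI: "finite I" using I(1) finite_subset by blast
  have two: "sum u I = real p * a + real (card (I - {2..k})) * (b - a)"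
    if "\<And>j. j \<in> {2..k} \<Longrightarrow> u j = a" "\<And>j. j \<in> {Suc k..n} \<Longrightarrow> u j = b" for a b k
    unfolding I(2)[symmetric]
    by (rule sum_two_valued[OF fI]) (use that I(1) in \<open>auto simp: Suc_le_eq subset_eq\<close>)
  have last: "card (I - {2..n - 1}) = 0 \<or> card (I - {2..n - 1}) = 1"
  proof -
    have "I - {2..n - 1} \<subseteq> {n}"
    proof
      fix x assume "x \<in> I - {2..n - 1}"
      moreover from this have "2 \<le> x" "x \<le> n" using I(1) by auto
      ultimately show "x \<in> {n}" by auto
    qed
    then show ?thesis using card_mono[of "{n}" "I - {2..n - 1}"] by fastforce
  qed
  have lastsum: "sum u I = real p * a \<or> sum u I = real p * a + (b - a)"
    if "\<forall>j\<in>{2..n - 1}. u j = a" "u n = b" for a b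
  proof -
    have "{Suc (n - 1)..n} = {n}" using n by auto
    then show ?thesis using two[of "n - 1" a b] that last by auto
  qed
  from C[unfolded trace_cases_def] show ?thesis
  proof (elim disjE conjE bexE)
    fix k assume pn: "p = n - 2" and k: "k \<in> {0..n - 1}"
      and u: "let t = (real k + 1 - real n) / (real n - 2) * lam in
              (\<forall>j\<in>{2..k + 1}. u j = t) \<and> (\<forall>j\<in>{k + 2..n}. u j = t + lam)"
    define t where "t = (real k + 1 - real n) / (real n - 2) * lam"
    have pr: "real p = real n - 2" using pn n by (simp add: of_nat_diff)
    have pt: "real p * t = (real k + 1 - real n) * lam" unfolding t_def pr using n by simp
    define r where "r = card (I - {2..k + 1})"
    have s: "sum u I = (real k + 1 - real n) * lam + real r * lam"
    proof -
      have "\<And>j. j \<in> {2..k + 1} \<Longrightarrow> u j = t" "\<And>j. j \<in> {Suc (k + 1)..n} \<Longrightarrow> u j = t + lam"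
        using u unfolding Let_def t_def[symmetric] by auto
      then show ?thesis
        using two[of "k + 1" t "t + lam"] by (simp only: pt r_def) simp
    qed
    have "r + card (I \<inter> {2..k + 1}) = p"
      using card_Int_Diff[OF fI, of "{2..k + 1}"] I(2) by (simp add: r_def)
    moreover have "card (I \<inter> {2..k + 1}) \<le> k" using card_mono[of "{2..k + 1}" "I \<inter> {2..k + 1}"] by simp
    moreover have "r \<le> n - 1 - k"
    proof -
      have "I - {2..k + 1} \<subseteq> {k + 2..n}" using I(1) by auto
      then have "r \<le> card {k + 2..n}" unfolding r_def by (intro card_mono) auto
      then show ?thesis by simp
    qed
    ultimately have "r = n - 1 - k \<or> Suc r = n - 1 - k" using pn k n by auto
    then have "real r = real n - 1 - real k \<or> real r = real n - 2 - real k"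
      using k n by (auto simp: of_nat_diff)
    then have "real k + 1 - real n + real r = 0 \<or> real k + 1 - real n + real r = - 1" by auto
    moreover have "sum u I = (real k + 1 - real n + real r) * lam" unfolding s by (simp add: distrib_right)
    ultimately show ?thesis by (metis mult_minus1 mult_zero_left)
  next
    assume "\<forall>j\<in>{2..n}. u j = 0"
    then have "\<forall>j\<in>{2..n - 1}. u j = 0" "u n = 0" using n by auto
    then show ?thesis using lastsum[of 0 0] by simp
  next
    assume "\<forall>j\<in>{2..n}. u j = - lam / real p"
    then have "\<forall>j\<in>{2..n - 1}. u j = - lam / real p" "u n = - lam / real p" using n by auto
    then show ?thesis using lastsum[of "- lam / real p" "- lam / real p"] p0 by simp
  next
    assume "\<forall>j\<in>{2..n - 1}. u j = 0" "u n = - lam"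
    then show ?thesis using lastsum[of 0 "- lam"] by auto
  next
    assume "\<forall>j\<in>{2..n - 1}. u j = - lam / real p" "u n = (real p - 1) / real p * lam"
    moreover have "real p * (- lam / real p) = - lam"
      "real p * (- lam / real p) + ((real p - 1) / real p * lam - (- lam / real p)) = 0"
      using p0 by (simp_all add: field_simps)
    ultimately show ?thesis using lastsum[of "- lam / real p" "(real p - 1) / real p * lam"] by auto
  qed
qed

section \<open>The classification\<close>

theorem theorem4p12:
  fixes br :: "'a::euclidean_space \<Rightarrow> 'a \<Rightarrow> 'a"
    and \<aa> :: "'a set"
    and J A :: "'a \<Rightarrow> 'a"
    and lam :: real
    and v :: 'a
    and n p :: nat
    and z :: "nat \<Rightarrow> complex"
    and u :: "nat \<Rightarrow> real"
  assumes "almost_abelian br \<aa>"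
    and "DIM('a) = 2 * n" and "2 * n \<ge> 8"
    and "integrable_cs br J"
    and "presentation br \<aa> J lam v A"
    and "eigenvalues_with_mult (cx_part10 J (J_part J \<aa>)) (map_prod A A) {2..n} z"
    and "\<And>j. j \<in> {2..n} \<Longrightarrow> of_real (u j) = z j + cnj (z j)"
    and "2 \<le> p" and "p \<le> n - 2"
  shows "((\<exists>\<Omega>. p_pluriclosed_structure br J p \<Omega>) \<longleftrightarrow>
      diagonalizable_over_C (J_part J \<aa>) A \<and>
      (\<exists>\<sigma>. \<sigma> permutes {2..n} \<and>
        (let u' = (\<lambda>j. u (\<sigma> j)) in
          (p = n - 2 \<and>
            (\<exists>k\<in>{0..n - 1}. let t = (real k + 1 - real n) / (real n - 2) * lam in
              (\<forall>j\<in>{2..k + 1}. u' j = t) \<and> (\<forall>j\<in>{k + 2..n}. u' j = t + lam))) \<or>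
          (p \<le> n - 3 \<and>
            ((\<forall>j\<in>{2..n}. u' j = 0) \<or>
             (\<forall>j\<in>{2..n}. u' j = - lam / real p) \<or>
             ((\<forall>j\<in>{2..n - 1}. u' j = 0) \<and> u' n = - lam) \<or>
             ((\<forall>j\<in>{2..n - 1}. u' j = - lam / real p) \<and>
               u' n = (real p - 1) / real p * lam))))))
    \<and> (p \<le> n - 3 \<and> diagonalizable_over_C (J_part J \<aa>) A \<and>
        (\<exists>\<sigma>. \<sigma> permutes {2..n} \<and> (\<forall>j\<in>{2..n - 1}. u (\<sigma> j) = 0) \<and> u (\<sigma> n) = - lam)
      \<longrightarrow> (\<exists>g. pluriclosed_metric br J g))"
    (is "(?L \<longleftrightarrow> ?Dg \<and> ?R) \<and> _")
proof -
  have n: "4 \<le> n" using assms(3) by simp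
  obtain y where y: "y \<in> \<aa>" "y \<notin> J_part J \<aa>" and A: "\<And>w. w \<in> J_part J \<aa> \<Longrightarrow> A w = br (- J y) w"
    and v: "v \<in> J_part J \<aa>" "br (- J y) y = lam *\<^sub>R y + v"
    using assms(5) unfolding presentation_def by blast
  have J: "complex_structure J" using assms(4) by (simp add: integrable_cs_def)
  interpret almost_abelian_complex J br \<aa> lam v y
    by unfold_locales (use J assms(1,4) y v in auto)
  obtain m f \<zeta> \<epsilon> where jb: "jordan_basis m f \<zeta> \<epsilon>"
    and mset: "image_mset \<zeta> (mset_set {..<m}) = image_mset z (mset_set {2..n})"
    using jordan_basis_exists[OF assms(6) finite_atLeastAtMost A] .
  have "size (image_mset \<zeta> (mset_set {..<m})) = size (image_mset z (mset_set {2..n}))"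
    using mset by simp
  then have m: "m = n - 1" by simp
  \<comment> \<open>The given eigenvalues are indexed from 2, the Jordan basis from 0.\<close>
  have shift: "bij_betw (\<lambda>j. j - 2) {2..n} {..<m}"
    by (rule bij_betw_byWitness[where f' = "\<lambda>i. i + 2"]) (use m n in auto)
  have "image_mset (\<lambda>j. \<zeta> (j - 2)) (mset_set {2..n}) = image_mset \<zeta> (image_mset (\<lambda>j. j - 2) (mset_set {2..n}))"
    by (simp add: multiset.map_comp o_def)
  also have "image_mset (\<lambda>j. j - 2) (mset_set {2..n}) = mset_set {..<m}"
    using shift by (simp add: bij_betw_def image_mset_mset_set)
  finally have "image_mset (\<lambda>j. \<zeta> (j - 2)) (mset_set {2..n}) = image_mset z (mset_set {2..n})"
    using mset by simp
  from image_mset_eq_implies_permutes[OF finite_atLeastAtMost this]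
  obtain \<rho> where \<rho>: "\<rho> permutes {2..n}" "\<forall>j\<in>{2..n}. \<zeta> (j - 2) = z (\<rho> j)" .
  define \<tau> where "\<tau> i = \<rho> (i + 2)" for i
  have \<tau>: "bij_betw \<tau> {..<m} {2..n}"
  proof -
    have "bij_betw (\<lambda>i. i + 2) {..<m} {2..n}"
      by (rule bij_betw_byWitness[where f' = "\<lambda>j. j - 2"]) (use m n in auto)
    from bij_betw_trans[OF this permutes_imp_bij[OF \<rho>(1)]] show ?thesis
      by (simp add: \<tau>_def[abs_def] o_def)
  qed
  have u\<zeta>: "2 * Re (\<zeta> i) = u (\<tau> i)" if "i \<in> {..<m}" for i
  proof -
    have "\<tau> i \<in> {2..n}" using \<tau> that by (auto simp: bij_betw_def)
    moreover have "i + 2 \<in> {2..n}" using that m n by auto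
    then have "\<zeta> i = z (\<tau> i)" using bspec[OF \<rho>(2), of "i + 2"] by (simp add: \<tau>_def)
    ultimately have "complex_of_real (u (\<tau> i)) = \<zeta> i + cnj (\<zeta> i)" using assms(7) by simp
    then show ?thesis by (simp add: complex_add_cnj flip: of_real_mult)
  qed
  have dg: "diagonalizable_over_C \<hh> A \<longleftrightarrow> (\<forall>j<m. \<not> \<epsilon> j)"
  proof -
    have "map_prod A A b = map_prod D D b" if "cx.span B = \<hh> \<times> \<hh>" "b \<in> B" for B b
    proof -
      have "b \<in> \<hh> \<times> \<hh>" using cx.span_base[OF that(2)] that(1) by simp
      then show ?thesis by (auto simp: A)
    qed
    then have "diagonalizable_over_C \<hh> A \<longleftrightarrow> diagonalizable_over_C \<hh> D"
      unfolding diagonalizable_over_C_def by (metis (no_types, lifting))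
    then show ?thesis
      using diagonalizable_imp_jordan_diagonal[OF _ jb] jordan_diagonal_imp_diagonalizable[OF jb] by blast
  qed
  have \<tau>': "bij_betw (inv_into {..<m} \<tau>) {2..n} {..<m}"
    by (rule bij_betw_inv_into[OF \<tau>])
  have u\<zeta>': "u j = 2 * Re (\<zeta> (inv_into {..<m} \<tau> j))" if "j \<in> {2..n}" for j
    using u\<zeta>[of "inv_into {..<m} \<tau> j"] bij_betw_inv_into_right[OF \<tau> that] bij_betwE[OF \<tau>'] that
    by simp
  have sums: "sum (\<lambda>i. 2 * Re (\<zeta> i)) I = 0 \<or> sum (\<lambda>i. 2 * Re (\<zeta> i)) I = - lam"
    if "\<And>I. I \<subseteq> {2..n} \<Longrightarrow> card I = q \<Longrightarrow> sum u I = 0 \<or> sum u I = - lam" "I \<subseteq> {..<m}" "card I = q" for q I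
    by (rule subset_sums_permute[OF \<tau>' u\<zeta>' that])
  show ?thesis
  proof (intro conjI impI)
    show "?L \<longleftrightarrow> ?Dg \<and> ?R"
    proof
      assume ?L
      then obtain \<Omega> where \<Omega>: "p_pluriclosed_structure br J p \<Omega>" by blast
      have d: "\<forall>j<m. \<not> \<epsilon> j"
        by (rule pluriclosed_imp_diagonal[OF \<Omega> jb]) (use assms(8,9) m n in auto)
      have "sum u I = 0 \<or> sum u I = - lam" if "I \<subseteq> {2..n}" "card I = p" for I
        by (rule subset_sums_permute[OF \<tau> u\<zeta> pluriclosed_imp_trace[OF \<Omega> jb d] that])
      from subset_sums_classification[OF n assms(8,9) this] have ?R
        by (simp add: trace_cases_def)
      moreover have ?Dg using dg d by blast
      ultimately show "?Dg \<and> ?R" by blast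
    next
      assume DR: "?Dg \<and> ?R"
      then obtain \<sigma> where \<sigma>: "\<sigma> permutes {2..n}"
        and C: "trace_cases n p lam (\<lambda>j. u (\<sigma> j))"
        unfolding trace_cases_def Let_def by blast
      have S: "sum u I = 0 \<or> sum u I = - lam" if "I \<subseteq> {2..n}" "card I = p" for I
        by (rule subset_sums_permute[OF permutes_imp_bij[OF \<sigma>] refl
              subset_sums_of_classification[OF n assms(8,9) C] that])
      have d: "\<forall>j<m. \<not> \<epsilon> j" using DR dg by blast
      show ?L
        by (rule diagonal_imp_pluriclosed[OF jb d]) (rule sums[OF S])
    qed
  next
    assume H: "p \<le> n - 3 \<and> diagonalizable_over_C \<hh> A \<and>
        (\<exists>\<sigma>. \<sigma> permutes {2..n} \<and> (\<forall>j\<in>{2..n - 1}. u (\<sigma> j) = 0) \<and> u (\<sigma> n) = - lam)"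
    then obtain \<sigma> where \<sigma>: "\<sigma> permutes {2..n}" "\<forall>j\<in>{2..n - 1}. u (\<sigma> j) = 0" "u (\<sigma> n) = - lam"
      by blast
    have "2 * Re (\<zeta> i) = 0 \<or> 2 * Re (\<zeta> i) = - lam" if i: "i < m" for i
    proof -
      have "\<tau> i \<in> {2..n}" using \<tau> i by (auto simp: bij_betw_def)
      then obtain j where j: "j \<in> {2..n}" "\<tau> i = \<sigma> j"
        using permutes_image[OF \<sigma>(1)] by (metis imageE)
      then have "j \<in> {2..n - 1} \<or> j = n" by auto
      then show ?thesis using u\<zeta>[of i] i j \<sigma> by auto
    qed
    then show "\<exists>g. pluriclosed_metric br J g"
      using diagonal_imp_pluriclosed_metric[OF jb] H dg by blast
  qed
qed

end
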